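(* Let $\mathfrak{A}$ be a separable unital subhomogeneous C$^*$-algebra, and let $\vec{A} = (A_1, \ldots, A_m)$ and $\vec{B} = (B_1, \ldots, B_m)$ be abelian families in $\mathfrak{A}$. Then the following are equivalent: (1) $\vec{A} \prec_{\mathrm{tr}} \vec{B}$. (2) $\vec{A} \in \overline{\mathrm{conv}}(\mathcal{U}(\vec{B}))$.
   Context: A C$^*$-algebra $\mathfrak{A}$ is subhomogeneous if there exist $N\in\mathbb{N}$ and a faithful representation of $\mathfrak{A}$ that is a direct sum of representations onto matrix algebras of size at most $N$. For a unital C$^*$-algebra $\mathfrak{A}$, an abelian family in $\mathfrak{A}$ is an $m$-tuple $\vec{A}=(A_1,\dots,A_m)\in\mathfrak{A}^m$ of pairwise commuting self-adjoint elements. For continuous $f:\mathbb{R}^m\to\mathbb{R}$, $f(A_1,\dots,A_m)$ is defined by the joint continuous functional calculus. The (joint) unitary orbit is $\mathcal{U}(\vec{A})=\{(U^*A_1U,\dots,U^*A_mU) : U\in\mathfrak{A}\text{ unitary}\}\subseteq\mathfrak{A}^m$, and $\overline{\mathrm{conv}}(\mathcal{U}(\vec{A}))$ is the norm closure in $\mathfrak{A}^m$ of its convex hull. A tracial state on $\mathfrak{A}$ is a unital positive linear functional $\tau$ with $\tau(AB)=\tau(BA)$. $\vec{A}\prec_{\mathrm{tr}}\vec{B}$ means $\tau(f(A_1,\dots,A_m))\le\tau(f(B_1,\dots,B_m))$ for every tracial state $\tau$ on $\mathfrak{A}$ and every continuous convex $f:\mathbb{R}^m\to\mathbb{R}$.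 *)

theory Defs
  imports "HOL-Analysis.Analysis" "Jordan_Normal_Form.Schur_Decomposition"
begin

no_notation vec_index (infixl \<open>$\<close> 100)

section \<open>Unital C*-algebras\<close>

text \<open>
  The library has no complex normed algebras, so complex scalars and the involution are added to
  real unital Banach algebras. As a type class this models one C*-algebra per type; the algebra is
  nonzero, since \<^class>\<open>real_normed_algebra_1\<close> has \<open>0 \<noteq> 1\<close>. That class also requires
  \<open>norm 1 = 1\<close>, which in a nonzero C*-algebra follows from the C*-identity.
\<close>

class unital_cstar_algebra = real_normed_algebra_1 + banach +
  fixes scaleC :: "complex \<Rightarrow> 'a \<Rightarrow> 'a" (infixr \<open>*\<^sub>C\<close> 75)
    and star :: "'a \<Rightarrow> 'a"
  assumes scaleC_add_right: "c *\<^sub>C (x + y) = c *\<^sub>C x + c *\<^sub>C y"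
    and scaleC_add_left: "(c + d) *\<^sub>C x = c *\<^sub>C x + d *\<^sub>C x"
    and scaleC_scaleC: "c *\<^sub>C (d *\<^sub>C x) = (c * d) *\<^sub>C x"
    and scaleC_of_real: "complex_of_real r *\<^sub>C x = r *\<^sub>R x"
    and mult_scaleC_left: "(c *\<^sub>C x) * y = c *\<^sub>C (x * y)"
    and mult_scaleC_right: "x * (c *\<^sub>C y) = c *\<^sub>C (x * y)"
    and norm_scaleC: "norm (c *\<^sub>C x) = cmod c * norm x"
    and star_add: "star (x + y) = star x + star y"
    and star_scaleC: "star (c *\<^sub>C x) = cnj c *\<^sub>C star x"
    and star_mult: "star (x * y) = star y * star x"
    and star_star: "star (star x) = x"
    and cstar_identity: "norm (star x * x) = (norm x)\<^sup>2"

definition self_adjoint :: "'a::unital_cstar_algebra \<Rightarrow> bool"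
  where "self_adjoint x \<longleftrightarrow> star x = x"

definition unitary :: "'a::unital_cstar_algebra \<Rightarrow> bool"
  where "unitary u \<longleftrightarrow> star u * u = 1 \<and> u * star u = 1"

section \<open>Subhomogeneous algebras\<close>

definition rep_onto_matrix_algebra :: "nat \<Rightarrow> ('a::unital_cstar_algebra \<Rightarrow> complex mat) \<Rightarrow> bool"
  where "rep_onto_matrix_algebra n \<pi> \<longleftrightarrow>
    (\<forall>x y. \<pi> (x + y) = \<pi> x + \<pi> y) \<and>
    (\<forall>c x. \<pi> (c *\<^sub>C x) = c \<cdot>\<^sub>m \<pi> x) \<and>
    (\<forall>x y. \<pi> (x * y) = \<pi> x * \<pi> y) \<and>
    (\<forall>x. \<pi> (star x) = mat_adjoint (\<pi> x)) \<and>
    range \<pi> = carrier_mat n n"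

text \<open>
  The operator \<open>\<Oplus>\<^sub>\<pi> \<pi>(x)\<close> on the Hilbert space direct sum of the spaces \<open>\<complex>\<^sup>n\<close>
  is block diagonal and is represented by its family of blocks. The family of representations is
  indexed by itself; repeated summands would not affect faithfulness.
\<close>

definition direct_sum_rep ::
    "('a::unital_cstar_algebra \<Rightarrow> complex mat) set \<Rightarrow> 'a \<Rightarrow> ('a \<Rightarrow> complex mat) \<Rightarrow> complex mat"
  where "direct_sum_rep R x = (\<lambda>\<pi>\<in>R. \<pi> x)"

definition subhomogeneous :: "'a::unital_cstar_algebra itself \<Rightarrow> bool"
  where "subhomogeneous _ \<longleftrightarrow>
    (\<exists>(N::nat) (R :: ('a \<Rightarrow> complex mat) set).
      (\<forall>\<pi>\<in>R. \<exists>n. 1 \<le> n \<and> n \<le> N \<and> rep_onto_matrix_algebra n \<pi>) \<and>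
      inj (direct_sum_rep R))"

section \<open>Abelian families and joint functional calculus\<close>

definition abelian_family :: "('a::unital_cstar_algebra) ^ 'm \<Rightarrow> bool"
  where "abelian_family A \<longleftrightarrow>
    (\<forall>i. self_adjoint (A $ i)) \<and> (\<forall>i j. A $ i * A $ j = A $ j * A $ i)"

definition unital_cstar_subalgebra :: "('a::unital_cstar_algebra) set \<Rightarrow> bool"
  where "unital_cstar_subalgebra S \<longleftrightarrow>
    1 \<in> S \<and> closed S \<and>
    (\<forall>x\<in>S. \<forall>y\<in>S. x + y \<in> S \<and> x * y \<in> S) \<and>
    (\<forall>c. \<forall>x\<in>S. c *\<^sub>C x \<in> S) \<and>
    (\<forall>x\<in>S. star x \<in> S)"

definition cstar_generated :: "('a::unital_cstar_algebra) set \<Rightarrow> 'a set"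
  where "cstar_generated X = \<Inter>{S. unital_cstar_subalgebra S \<and> X \<subseteq> S}"

text \<open>Only the values of \<open>\<phi>\<close> on \<open>S\<close> matter.\<close>

definition character_on :: "('a::unital_cstar_algebra) set \<Rightarrow> ('a \<Rightarrow> complex) \<Rightarrow> bool"
  where "character_on S \<phi> \<longleftrightarrow>
    (\<forall>x\<in>S. \<forall>y\<in>S. \<phi> (x + y) = \<phi> x + \<phi> y \<and> \<phi> (x * y) = \<phi> x * \<phi> y) \<and>
    (\<forall>c. \<forall>x\<in>S. \<phi> (c *\<^sub>C x) = c * \<phi> x) \<and>
    (\<exists>x\<in>S. \<phi> x \<noteq> 0)"

text \<open>
  For an abelian family \<open>A\<close>, the element \<open>f(A\<^sub>1, \<dots>, A\<^sub>m)\<close> is the inverse Gelfand transform, in the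
  commutative algebra generated by \<open>1\<close> and the \<open>A\<^sub>i\<close>, of \<open>\<phi> \<mapsto> f(\<phi>(A\<^sub>1), \<dots>, \<phi>(A\<^sub>m))\<close>. The points
  \<open>(\<phi>(A\<^sub>1), \<dots>, \<phi>(A\<^sub>m))\<close> form the joint spectrum; their coordinates are real because the \<open>A\<^sub>i\<close> are
  self-adjoint, so \<^const>\<open>Re\<close> is only a type conversion.
\<close>

definition joint_fun_calc :: "(real ^ 'm \<Rightarrow> real) \<Rightarrow> ('a::unital_cstar_algebra) ^ 'm \<Rightarrow> 'a"
  where "joint_fun_calc f A =
    (let S = cstar_generated (range (\<lambda>i. A $ i)) in
      THE c. c \<in> S \<and>
        (\<forall>\<phi>. character_on S \<phi> \<longrightarrow> \<phi> c = complex_of_real (f (\<chi> i. Re (\<phi> (A $ i))))))"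

section \<open>Unitary orbits and tracial majorization\<close>

definition unitary_orbit :: "('a::unital_cstar_algebra) ^ 'm \<Rightarrow> ('a ^ 'm) set"
  where "unitary_orbit A = {(\<chi> i. star u * A $ i * u) | u. unitary u}"

definition tracial_state :: "('a::unital_cstar_algebra \<Rightarrow> complex) \<Rightarrow> bool"
  where "tracial_state \<tau> \<longleftrightarrow>
    Vector_Spaces.linear (*\<^sub>C) (*) \<tau> \<and>
    (\<forall>x. \<tau> (star x * x) \<in> \<real>\<^sub>\<ge>\<^sub>0) \<and>
    \<tau> 1 = 1 \<and>
    (\<forall>x y. \<tau> (x * y) = \<tau> (y * x))"

text \<open>
  The elements \<open>f(A)\<close> and \<open>f(B)\<close> are self-adjoint, so their traces are real and \<^const>\<open>Re\<close> is
  again only a type conversion.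
\<close>

definition tracially_majorized :: "('a::unital_cstar_algebra) ^ 'm \<Rightarrow> 'a ^ 'm \<Rightarrow> bool"
    (infix \<open>\<prec>\<^sub>t\<^sub>r\<close> 50)
  where "A \<prec>\<^sub>t\<^sub>r B \<longleftrightarrow>
    (\<forall>\<tau> (f :: real ^ 'm \<Rightarrow> real).
      tracial_state \<tau> \<longrightarrow> continuous_on UNIV f \<longrightarrow> convex_on UNIV f \<longrightarrow>
      Re (\<tau> (joint_fun_calc f A)) \<le> Re (\<tau> (joint_fun_calc f B)))"

end

theory Submission
  imports Defs "HOL-Combinatorics.Cycles"
begin

no_notation scalar_prod (infix \<open>\<bullet>\<close> 70)

text \<open>
  Majorization follows from approximation since a convex \<open>f\<close> is, up to \<open>\<epsilon>\<close>, the maximum of finitely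
  many affine minorants \<open>l\<^sub>j\<close>: with a subordinate partition of unity \<open>p\<^sub>j\<close>, the inequality
  \<open>\<tau>(p\<^sub>j(A) u\<^sup>* l\<^sub>j(B) u) \<le> \<tau>(p\<^sub>j(A) u\<^sup>* f(B) u)\<close> sums up to \<open>\<tau>(f(B))\<close> on the right, and the resulting bound
  is a closed affine condition on \<open>A\<close>.

  For the converse, the traces of the irreducible representations \<open>\<pi>\<close> show that \<open>\<pi>(A)\<close> is majorized by
  \<open>\<pi>(B)\<close>; a separation argument, with a convex function built from a cyclically monotone assignment,
  approximates \<open>\<pi>(A)\<close> by averages of unitary conjugates of \<open>\<pi>(B)\<close>. These local approximations are glued
  by induction on the dimension \<open>n\<close> of the irreducible representations. On the \<open>n\<close>-dimensional ones, the
  ideal of elements that vanish in smaller dimensions contains enough elements \<open>q\<close> that act as scalars;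
  where the approximation obtained for smaller dimensions fails is compact modulo equivalence, so finitely
  many \<open>q\<close> suffice; and \<open>(1 - q) X + q Y\<close> is approximated by averages of unitary conjugates, by switching
  between the unitaries of \<open>X\<close> and \<open>Y\<close> along steep functions of \<open>q\<close>.
\<close>

subsection \<open>Complex matrices\<close>

text \<open>The obstacle is that partitions of unity on the irreducible representations of dimension
  n are not at hand. These representations do not form a closed set, since a limit can be reducible.
  So compactness is applied to all n-dimensional representations in which the error is still large.
  Such a limit is irreducible after all: cutting off the sum of squares of the error at a small
  level gives an element that vanishes in all irreducible representations of smaller dimension but
  not in the limit, and a Burnside argument applies. The elements \<open>q\<close> that play the
  role of functions are scalar only in dimensions up to n and arbitrary above; this is why the
  induction goes upwards and no stage makes a claim about larger dimensions. Only products of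
  exponentials of skew-adjoint elements are used as unitaries: switching from u to v needs a path of
  unitaries, here obtained by scaling exponents, and every unitary matrix lifts to such an
  exponential. Errors are measured in the Hilbert-Schmidt norm, which is invariant under conjugation
  and comes from an inner product; it dominates the operator norm in each representation.\<close>

lemma mat_adjoint_carrier [simp]:
  "A \<in> carrier_mat n m \<Longrightarrow> mat_adjoint A \<in> carrier_mat m n"
  by (auto simp: mat_adjoint_def)

lemma dim_mat_adjoint [simp]:
  "dim_row (mat_adjoint A) = dim_col A" "dim_col (mat_adjoint A) = dim_row A"
  by (auto simp: mat_adjoint_def)

lemma mat_adjoint_index [simp]:
  fixes A :: "complex mat"
  assumes "i < dim_col A" "j < dim_row A"
  shows "mat_adjoint A $$ (i, j) = cnj (A $$ (j, i))"
  using assms by (simp add: mat_adjoint_def mat_of_rows_def)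

lemma mult_mat_index:
  fixes A :: "complex mat"
  assumes "A \<in> carrier_mat n k" "B \<in> carrier_mat k m" "i < n" "j < m"
  shows "(A * B) $$ (i, j) = (\<Sum>l<k. A $$ (i, l) * B $$ (l, j))"
  using assms by (simp add: scalar_prod_def atLeast0LessThan)

lemma mat_adjoint_mult:
  fixes A :: "complex mat"
  assumes A: "A \<in> carrier_mat n k" and B: "B \<in> carrier_mat k m"
  shows "mat_adjoint (A * B) = mat_adjoint B * mat_adjoint A"
proof (rule eq_matI)
  fix i j assume "i < dim_row (mat_adjoint B * mat_adjoint A)" "j < dim_col (mat_adjoint B * mat_adjoint A)"
  then have ij: "i < m" "j < n" using assms by auto
  have "(mat_adjoint B * mat_adjoint A) $$ (i, j) = (\<Sum>l<k. mat_adjoint B $$ (i, l) * mat_adjoint A $$ (l, j))"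
    by (rule mult_mat_index[of _ m k _ n]) (use assms ij in auto)
  also have "\<dots> = cnj ((A * B) $$ (j, i))"
    by (subst mult_mat_index[OF A B ij(2,1)]) (use assms ij in \<open>auto intro!: sum.cong\<close>)
  finally show "mat_adjoint (A * B) $$ (i, j) = (mat_adjoint B * mat_adjoint A) $$ (i, j)"
    using assms ij by simp
qed (use assms in auto)

lemma mat_adjoint_adjoint [simp]: "mat_adjoint (mat_adjoint A) = (A :: complex mat)"
  by (rule eq_matI) auto

lemma mat_adjoint_smult: "mat_adjoint (c \<cdot>\<^sub>m A) = cnj c \<cdot>\<^sub>m mat_adjoint (A :: complex mat)"
  by (rule eq_matI) auto

lemma mat_adjoint_one [simp]: "mat_adjoint (1\<^sub>m n) = (1\<^sub>m n :: complex mat)"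
  by (rule eq_matI) auto

definition mtr :: "complex mat \<Rightarrow> complex"
  where "mtr A = (\<Sum>i<dim_row A. A $$ (i, i))"

lemma mtr_carrier: "A \<in> carrier_mat n n \<Longrightarrow> mtr A = (\<Sum>i<n. A $$ (i, i))"
  by (auto simp: mtr_def)

lemma mtr_comm:
  assumes A: "A \<in> carrier_mat n k" and B: "B \<in> carrier_mat k n"
  shows "mtr (A * B) = mtr (B * A)"
proof -
  have "mtr (A * B) = (\<Sum>i<n. \<Sum>l<k. A $$ (i, l) * B $$ (l, i))"
    using A by (simp add: mtr_def mult_mat_index[OF A B] del: index_mult_mat(1))
  also have "\<dots> = (\<Sum>l<k. \<Sum>i<n. B $$ (l, i) * A $$ (i, l))"
    by (subst sum.swap) (simp add: mult.commute)
  also have "\<dots> = mtr (B * A)"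
    using B by (simp add: mtr_def mult_mat_index[OF B A] del: index_mult_mat(1))
  finally show ?thesis .
qed

lemma mtr_add: "A \<in> carrier_mat n n \<Longrightarrow> B \<in> carrier_mat n n \<Longrightarrow> mtr (A + B) = mtr A + mtr B"
  by (simp add: mtr_def sum.distrib)

lemma mtr_smult: "A \<in> carrier_mat n n \<Longrightarrow> mtr (c \<cdot>\<^sub>m A) = c * mtr A"
  by (simp add: mtr_def sum_distrib_left)

lemma mtr_one [simp]: "mtr (1\<^sub>m n) = of_nat n"
  by (simp add: mtr_def)

lemma cmod_square: "(complex_of_real (cmod z))\<^sup>2 = z * cnj z"
  using complex_norm_square[of z] by simp

lemma mtr_adjoint_mult:
  assumes A: "A \<in> carrier_mat n k"
  shows "mtr (mat_adjoint A * A) = of_real (\<Sum>j<k. \<Sum>i<n. (cmod (A $$ (i, j)))\<^sup>2)"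
  using A by (simp add: mtr_def mult_mat_index[OF mat_adjoint_carrier[OF A] A] cmod_square mult.commute
      del: index_mult_mat(1))

lemma adjoint_mult_eq_0:
  fixes A :: "complex mat"
  assumes A: "A \<in> carrier_mat n k" and 0: "mat_adjoint A * A = 0\<^sub>m k k"
  shows "A = 0\<^sub>m n k"
proof -
  have "mtr (mat_adjoint A * A) = 0" by (simp add: 0 mtr_def)
  then have "(\<Sum>j<k. \<Sum>i<n. (cmod (A $$ (i, j)))\<^sup>2) = 0"
    unfolding mtr_adjoint_mult[OF A] by (simp only: of_real_eq_0_iff)
  then have "\<forall>j<k. \<forall>i<n. A $$ (i, j) = 0"
    by (subst (asm) sum_nonneg_eq_0_iff) (auto intro!: sum_nonneg simp: sum_nonneg_eq_0_iff)
  then show ?thesis using A by (intro eq_matI) auto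
qed

section \<open>Isometries, subspaces and orthonormal bases\<close>

definition isometry_mat :: "nat \<Rightarrow> nat \<Rightarrow> complex mat \<Rightarrow> bool"
  where "isometry_mat n k V \<longleftrightarrow> V \<in> carrier_mat n k \<and> mat_adjoint V * V = 1\<^sub>m k"

definition unitary_mat :: "nat \<Rightarrow> complex mat \<Rightarrow> bool"
  where "unitary_mat n U \<longleftrightarrow> U \<in> carrier_mat n n \<and> mat_adjoint U * U = 1\<^sub>m n \<and> U * mat_adjoint U = 1\<^sub>m n"

lemma isometry_mat_square: "isometry_mat n n U \<Longrightarrow> unitary_mat n U"
  unfolding isometry_mat_def unitary_mat_def
  by (meson mat_adjoint_carrier mat_mult_left_right_inverse)

lemma unitary_mat_adjoint: "unitary_mat n U \<Longrightarrow> unitary_mat n (mat_adjoint U)"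
  by (auto simp: unitary_mat_def)

text \<open>The projection \<open>Q\<close> onto the complement of the range of \<open>V\<close> has
  trace n - k, and this trace is also its squared Hilbert-Schmidt norm. So n - k is nonnegative, and
  if it is positive, some column of \<open>Q\<close> is a nonzero vector orthogonal to the
  range.\<close>

lemma isometry_defect:
  assumes V: "isometry_mat n k V"
  shows "k \<le> n" and "k < n \<Longrightarrow> \<exists>t \<in> carrier_mat n 1. t \<noteq> 0\<^sub>m n 1 \<and> mat_adjoint V * t = 0\<^sub>m k 1"
proof -
  have Vc: "V \<in> carrier_mat n k" and VV: "mat_adjoint V * V = 1\<^sub>m k"
    using V by (auto simp: isometry_mat_def)
  have ac: "mat_adjoint V \<in> carrier_mat k n" using Vc by simp
  define Q where "Q = 1\<^sub>m n - V * mat_adjoint V"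
  have Qc: "Q \<in> carrier_mat n n" using Vc by (auto simp: Q_def)
  have VVc: "V * mat_adjoint V \<in> carrier_mat n n" using Vc by auto
  have Qadj: "mat_adjoint Q = Q"
  proof -
    have "mat_adjoint (V * mat_adjoint V) = V * mat_adjoint V"
      by (subst mat_adjoint_mult[OF Vc ac]) simp
    then have e: "cnj ((V * mat_adjoint V) $$ (j, i)) = (V * mat_adjoint V) $$ (i, j)"
      if "i < n" "j < n" for i j
      using that VVc mat_adjoint_index[of i "V * mat_adjoint V" j] by (metis carrier_matD)
    show ?thesis
      using VVc by (intro eq_matI) (auto simp: Q_def e simp del: index_mult_mat(1))
  qed
  have aQ: "mat_adjoint V * Q = 0\<^sub>m k n"
  proof -
    have "mat_adjoint V * Q = mat_adjoint V * 1\<^sub>m n - mat_adjoint V * (V * mat_adjoint V)"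
      unfolding Q_def by (rule mult_minus_distrib_mat[OF ac _ VVc]) simp
    also have "mat_adjoint V * (V * mat_adjoint V) = mat_adjoint V"
      using assoc_mult_mat[OF ac Vc ac] VV left_mult_one_mat[OF ac] by simp
    finally show ?thesis using ac right_mult_one_mat[OF ac] by (auto intro!: eq_matI)
  qed
  have QQ: "mat_adjoint Q * Q = Q"
  proof -
    have "Q * Q = 1\<^sub>m n * Q - V * mat_adjoint V * Q"
      by (subst (1) Q_def, rule minus_mult_distrib_mat[OF _ VVc Qc]) simp
    also have "V * mat_adjoint V * Q = 0\<^sub>m n n"
      using assoc_mult_mat[OF Vc ac Qc] aQ Vc by simp
    finally show ?thesis using Qc Qadj by (auto intro!: eq_matI)
  qed
  have trQ: "mtr Q = of_nat n - of_nat k"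
  proof -
    have "mtr (V * mat_adjoint V) = of_nat k"
      using mtr_comm[OF Vc ac] VV by simp
    moreover have "mtr Q = mtr (1\<^sub>m n) - mtr (V * mat_adjoint V)"
      using VVc Vc unfolding Q_def mtr_def by (simp add: sum_subtractf del: index_mult_mat(1))
    ultimately show ?thesis by simp
  qed
  have "complex_of_real (\<Sum>j<n. \<Sum>i<n. (cmod (Q $$ (i, j)))\<^sup>2) = of_nat n - of_nat k"
    using mtr_adjoint_mult[OF Qc] QQ trQ by simp
  then have "complex_of_real (\<Sum>j<n. \<Sum>i<n. (cmod (Q $$ (i, j)))\<^sup>2) = complex_of_real (real n - real k)"
    by simp
  then have e: "(\<Sum>j<n. \<Sum>i<n. (cmod (Q $$ (i, j)))\<^sup>2) = real n - real k"
    using of_real_eq_iff by blast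
  moreover have "(\<Sum>j<n. \<Sum>i<n. (cmod (Q $$ (i, j)))\<^sup>2) \<ge> 0" by (intro sum_nonneg) auto
  ultimately show "k \<le> n" by simp
  assume "k < n"
  with e have "(\<Sum>j<n. \<Sum>i<n. (cmod (Q $$ (i, j)))\<^sup>2) \<noteq> 0" by simp
  then obtain j where j: "j < n" "(\<Sum>i<n. (cmod (Q $$ (i, j)))\<^sup>2) \<noteq> 0"
    by (meson lessThan_iff sum.neutral)
  then obtain i where i: "i < n" "Q $$ (i, j) \<noteq> 0"
    by (metis (mono_tags, lifting) lessThan_iff norm_zero power_zero_numeral sum.neutral)
  define t where "t = mat n 1 (\<lambda>(i, _). Q $$ (i, j))"
  have tc: "t \<in> carrier_mat n 1" by (simp add: t_def)
  have "mat_adjoint V * t = 0\<^sub>m k 1"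
  proof (rule eq_matI)
    fix a b assume "a < dim_row (0\<^sub>m k 1 :: complex mat)" "b < dim_col (0\<^sub>m k 1 :: complex mat)"
    then have ab: "a < k" "b = 0" by auto
    have "(mat_adjoint V * t) $$ (a, b) = (\<Sum>l<n. mat_adjoint V $$ (a, l) * t $$ (l, b))"
      by (rule mult_mat_index[OF ac tc]) (use ab in auto)
    also have "\<dots> = (mat_adjoint V * Q) $$ (a, j)"
      by (subst mult_mat_index[OF ac Qc]) (use ab j in \<open>auto simp: t_def\<close>)
    finally show "(mat_adjoint V * t) $$ (a, b) = 0\<^sub>m k 1 $$ (a, b)"
      using aQ ab j by simp
  qed (use ac tc in auto)
  moreover have "t \<noteq> 0\<^sub>m n 1"
  proof
    assume "t = 0\<^sub>m n 1"
    then have "t $$ (i, 0) = 0" using i by simp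
    then show False using i by (simp add: t_def)
  qed
  ultimately show "\<exists>t \<in> carrier_mat n 1. t \<noteq> 0\<^sub>m n 1 \<and> mat_adjoint V * t = 0\<^sub>m k 1"
    using tc by blast
qed

definition append_col :: "nat \<Rightarrow> nat \<Rightarrow> complex mat \<Rightarrow> complex mat \<Rightarrow> complex mat"
  where "append_col n k V w = mat n (Suc k) (\<lambda>(i, j). if j < k then V $$ (i, j) else w $$ (i, 0))"

lemma append_col_carrier [simp]: "append_col n k V w \<in> carrier_mat n (Suc k)"
  by (simp add: append_col_def)

lemma append_col_index:
  "i < n \<Longrightarrow> j < Suc k \<Longrightarrow> append_col n k V w $$ (i, j) = (if j < k then V $$ (i, j) else w $$ (i, 0))"
  by (simp add: append_col_def)

lemma append_col_isometry:
  assumes V: "isometry_mat n k V" and w: "w \<in> carrier_mat n 1"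
    and ww: "mat_adjoint w * w = 1\<^sub>m 1" and Vw: "mat_adjoint V * w = 0\<^sub>m k 1"
  shows "isometry_mat n (Suc k) (append_col n k V w)"
proof -
  let ?W = "append_col n k V w"
  have Vc: "V \<in> carrier_mat n k" and VV: "mat_adjoint V * V = 1\<^sub>m k"
    using V by (auto simp: isometry_mat_def)
  have Wd: "dim_row ?W = n" "dim_col ?W = Suc k" by (auto simp: append_col_def)
  have e1: "(\<Sum>l<n. cnj (V $$ (l, i)) * V $$ (l, j)) = (if i = j then 1 else 0)" if "i < k" "j < k" for i j
    using that arg_cong[OF VV, of "\<lambda>M. M $$ (i, j)"] mult_mat_index[OF mat_adjoint_carrier[OF Vc] Vc that] Vc
    by simp
  have e2: "(\<Sum>l<n. cnj (V $$ (l, i)) * w $$ (l, 0)) = 0" if "i < k" for i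
    using that arg_cong[OF Vw, of "\<lambda>M. M $$ (i, 0)"] mult_mat_index[OF mat_adjoint_carrier[OF Vc] w that] Vc
    by simp
  have e3: "(\<Sum>l<n. cnj (w $$ (l, 0)) * w $$ (l, 0)) = 1"
    using arg_cong[OF ww, of "\<lambda>M. M $$ (0, 0)"] mult_mat_index[OF mat_adjoint_carrier[OF w] w] w
    by simp
  have e4: "(\<Sum>l<n. cnj (w $$ (l, 0)) * V $$ (l, i)) = 0" if "i < k" for i
    using arg_cong[OF e2[OF that], of cnj] by (simp add: mult.commute)
  have "mat_adjoint ?W * ?W = 1\<^sub>m (Suc k)"
  proof (rule eq_matI)
    fix i j assume "i < dim_row (1\<^sub>m (Suc k) :: complex mat)" "j < dim_col (1\<^sub>m (Suc k) :: complex mat)"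
    then have ij: "i < Suc k" "j < Suc k" by auto
    have "(mat_adjoint ?W * ?W) $$ (i, j) = (\<Sum>l<n. cnj (?W $$ (l, i)) * ?W $$ (l, j))"
      using mult_mat_index[of "mat_adjoint ?W" "Suc k" n ?W "Suc k" i j] ij by (simp add: Wd)
    also have "\<dots> = (\<Sum>l<n. cnj (if i < k then V $$ (l, i) else w $$ (l, 0)) * (if j < k then V $$ (l, j) else w $$ (l, 0)))"
      using ij by (intro sum.cong) (auto simp: append_col_index)
    also have "\<dots> = (if i = j then 1 else 0)"
      using ij by (cases "i < k"; cases "j < k") (auto simp: e1 e2 e3 e4)
    finally show "(mat_adjoint ?W * ?W) $$ (i, j) = 1\<^sub>m (Suc k) $$ (i, j)" using ij by simp
  qed (auto simp: append_col_def)
  then show ?thesis by (simp add: isometry_mat_def)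
qed

lemma append_col_mult:
  assumes V: "V \<in> carrier_mat n k" and c: "c \<in> carrier_mat (Suc k) 1" and w: "w \<in> carrier_mat n 1"
  shows "append_col n k V w * c = V * mat k 1 (\<lambda>(i, _). c $$ (i, 0)) + c $$ (k, 0) \<cdot>\<^sub>m w"
proof (rule eq_matI)
  let ?c = "mat k 1 (\<lambda>(i, _). c $$ (i, 0))"
  fix i j assume "i < dim_row (V * ?c + c $$ (k, 0) \<cdot>\<^sub>m w)" "j < dim_col (V * ?c + c $$ (k, 0) \<cdot>\<^sub>m w)"
  then have ij: "i < n" "j = 0" using w by auto
  have "(append_col n k V w * c) $$ (i, j) = (\<Sum>l<Suc k. append_col n k V w $$ (i, l) * c $$ (l, 0))"
    by (simp only: ij(2), rule mult_mat_index) (use ij c in auto)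
  also have "\<dots> = (\<Sum>l<k. V $$ (i, l) * ?c $$ (l, 0)) + c $$ (k, 0) * w $$ (i, 0)"
    using ij by (simp add: append_col_index)
  also have "(\<Sum>l<k. V $$ (i, l) * ?c $$ (l, 0)) = (V * ?c) $$ (i, 0)"
    by (rule mult_mat_index[symmetric]) (use ij V in auto)
  finally show "(append_col n k V w * c) $$ (i, j) = (V * ?c + c $$ (k, 0) \<cdot>\<^sub>m w) $$ (i, j)"
    using ij w V by (simp del: index_mult_mat(1))
qed (use w c in \<open>auto simp: append_col_def\<close>)

lemma normalize_col:
  fixes v :: "complex mat"
  assumes v: "v \<in> carrier_mat n 1" "v \<noteq> 0\<^sub>m n 1"
  obtains c where "c \<noteq> 0" "mat_adjoint (c \<cdot>\<^sub>m v) * (c \<cdot>\<^sub>m v) = 1\<^sub>m 1"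
proof -
  define s where "s = (\<Sum>i<n. (cmod (v $$ (i, 0)))\<^sup>2)"
  have "\<exists>i<n. v $$ (i, 0) \<noteq> 0"
  proof (rule ccontr)
    assume "\<not> ?thesis"
    then have "v = 0\<^sub>m n 1" using v by (intro eq_matI) auto
    then show False using v by simp
  qed
  then obtain i where "i < n" "v $$ (i, 0) \<noteq> 0" by blast
  then have s: "s > 0" unfolding s_def by (intro sum_pos2[of _ i]) auto
  have m: "(mat_adjoint v * v) = of_real s \<cdot>\<^sub>m 1\<^sub>m 1"
  proof (rule eq_matI)
    fix a b assume "a < dim_row (complex_of_real s \<cdot>\<^sub>m 1\<^sub>m 1)" "b < dim_col (complex_of_real s \<cdot>\<^sub>m 1\<^sub>m 1)"
    then have ab: "a = 0" "b = 0" by auto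
    have "(mat_adjoint v * v) $$ (0, 0) = (\<Sum>l<n. mat_adjoint v $$ (0, l) * v $$ (l, 0))"
      by (rule mult_mat_index) (use v in auto)
    then show "(mat_adjoint v * v) $$ (a, b) = (complex_of_real s \<cdot>\<^sub>m 1\<^sub>m 1) $$ (a, b)"
      using v by (simp add: ab s_def cmod_square mult.commute del: index_mult_mat(1))
  qed (use v in auto)
  define c where "c = complex_of_real (1 / sqrt s)"
  have "mat_adjoint (c \<cdot>\<^sub>m v) * (c \<cdot>\<^sub>m v) = (c * c) \<cdot>\<^sub>m (mat_adjoint v * v)"
    using v unfolding mat_adjoint_smult
    by (subst mult_smult_assoc_mat[of _ 1 n _ 1]) (auto simp: mult_smult_distrib[of _ 1 n _ 1] c_def intro!: eq_matI)
  also have "\<dots> = 1\<^sub>m 1"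
  proof -
    have "c * c * of_real s = of_real (1 / sqrt s * (1 / sqrt s) * s)" unfolding c_def by (simp only: of_real_mult)
    also have "1 / sqrt s * (1 / sqrt s) * s = 1" using s by simp
    finally show ?thesis by (auto simp: m intro!: eq_matI)
  qed
  finally show ?thesis using that[of c] s by (simp add: c_def)
qed

lemma add_neg_self_mat: "A \<in> carrier_mat n k \<Longrightarrow> A + (-1) \<cdot>\<^sub>m A = (0\<^sub>m n k :: complex mat)"
  by (rule eq_matI) auto

text \<open>Vectors are matrices with one column, so that application to a vector, scalar products
  and composition are all the same matrix product.\<close>

definition col_subspace :: "nat \<Rightarrow> complex mat set \<Rightarrow> bool"
  where "col_subspace n T \<longleftrightarrow> T \<subseteq> carrier_mat n 1 \<and> 0\<^sub>m n 1 \<in> T \<and>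
    (\<forall>s\<in>T. \<forall>t\<in>T. s + t \<in> T) \<and> (\<forall>c. \<forall>t\<in>T. c \<cdot>\<^sub>m t \<in> T)"

lemma ex_max_nat:
  fixes P :: "nat \<Rightarrow> bool"
  assumes "P k0" "\<And>k. P k \<Longrightarrow> k \<le> n"
  obtains k where "P k" "\<not> P (Suc k)"
proof -
  have "P (GREATEST k. P k)" using assms by (rule GreatestI_nat)
  moreover have "\<not> P (Suc (GREATEST k. P k))"
    using assms(2) by (metis Greatest_le_nat Suc_n_not_le_n)
  ultimately show ?thesis using that by blast
qed

text \<open>\<open>V\<close> is chosen with as many columns as possible;
  \<open>isometry_defect\<close> bounds their number. If the projection onto the range of
  \<open>V\<close> moved some \<open>t\<close> in \<open>T\<close>, the normalized remainder of
  \<open>t\<close> could be appended.\<close>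

lemma orthonormal_basis:
  assumes T: "col_subspace n T"
  obtains k V where "isometry_mat n k V" "\<And>c. c \<in> carrier_mat k 1 \<Longrightarrow> V * c \<in> T"
    "\<And>t. t \<in> T \<Longrightarrow> V * (mat_adjoint V * t) = t"
proof -
  let ?P = "\<lambda>k. \<exists>V. isometry_mat n k V \<and> (\<forall>c\<in>carrier_mat k 1. V * c \<in> T)"
  have Tc: "T \<subseteq> carrier_mat n 1" and T0: "0\<^sub>m n 1 \<in> T"
    and Tadd: "\<And>s t. s \<in> T \<Longrightarrow> t \<in> T \<Longrightarrow> s + t \<in> T" and Tsm: "\<And>c t. t \<in> T \<Longrightarrow> c \<cdot>\<^sub>m t \<in> T"
    using T by (auto simp: col_subspace_def)
  have P0: "?P 0"
  proof (intro exI[of _ "0\<^sub>m n 0"] conjI ballI)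
    show "isometry_mat n 0 (0\<^sub>m n 0)" by (auto simp: isometry_mat_def)
    fix c :: "complex mat" assume "c \<in> carrier_mat 0 1"
    then have "0\<^sub>m n 0 * c = 0\<^sub>m n 1" by (intro eq_matI) (auto simp: scalar_prod_def)
    then show "0\<^sub>m n 0 * c \<in> T" using T0 by simp
  qed
  obtain k where k: "?P k" "\<not> ?P (Suc k)"
    by (rule ex_max_nat[of ?P 0 n]) (use P0 isometry_defect(1) in auto)
  then obtain V where V: "isometry_mat n k V" and VT: "\<forall>c\<in>carrier_mat k 1. V * c \<in> T" by blast
  have Vc: "V \<in> carrier_mat n k" and VV: "mat_adjoint V * V = 1\<^sub>m k"
    using V by (auto simp: isometry_mat_def)
  have ac: "mat_adjoint V \<in> carrier_mat k n" using Vc by simp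
  have "V * (mat_adjoint V * t) = t" if t: "t \<in> T" for t
  proof (rule ccontr)
    assume ne: "V * (mat_adjoint V * t) \<noteq> t"
    have tc: "t \<in> carrier_mat n 1" using t Tc by auto
    have atc: "mat_adjoint V * t \<in> carrier_mat k 1" using ac tc by simp
    define s where "s = t + (-1) \<cdot>\<^sub>m (V * (mat_adjoint V * t))"
    have VtT: "V * (mat_adjoint V * t) \<in> T" using VT atc by blast
    have sT: "s \<in> T" unfolding s_def using Tadd t Tsm VtT by blast
    have sc: "s \<in> carrier_mat n 1" using sT Tc by auto
    have Vtc: "V * (mat_adjoint V * t) \<in> carrier_mat n 1" using Vc atc by simp
    have s0: "s \<noteq> 0\<^sub>m n 1"
    proof
      assume s0: "s = 0\<^sub>m n 1"
      have "V * (mat_adjoint V * t) = t"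
      proof (rule eq_matI)
        fix i j assume ij: "i < dim_row t" "j < dim_col t"
        then have "s $$ (i, j) = 0" using s0 tc by simp
        moreover have "s $$ (i, j) = t $$ (i, j) - (V * (mat_adjoint V * t)) $$ (i, j)"
          unfolding s_def using ij tc Vtc Vc by (simp del: index_mult_mat(1))
        ultimately show "(V * (mat_adjoint V * t)) $$ (i, j) = t $$ (i, j)" by simp
      qed (use Vtc tc in auto)
      then show False using ne by simp
    qed
    have as: "mat_adjoint V * s = 0\<^sub>m k 1"
    proof -
      have "mat_adjoint V * s = mat_adjoint V * t + (-1) \<cdot>\<^sub>m (mat_adjoint V * (V * (mat_adjoint V * t)))"
        unfolding s_def using ac tc Vtc
        by (simp add: mult_add_distrib_mat[OF ac tc] mult_smult_distrib[OF ac Vtc])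
      also have "mat_adjoint V * (V * (mat_adjoint V * t)) = mat_adjoint V * t"
        using assoc_mult_mat[OF ac Vc atc] VV left_mult_one_mat[OF atc] by simp
      finally show ?thesis using add_neg_self_mat[OF atc] by simp
    qed
    obtain c where c: "c \<noteq> 0" "mat_adjoint (c \<cdot>\<^sub>m s) * (c \<cdot>\<^sub>m s) = 1\<^sub>m 1"
      using normalize_col[OF sc s0] .
    define w where "w = c \<cdot>\<^sub>m s"
    have wT: "w \<in> T" unfolding w_def using Tsm sT by blast
    have wc: "w \<in> carrier_mat n 1" using wT Tc by auto
    have aw: "mat_adjoint V * w = 0\<^sub>m k 1"
      unfolding w_def by (simp add: mult_smult_distrib[OF ac sc] as)
    have "isometry_mat n (Suc k) (append_col n k V w)"
      using append_col_isometry[OF V wc] c(2) aw by (simp add: w_def)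
    moreover have "append_col n k V w * d \<in> T" if "d \<in> carrier_mat (Suc k) 1" for d
      unfolding append_col_mult[OF Vc that wc] using VT Tadd Tsm wT by simp
    ultimately show False using k(2) by blast
  qed
  then show ?thesis using that V VT by blast
qed

text \<open>The compression of \<open>a\<close> to \<open>T\<close> is a nonempty square matrix, so
  its characteristic polynomial has a complex root; invariance of \<open>T\<close> turns an
  eigenvector of the compression into one of \<open>a\<close>.\<close>

lemma invariant_eigenvector:
  assumes T: "col_subspace n T" and a: "a \<in> carrier_mat n n"
    and inv: "\<And>t. t \<in> T \<Longrightarrow> a * t \<in> T" and t0: "t0 \<in> T" "t0 \<noteq> 0\<^sub>m n 1"
  obtains v c where "v \<in> T" "v \<noteq> 0\<^sub>m n 1" "a * v = c \<cdot>\<^sub>m v"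
proof -
  obtain k V where V: "isometry_mat n k V" and VT: "\<And>c. c \<in> carrier_mat k 1 \<Longrightarrow> V * c \<in> T"
    and Vt: "\<And>t. t \<in> T \<Longrightarrow> V * (mat_adjoint V * t) = t"
    using orthonormal_basis[OF T] by metis
  have Vc: "V \<in> carrier_mat n k" and VV: "mat_adjoint V * V = 1\<^sub>m k"
    using V by (auto simp: isometry_mat_def)
  have ac: "mat_adjoint V \<in> carrier_mat k n" using Vc by simp
  have Tc: "T \<subseteq> carrier_mat n 1" using T by (auto simp: col_subspace_def)
  have k: "k > 0"
  proof (rule ccontr)
    assume "\<not> k > 0"
    then have "V * (mat_adjoint V * t0) = 0\<^sub>m n 1"
      using Vc t0 Tc by (intro eq_matI) (auto simp: scalar_prod_def)
    then show False using Vt t0 by simp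
  qed
  define b where "b = mat_adjoint V * (a * V)"
  have bc: "b \<in> carrier_mat k k" unfolding b_def using Vc a by auto
  obtain as where as: "char_poly b = (\<Prod>a\<leftarrow>as. [:- a, 1:])" "length as = k"
    using char_poly_factorized[OF bc] by blast
  then have "poly (char_poly b) (hd as) = 0"
    using k by (cases as) auto
  then have "eigenvalue b (hd as)"
    using eigenvalue_root_char_poly[OF bc] by blast
  then obtain w where w: "eigenvector b w (hd as)"
    by (auto simp: eigenvalue_def)
  define l where "l = hd as"
  then have wc: "w \<in> carrier_vec k" and w0: "w \<noteq> 0\<^sub>v k" and bw: "b *\<^sub>v w = l \<cdot>\<^sub>v w"
    using bc w by (auto simp: eigenvector_def l_def)
  define d where "d = mat k 1 (\<lambda>(i, _). vec_index w i)"
  have dc: "d \<in> carrier_mat k 1" by (simp add: d_def)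
  have colw: "col d 0 = w" using wc by (auto simp: d_def)
  have bd: "b * d = l \<cdot>\<^sub>m d"
  proof (rule eq_matI)
    fix i j assume "i < dim_row (l \<cdot>\<^sub>m d)" "j < dim_col (l \<cdot>\<^sub>m d)"
    then have ij: "i < k" "j = 0" using dc by auto
    have "(b * d) $$ (i, j) = vec_index (b *\<^sub>v w) i" using ij bc dc colw by simp
    then show "(b * d) $$ (i, j) = (l \<cdot>\<^sub>m d) $$ (i, j)" using ij bw wc by (simp add: d_def)
  qed (use bc dc in auto)
  have d0: "d \<noteq> 0\<^sub>m k 1"
  proof
    assume "d = 0\<^sub>m k 1"
    then have "w = 0\<^sub>v k" unfolding colw[symmetric] by (auto intro!: eq_vecI)
    then show False using w0 by simp
  qed
  define v where "v = V * d"
  have vT: "v \<in> T" unfolding v_def by (rule VT[OF dc])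
  have vc: "v \<in> carrier_mat n 1" using vT Tc by auto
  have "v \<noteq> 0\<^sub>m n 1"
  proof
    assume "v = 0\<^sub>m n 1"
    then have "mat_adjoint V * v = 0\<^sub>m k 1" using right_mult_zero_mat[OF ac] by simp
    moreover have "mat_adjoint V * v = d"
      unfolding v_def using assoc_mult_mat[OF ac Vc dc] VV dc by simp
    ultimately show False using d0 by simp
  qed
  moreover have "a * v = l \<cdot>\<^sub>m v"
  proof -
    have aVc: "a * V \<in> carrier_mat n k" using a Vc by simp
    have av: "a * v = (a * V) * d" unfolding v_def using a Vc dc by simp
    have "a * v = V * (mat_adjoint V * (a * v))" by (rule Vt[OF inv[OF vT], symmetric])
    then have "a * v = V * (mat_adjoint V * (a * V * d))" by (simp only: av)
    also have "mat_adjoint V * (a * V * d) = b * d"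
      unfolding b_def using assoc_mult_mat[OF ac aVc dc] by simp
    also have "V * (b * d) = l \<cdot>\<^sub>m v" unfolding bd v_def by (rule mult_smult_distrib[OF Vc dc])
    finally show ?thesis .
  qed
  ultimately show ?thesis using that vT by blast
qed

section \<open>Joint diagonalization of commuting Hermitian matrices\<close>

lemma common_eigenvector:
  assumes "finite I" and a: "\<And>i. i \<in> I \<Longrightarrow> a i \<in> carrier_mat n n"
    and comm: "\<And>i j. i \<in> I \<Longrightarrow> j \<in> I \<Longrightarrow> a i * a j = a j * a i"
    and T: "col_subspace n T" and inv: "\<And>i t. i \<in> I \<Longrightarrow> t \<in> T \<Longrightarrow> a i * t \<in> T"
    and t0: "t0 \<in> T" "t0 \<noteq> 0\<^sub>m n 1"
  shows "\<exists>v\<in>T. v \<noteq> 0\<^sub>m n 1 \<and> (\<forall>i\<in>I. \<exists>c. a i * v = c \<cdot>\<^sub>m v)"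
  using assms
proof (induction I arbitrary: T t0 rule: finite_induct)
  case empty
  then show ?case by blast
next
  case (insert i I)
  note T = \<open>col_subspace n T\<close>
  have Tc: "T \<subseteq> carrier_mat n 1" using T by (auto simp: col_subspace_def)
  have ai: "a i \<in> carrier_mat n n" using insert.prems by simp
  obtain v c where v: "v \<in> T" "v \<noteq> 0\<^sub>m n 1" "a i * v = c \<cdot>\<^sub>m v"
    using invariant_eigenvector[OF T ai, of t0] insert.prems by blast
  \<comment> \<open>The eigenspace of \<open>a i\<close> inside \<open>T\<close> is invariant under
    the remaining matrices because they commute with \<open>a i\<close>, so the induction hypothesis
    applies to it.\<close>
  define T' where "T' = {t \<in> T. a i * t = c \<cdot>\<^sub>m t}"
  have T': "col_subspace n T'"
    unfolding col_subspace_def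
  proof (intro conjI ballI allI)
    show "T' \<subseteq> carrier_mat n 1" using Tc by (auto simp: T'_def)
    show "0\<^sub>m n 1 \<in> T'" using T right_mult_zero_mat[OF ai] by (auto simp: T'_def col_subspace_def)
    fix s t assume "s \<in> T'" "t \<in> T'"
    then have st: "s \<in> T" "t \<in> T" "a i * s = c \<cdot>\<^sub>m s" "a i * t = c \<cdot>\<^sub>m t" by (auto simp: T'_def)
    then have "s \<in> carrier_mat n 1" "t \<in> carrier_mat n 1" using Tc by auto
    then have "a i * (s + t) = c \<cdot>\<^sub>m (s + t)"
      using mult_add_distrib_mat[OF ai] st(3,4) add_smult_distrib_left_mat by metis
    then show "s + t \<in> T'" using st T by (auto simp: T'_def col_subspace_def)
  next
    fix d t assume "t \<in> T'"
    then have st: "t \<in> T" "a i * t = c \<cdot>\<^sub>m t" by (auto simp: T'_def)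
    then have tc: "t \<in> carrier_mat n 1" using Tc by auto
    have "a i * (d \<cdot>\<^sub>m t) = c \<cdot>\<^sub>m (d \<cdot>\<^sub>m t)"
      unfolding mult_smult_distrib[OF ai tc] st(2) by (auto intro!: eq_matI)
    then show "d \<cdot>\<^sub>m t \<in> T'" using st T by (auto simp: T'_def col_subspace_def)
  qed
  have inv': "a j * t \<in> T'" if j: "j \<in> I" and t: "t \<in> T'" for j t
  proof -
    have tc: "t \<in> carrier_mat n 1" using t Tc by (auto simp: T'_def)
    have aj: "a j \<in> carrier_mat n n" using insert.prems j by simp
    have "a i * (a j * t) = a j * (a i * t)"
      using assoc_mult_mat[OF ai aj tc] assoc_mult_mat[OF aj ai tc] insert.prems(2)[of i j] j by simp
    also have "\<dots> = c \<cdot>\<^sub>m (a j * t)" using t mult_smult_distrib[OF aj tc] by (simp add: T'_def)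
    finally show ?thesis using t j insert.prems(4) by (simp add: T'_def)
  qed
  have "\<exists>w\<in>T'. w \<noteq> 0\<^sub>m n 1 \<and> (\<forall>j\<in>I. \<exists>c. a j * w = c \<cdot>\<^sub>m w)"
    by (rule insert.IH[OF _ _ T' inv', of v]) (use insert.prems v in \<open>auto simp: T'_def\<close>)
  then show ?case by (auto simp: T'_def)
qed

lemma diagonal_mat_append:
  assumes "D \<in> carrier_mat k k" "diagonal_mat D" "a \<in> carrier_mat n n" "V \<in> carrier_mat n k" "w \<in> carrier_mat n 1"
    "a * V = V * D" "a * w = c \<cdot>\<^sub>m w"
  defines "D' \<equiv> mat (Suc k) (Suc k) (\<lambda>(i, j). if i = j then if i < k then D $$ (i, i) else c else 0)"
  shows "a * append_col n k V w = append_col n k V w * D'"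
proof (rule eq_matI)
  let ?W = "append_col n k V w"
  fix i j assume "i < dim_row (?W * D')" "j < dim_col (?W * D')"
  then have ij: "i < n" "j < Suc k" by (auto simp: append_col_def D'_def)
  have D'c: "D' \<in> carrier_mat (Suc k) (Suc k)" by (simp add: D'_def)
  have "(a * ?W) $$ (i, j) = (\<Sum>l<n. a $$ (i, l) * ?W $$ (l, j))"
    by (rule mult_mat_index) (use assms ij in auto)
  also have "\<dots> = (\<Sum>l<n. a $$ (i, l) * (if j < k then V $$ (l, j) else w $$ (l, 0)))"
    using ij by (simp add: append_col_index)
  also have "\<dots> = (if j < k then (a * V) $$ (i, j) else (a * w) $$ (i, 0))"
    using ij mult_mat_index[OF assms(3) assms(4) ij(1), of j] mult_mat_index[OF assms(3) assms(5) ij(1), of 0]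
    by (simp del: index_mult_mat(1))
  also have "\<dots> = ?W $$ (i, j) * D' $$ (j, j)"
  proof (cases "j < k")
    case True
    have "(V * D) $$ (i, j) = (\<Sum>l<k. V $$ (i, l) * D $$ (l, j))"
      by (rule mult_mat_index) (use assms ij True in auto)
    also have "\<dots> = (\<Sum>l<k. if l = j then V $$ (i, j) * D $$ (j, j) else 0)"
      by (rule sum.cong) (use assms True in \<open>auto simp: diagonal_mat_def\<close>)
    finally show ?thesis using True ij assms(6) by (simp add: append_col_index D'_def)
  qed (use ij assms in \<open>auto simp: append_col_index D'_def\<close>)
  also have "\<dots> = (\<Sum>l<Suc k. if l = j then ?W $$ (i, j) * D' $$ (j, j) else 0)"
    using ij by simp
  also have "\<dots> = (\<Sum>l<Suc k. ?W $$ (i, l) * D' $$ (l, j))"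
    by (rule sum.cong) (use ij in \<open>auto simp: D'_def\<close>)
  also have "\<dots> = (?W * D') $$ (i, j)"
    by (rule mult_mat_index[symmetric, OF _ D'c]) (use ij in auto)
  finally show "(a * ?W) $$ (i, j) = (?W * D') $$ (i, j)" .
qed (use assms in \<open>auto simp: append_col_def\<close>)

text \<open>Orthonormal joint eigenvectors are collected until no more fit. If they did not span,
  the orthogonal complement of their span would be invariant, because the matrices are Hermitian,
  and \<open>common_eigenvector\<close> would find another one there.\<close>

lemma joint_diagonalization:
  assumes I: "finite I" and a: "\<And>i. i \<in> I \<Longrightarrow> a i \<in> carrier_mat n n"
    and herm: "\<And>i. i \<in> I \<Longrightarrow> mat_adjoint (a i) = a i"
    and comm: "\<And>i j. i \<in> I \<Longrightarrow> j \<in> I \<Longrightarrow> a i * a j = a j * a i"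
  obtains U where "unitary_mat n U" "\<And>i. i \<in> I \<Longrightarrow> diagonal_mat (mat_adjoint U * a i * U)"
proof -
  let ?P = "\<lambda>k. \<exists>V. isometry_mat n k V \<and> (\<forall>i\<in>I. \<exists>D\<in>carrier_mat k k. diagonal_mat D \<and> a i * V = V * D)"
  have P0: "?P 0"
  proof (intro exI[of _ "0\<^sub>m n 0"] conjI ballI bexI)
    show "isometry_mat n 0 (0\<^sub>m n 0)" by (auto simp: isometry_mat_def)
    fix i assume "i \<in> I"
    then show "a i * 0\<^sub>m n 0 = 0\<^sub>m n 0 * 0\<^sub>m 0 0" using a by (intro eq_matI) auto
  qed (auto simp: diagonal_mat_def)
  obtain k where k: "?P k" "\<not> ?P (Suc k)"
    by (rule ex_max_nat[of ?P 0 n]) (use P0 isometry_defect(1) in auto)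
  then obtain V where V: "isometry_mat n k V"
    and VD: "\<And>i. i \<in> I \<Longrightarrow> \<exists>D\<in>carrier_mat k k. diagonal_mat D \<and> a i * V = V * D" by blast
  have Vc: "V \<in> carrier_mat n k" and VV: "mat_adjoint V * V = 1\<^sub>m k"
    using V by (auto simp: isometry_mat_def)
  have ac: "mat_adjoint V \<in> carrier_mat k n" using Vc by simp
  have "k = n"
  proof (rule ccontr)
    assume "k \<noteq> n"
    then have "k < n" using isometry_defect(1)[OF V] by simp
    then obtain t where t: "t \<in> carrier_mat n 1" "t \<noteq> 0\<^sub>m n 1" "mat_adjoint V * t = 0\<^sub>m k 1"
      using isometry_defect(2)[OF V] by blast
    define T where "T = {t \<in> carrier_mat n 1. mat_adjoint V * t = 0\<^sub>m k 1}"
    have T: "col_subspace n T"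
      using ac right_mult_zero_mat[OF ac] by (auto simp: col_subspace_def T_def mult_add_distrib_mat[OF ac] mult_smult_distrib[OF ac])
    have inv: "a i * s \<in> T" if i: "i \<in> I" and s: "s \<in> T" for i s
    proof -
      obtain D where D: "D \<in> carrier_mat k k" "a i * V = V * D" using VD[OF i] by blast
      have sc: "s \<in> carrier_mat n 1" and s0: "mat_adjoint V * s = 0\<^sub>m k 1" using s by (auto simp: T_def)
      have "mat_adjoint V * (a i * s) = mat_adjoint V * mat_adjoint (a i) * s"
        using assoc_mult_mat[OF ac a[OF i] sc] herm[OF i] by simp
      also have "mat_adjoint V * mat_adjoint (a i) = mat_adjoint D * mat_adjoint V"
        using mat_adjoint_mult[OF a[OF i] Vc] mat_adjoint_mult[OF Vc D(1)] D(2) by simp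
      also have "\<dots> * s = 0\<^sub>m k 1"
        using assoc_mult_mat[OF mat_adjoint_carrier[OF D(1)] ac sc] s0 D(1) by simp
      finally show ?thesis using a[OF i] sc by (simp add: T_def)
    qed
    obtain v where v: "v \<in> T" "v \<noteq> 0\<^sub>m n 1" "\<And>i. i \<in> I \<Longrightarrow> \<exists>c. a i * v = c \<cdot>\<^sub>m v"
      using common_eigenvector[where a = a and I = I, OF I a comm T inv, of t] t by (auto simp: T_def)
    have vc: "v \<in> carrier_mat n 1" and v0: "mat_adjoint V * v = 0\<^sub>m k 1" using v(1) by (auto simp: T_def)
    obtain d where d: "d \<noteq> 0" "mat_adjoint (d \<cdot>\<^sub>m v) * (d \<cdot>\<^sub>m v) = 1\<^sub>m 1"
      using normalize_col[OF vc v(2)] .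
    define w where "w = d \<cdot>\<^sub>m v"
    have wc: "w \<in> carrier_mat n 1" using vc by (simp add: w_def)
    have iso: "isometry_mat n (Suc k) (append_col n k V w)"
      by (rule append_col_isometry[OF V wc]) (use d v0 ac vc in \<open>auto simp: w_def mult_smult_distrib[OF ac vc]\<close>)
    have "\<exists>D\<in>carrier_mat (Suc k) (Suc k). diagonal_mat D \<and> a i * append_col n k V w = append_col n k V w * D"
      if i: "i \<in> I" for i
    proof -
      obtain c where c: "a i * v = c \<cdot>\<^sub>m v" using v(3)[OF i] by blast
      have cw: "a i * w = c \<cdot>\<^sub>m w"
        unfolding w_def using mult_smult_distrib[OF a[OF i] vc] c by (auto intro!: eq_matI)
      obtain D where D: "D \<in> carrier_mat k k" "diagonal_mat D" "a i * V = V * D" using VD[OF i] by blast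
      let ?D = "mat (Suc k) (Suc k) (\<lambda>(i, j). if i = j then if i < k then D $$ (i, i) else c else 0)"
      have "diagonal_mat ?D" by (auto simp: diagonal_mat_def)
      then show ?thesis using diagonal_mat_append[OF D(1,2) a[OF i] Vc wc D(3) cw]
        by (intro bexI[of _ ?D]) auto
    qed
    then show False using iso k(2) by blast
  qed
  then have U: "unitary_mat n V" using isometry_mat_square V by blast
  have "diagonal_mat (mat_adjoint V * a i * V)" if i: "i \<in> I" for i
  proof -
    obtain D where D: "D \<in> carrier_mat k k" "diagonal_mat D" "a i * V = V * D" using VD[OF i] by blast
    have "mat_adjoint V * a i * V = mat_adjoint V * (V * D)"
      using assoc_mult_mat[OF ac a[OF i] Vc] D(3) by simp
    also have "\<dots> = D" using assoc_mult_mat[OF ac Vc D(1)] VV D(1) by simp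
    finally show ?thesis using D(2) by simp
  qed
  then show ?thesis using that U by blast
qed

subsection \<open>Unital C*-algebras\<close>

lemma scaleC_one [simp]: "1 *\<^sub>C (x :: 'a::unital_cstar_algebra) = x"
  using scaleC_of_real[of 1 x] by simp

lemma scaleC_zero_left [simp]: "0 *\<^sub>C (x :: 'a::unital_cstar_algebra) = 0"
  using scaleC_of_real[of 0 x] by simp

lemma scaleC_zero_right [simp]: "c *\<^sub>C (0 :: 'a::unital_cstar_algebra) = 0"
  using scaleC_add_right[of c 0 "0 :: 'a"] by simp

lemma scaleC_minus1: "(-1) *\<^sub>C (x :: 'a::unital_cstar_algebra) = - x"
  using scaleC_of_real[of "-1" x] by simp

lemma scaleC_minus_left: "(- c) *\<^sub>C (x :: 'a::unital_cstar_algebra) = - (c *\<^sub>C x)"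
  using scaleC_scaleC[of "-1" c x] by (simp add: scaleC_minus1)

lemma scaleC_minus_right: "c *\<^sub>C (- x :: 'a::unital_cstar_algebra) = - (c *\<^sub>C x)"
  using scaleC_scaleC[of c "-1" x] by (simp add: scaleC_minus1 scaleC_minus_left)

lemma scaleC_diff_right: "c *\<^sub>C (x - y :: 'a::unital_cstar_algebra) = c *\<^sub>C x - c *\<^sub>C y"
  using scaleC_add_right[of c x "- y"] by (simp add: scaleC_minus_right)

lemma vector_space_scaleC: "vector_space (scaleC :: complex \<Rightarrow> 'a \<Rightarrow> 'a::unital_cstar_algebra)"
  by unfold_locales (simp_all add: scaleC_add_right scaleC_add_left scaleC_scaleC)

lemma star_zero [simp]: "star (0 :: 'a::unital_cstar_algebra) = 0"
  using star_add[of 0 "0 :: 'a"] by simp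

lemma star_minus: "star (- x :: 'a::unital_cstar_algebra) = - star x"
  using star_scaleC[of "-1" x] by (simp add: scaleC_minus1)

lemma star_diff: "star (x - y :: 'a::unital_cstar_algebra) = star x - star y"
  using star_add[of x "- y"] by (simp add: star_minus)

lemma star_scaleR: "star (r *\<^sub>R x :: 'a::unital_cstar_algebra) = r *\<^sub>R star x"
  using star_scaleC[of "of_real r" x] by (simp add: scaleC_of_real)

lemma star_one [simp]: "star (1 :: 'a::unital_cstar_algebra) = 1"
  using star_mult[of "star 1" "1 :: 'a"] by (simp add: star_star)

lemma norm_star [simp]: "norm (star x :: 'a::unital_cstar_algebra) = norm x"
proof -
  have le: "norm y \<le> norm (star y)" for y :: 'a
  proof (cases "y = 0")
    case False
    have "(norm y)\<^sup>2 \<le> norm (star y) * norm y"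
      using norm_mult_ineq[of "star y" y] by (simp add: cstar_identity)
    then show ?thesis using False by (simp add: power2_eq_square)
  qed simp
  show ?thesis using le[of x] le[of "star x"] by (simp add: star_star)
qed

lemma bounded_linear_star: "bounded_linear (star :: 'a::unital_cstar_algebra \<Rightarrow> 'a)"
  by (rule bounded_linear_intro[of _ 1]) (simp_all add: star_add star_scaleR)

lemma star_sum: "star (sum f I :: 'a::unital_cstar_algebra) = (\<Sum>i\<in>I. star (f i))"
  by (rule linear_sum[OF bounded_linear.linear[OF bounded_linear_star]])

lemma star_power: "star (x ^ k :: 'a::unital_cstar_algebra) = star x ^ k"
  by (induction k) (simp_all add: star_mult power_commutes)

lemma self_adjoint_intros:
  fixes x y :: "'a::unital_cstar_algebra"
  shows "self_adjoint (0 :: 'a)" "self_adjoint (1 :: 'a)"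
    "self_adjoint x \<Longrightarrow> self_adjoint y \<Longrightarrow> self_adjoint (x + y)"
    "self_adjoint x \<Longrightarrow> self_adjoint y \<Longrightarrow> self_adjoint (x - y)"
    "self_adjoint x \<Longrightarrow> self_adjoint (r *\<^sub>R x)"
    "self_adjoint x \<Longrightarrow> self_adjoint (x ^ k)"
    "self_adjoint (star x * x)"
  by (simp_all add: self_adjoint_def star_add star_diff star_scaleR star_power star_mult star_star)

lemma star_exp: "star (exp x :: 'a::unital_cstar_algebra) = exp (star x)"
proof -
  have "star (exp x) = (\<Sum>k. star (x ^ k /\<^sub>R fact k))"
    unfolding exp_def by (rule bounded_linear.suminf[OF bounded_linear_star summable_exp_generic])
  also have "\<dots> = exp (star x)" by (simp add: exp_def star_scaleR star_power)
  finally show ?thesis .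
qed

definition expi :: "'a::unital_cstar_algebra \<Rightarrow> 'a"
  where "expi h = exp (\<i> *\<^sub>C h)"

lemma unitary_expi:
  assumes "self_adjoint h"
  shows "unitary (expi h)"
proof -
  have s: "star (expi h) = exp (- (\<i> *\<^sub>C h))"
    using assms by (simp add: expi_def star_exp star_scaleC self_adjoint_def scaleC_minus_left)
  show ?thesis
    unfolding unitary_def s by (simp add: expi_def exp_minus_inverse exp_add_commuting[symmetric])
qed

lemma norm_unitary: "unitary u \<Longrightarrow> norm u = 1"
  using cstar_identity[of u] by (simp add: unitary_def power2_eq_1_iff)
    (metis norm_ge_zero abs_of_nonneg abs_minus_cancel abs_one one_neq_neg_one)

lemma unitary_mult: "unitary u \<Longrightarrow> unitary v \<Longrightarrow> unitary (u * v)"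
  unfolding unitary_def star_mult by (metis (no_types, lifting) mult.assoc mult_1_left)

lemma unitary_one: "unitary 1"
  by (simp add: unitary_def)

text \<open>The Neumann series. Its use in \<open>diag_bound\<close> and \<open>char_bound\<close>
  is that neither a vector nor a character can annihilate \<open>1 - z\<close> when \<open>z\<close>
  has norm below 1.\<close>

lemma left_inverse_one_minus:
  fixes z :: "'a::{real_normed_algebra_1, banach}"
  assumes "norm z < 1"
  shows "(\<lambda>k. z ^ k) sums (\<Sum>k. z ^ k)" "(\<Sum>k. z ^ k) * (1 - z) = 1"
proof -
  have s: "summable (\<lambda>k. z ^ k)"
    by (rule summable_norm_cancel, rule summable_comparison_test'[of "\<lambda>k. norm z ^ k" 0])
      (use assms in \<open>auto simp: norm_power_ineq summable_geometric\<close>)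
  then show "(\<lambda>k. z ^ k) sums (\<Sum>k. z ^ k)" by (rule summable_sums)
  have "(\<Sum>k. z ^ k) * z = (\<Sum>k. z ^ k * z)"
    by (rule suminf_mult2[OF s])
  also have "\<dots> = (\<Sum>k. z ^ Suc k)" by (simp add: power_commutes)
  also have "\<dots> = (\<Sum>k. z ^ k) - 1" using suminf_split_head[OF s] by simp
  finally show "(\<Sum>k. z ^ k) * (1 - z) = 1" by (simp add: algebra_simps)
qed

subsection \<open>Matrix representations\<close>

text \<open>Unital, but possibly reducible: limits of irreducible representations and compressions
  to invariant subspaces have to be included. No continuity is assumed; it is automatic by
  \<open>entry_bound\<close>.\<close>

locale matrix_rep =
  fixes n :: nat and \<pi> :: "'a::unital_cstar_algebra \<Rightarrow> complex mat"
  assumes carrier [simp]: "\<pi> x \<in> carrier_mat n n"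
    and add: "\<pi> (x + y) = \<pi> x + \<pi> y"
    and scaleC: "\<pi> (c *\<^sub>C x) = c \<cdot>\<^sub>m \<pi> x"
    and mult: "\<pi> (x * y) = \<pi> x * \<pi> y"
    and star: "\<pi> (star x) = mat_adjoint (\<pi> x)"
    and one: "\<pi> 1 = 1\<^sub>m n"
begin

lemma dim [simp]: "dim_row (\<pi> x) = n" "dim_col (\<pi> x) = n"
  using carrier_matD[OF carrier] by auto

lemma entry_add: "i < n \<Longrightarrow> j < n \<Longrightarrow> \<pi> (x + y) $$ (i, j) = \<pi> x $$ (i, j) + \<pi> y $$ (i, j)"
  by (simp add: add)

lemma entry_scaleC: "i < n \<Longrightarrow> j < n \<Longrightarrow> \<pi> (c *\<^sub>C x) $$ (i, j) = c * \<pi> x $$ (i, j)"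
  by (simp add: scaleC)

lemma entry_scaleR: "i < n \<Longrightarrow> j < n \<Longrightarrow> \<pi> (r *\<^sub>R x) $$ (i, j) = of_real r * \<pi> x $$ (i, j)"
  by (simp add: scaleC_of_real[symmetric] entry_scaleC)

lemma entry_mult: "i < n \<Longrightarrow> j < n \<Longrightarrow> \<pi> (x * y) $$ (i, j) = (\<Sum>l<n. \<pi> x $$ (i, l) * \<pi> y $$ (l, j))"
  unfolding mult by (rule mult_mat_index) auto

lemma entry_star: "i < n \<Longrightarrow> j < n \<Longrightarrow> \<pi> (star x) $$ (i, j) = cnj (\<pi> x $$ (j, i))"
  by (simp add: star)

lemma zero: "\<pi> 0 = 0\<^sub>m n n"
proof (rule eq_matI)
  fix i j assume "i < dim_row (0\<^sub>m n n :: complex mat)" "j < dim_col (0\<^sub>m n n :: complex mat)"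
  then show "\<pi> 0 $$ (i, j) = 0\<^sub>m n n $$ (i, j)"
    using entry_scaleC[of i j 0 0] by simp
qed auto

lemma entry_minus: "i < n \<Longrightarrow> j < n \<Longrightarrow> \<pi> (- x) $$ (i, j) = - \<pi> x $$ (i, j)"
  using entry_scaleC[of i j "-1" x] by (simp add: scaleC_minus1)

lemma entry_diff: "i < n \<Longrightarrow> j < n \<Longrightarrow> \<pi> (x - y) $$ (i, j) = \<pi> x $$ (i, j) - \<pi> y $$ (i, j)"
  using entry_add[of i j x "- y"] by (simp add: entry_minus)

lemma entry_sum: "i < n \<Longrightarrow> j < n \<Longrightarrow> \<pi> (sum f I) $$ (i, j) = (\<Sum>k\<in>I. \<pi> (f k) $$ (i, j))"
  by (induction I rule: infinite_finite_induct) (simp_all add: zero entry_add)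

lemma conj_rep:
  assumes U: "unitary_mat n U"
  shows "matrix_rep n (\<lambda>x. mat_adjoint U * \<pi> x * U)"
proof -
  have Uc: "U \<in> carrier_mat n n" and ac: "mat_adjoint U \<in> carrier_mat n n"
    and UU: "mat_adjoint U * U = 1\<^sub>m n" "U * mat_adjoint U = 1\<^sub>m n"
    using U by (auto simp: unitary_mat_def)
  have aX: "mat_adjoint U * \<pi> x \<in> carrier_mat n n" for x by (rule mult_carrier_mat[OF ac carrier])
  have XU: "\<pi> x * U \<in> carrier_mat n n" for x by (rule mult_carrier_mat[OF carrier Uc])
  have aXU: "mat_adjoint U * (\<pi> x * U) \<in> carrier_mat n n" for x by (rule mult_carrier_mat[OF ac XU])
  have as: "mat_adjoint U * \<pi> x * U = mat_adjoint U * (\<pi> x * U)" for x by (rule assoc_mult_mat[OF ac carrier Uc])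
  show ?thesis
  proof
    fix x y c
    show "mat_adjoint U * \<pi> x * U \<in> carrier_mat n n" using Uc by auto
    show "mat_adjoint U * \<pi> (x + y) * U = mat_adjoint U * \<pi> x * U + mat_adjoint U * \<pi> y * U"
      by (simp add: add mult_add_distrib_mat[OF ac carrier carrier] add_mult_distrib_mat[OF aX aX Uc])
    show "mat_adjoint U * \<pi> (c *\<^sub>C x) * U = c \<cdot>\<^sub>m (mat_adjoint U * \<pi> x * U)"
      by (simp add: scaleC mult_smult_distrib[OF ac carrier] mult_smult_assoc_mat[OF aX Uc])
    have "(mat_adjoint U * \<pi> x * U) * (mat_adjoint U * \<pi> y * U)
        = (mat_adjoint U * \<pi> x) * (U * (mat_adjoint U * (\<pi> y * U)))"
      unfolding as[of y] by (rule assoc_mult_mat[OF aX Uc aXU])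
    also have "U * (mat_adjoint U * (\<pi> y * U)) = \<pi> y * U"
      using assoc_mult_mat[OF Uc ac XU, of y] UU(2) left_mult_one_mat[OF XU] by simp
    also have "(mat_adjoint U * \<pi> x) * (\<pi> y * U) = mat_adjoint U * \<pi> (x * y) * U"
      unfolding mult assoc_mult_mat[OF ac carrier carrier, symmetric] by (rule assoc_mult_mat[OF aX carrier Uc, symmetric])
    finally show "mat_adjoint U * \<pi> (x * y) * U = (mat_adjoint U * \<pi> x * U) * (mat_adjoint U * \<pi> y * U)" ..
    show "mat_adjoint U * \<pi> (star x) * U = mat_adjoint (mat_adjoint U * \<pi> x * U)"
      unfolding mat_adjoint_mult[OF aX Uc] mat_adjoint_mult[OF ac carrier] star mat_adjoint_adjoint
      by (rule assoc_mult_mat[OF ac mat_adjoint_carrier[OF carrier] Uc])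
    show "mat_adjoint U * \<pi> 1 * U = 1\<^sub>m n"
      using right_mult_one_mat[OF ac] UU by (simp add: one)
  qed
qed

lemma conj_inverse:
  assumes U: "unitary_mat n U"
  shows "U * (mat_adjoint U * \<pi> x * U) * mat_adjoint U = \<pi> x"
proof -
  have Uc: "U \<in> carrier_mat n n" and ac: "mat_adjoint U \<in> carrier_mat n n"
    and UU: "mat_adjoint U * U = 1\<^sub>m n" "U * mat_adjoint U = 1\<^sub>m n"
    using U by (auto simp: unitary_mat_def)
  have "U * (mat_adjoint U * \<pi> x * U) = U * (mat_adjoint U * (\<pi> x * U))"
    by (simp only: assoc_mult_mat[OF ac carrier Uc])
  also have "\<dots> = \<pi> x * U"
    using assoc_mult_mat[OF Uc ac mult_carrier_mat[OF carrier Uc], of x] UU(2)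
      left_mult_one_mat[OF mult_carrier_mat[OF carrier Uc], of x] by simp
  also have "\<dots> * mat_adjoint U = \<pi> x"
    using assoc_mult_mat[OF carrier Uc ac] UU right_mult_one_mat[OF carrier] by simp
  finally show ?thesis .
qed

lemma conj_mtr:
  assumes U: "unitary_mat n U"
  shows "mtr (mat_adjoint U * \<pi> x * U) = mtr (\<pi> x)"
proof -
  have Uc: "U \<in> carrier_mat n n" and ac: "mat_adjoint U \<in> carrier_mat n n"
    and UU: "mat_adjoint U * U = 1\<^sub>m n" "U * mat_adjoint U = 1\<^sub>m n"
    using U by (auto simp: unitary_mat_def)
  have "mtr (mat_adjoint U * \<pi> x * U) = mtr (U * (mat_adjoint U * \<pi> x))"
    by (rule mtr_comm) (use Uc in auto)
  also have "U * (mat_adjoint U * \<pi> x) = \<pi> x"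
    using assoc_mult_mat[OF Uc ac carrier] UU left_mult_one_mat[OF carrier] by simp
  finally show ?thesis .
qed

text \<open>If the entry \<open>l\<close> exceeded the norm, \<open>1 - z\<close> with
  \<open>z\<close> equal to x/l would have a left inverse, although column \<open>i\<close> of its
  image vanishes.\<close>

lemma diag_bound:
  assumes "diagonal_mat (\<pi> x)" "i < n"
  shows "cmod (\<pi> x $$ (i, i)) \<le> norm x"
proof (rule ccontr)
  assume *: "\<not> ?thesis"
  define l where "l = \<pi> x $$ (i, i)"
  have l: "cmod l > norm x" using * by (simp add: l_def)
  then have l0: "l \<noteq> 0" by auto
  define z where "z = inverse l *\<^sub>C x"
  have "norm z < 1" using l l0 by (simp add: z_def norm_scaleC norm_inverse norm_divide divide_simps)
  then obtain y where y: "y * (1 - z) = 1" using left_inverse_one_minus(2) by blast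
  have e: "\<pi> (1 - z) $$ (k, i) = 0" if "k < n" for k
    using that assms l0 by (auto simp: entry_diff one z_def entry_scaleC l_def diagonal_mat_def)
  have "1 = \<pi> (y * (1 - z)) $$ (i, i)" using assms by (simp add: y one)
  also have "\<dots> = 0" unfolding entry_mult[OF assms(2,2)] by (simp add: e)
  finally show False by simp
qed

lemma diagonalize:
  assumes "abelian_family A"
  obtains U where "unitary_mat n U" "\<And>i. diagonal_mat (mat_adjoint U * \<pi> (A $ i) * U)"
proof -
  have "\<exists>U. unitary_mat n U \<and> (\<forall>i\<in>UNIV. diagonal_mat (mat_adjoint U * \<pi> (A $ i) * U))"
  proof (rule joint_diagonalization[of UNIV "\<lambda>i. \<pi> (A $ i)" n])
    fix i j
    show "mat_adjoint (\<pi> (A $ i)) = \<pi> (A $ i)"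
      using assms by (simp add: star[symmetric] abelian_family_def self_adjoint_def)
    show "\<pi> (A $ i) * \<pi> (A $ j) = \<pi> (A $ j) * \<pi> (A $ i)"
      using assms by (simp add: mult[symmetric] abelian_family_def)
  qed auto
  then show ?thesis using that by blast
qed

lemma diagonalize_single:
  assumes "self_adjoint h"
  obtains U where "unitary_mat n U" "diagonal_mat (mat_adjoint U * \<pi> h * U)"
proof -
  obtain U where "unitary_mat n U" "\<And>i. diagonal_mat (mat_adjoint U * \<pi> ((\<chi> i. h :: 'a ^ 1) $ i) * U)"
    using diagonalize[of "\<chi> i. h :: 'a ^ 1"] assms by (auto simp: abelian_family_def)
  then show ?thesis using that by simp
qed

text \<open>The squared norm of column \<open>j\<close> is the (j, j) entry of the image of
  \<open>star x * x\<close>. In a diagonalizing basis this is an average of eigenvalues, with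
  weights from a row of a unitary matrix; \<open>diag_bound\<close> and the C*-identity bound each
  eigenvalue by the squared norm of \<open>x\<close>.\<close>

lemma column_norm_bound:
  assumes j: "j < n"
  shows "(\<Sum>i<n. (cmod (\<pi> x $$ (i, j)))\<^sup>2) \<le> (norm x)\<^sup>2"
proof -
  define k where "k = star x * x"
  obtain U where U: "unitary_mat n U" and D: "diagonal_mat (mat_adjoint U * \<pi> k * U)"
    using diagonalize_single[of k] by (auto simp: k_def self_adjoint_intros)
  define \<rho> where "\<rho> = (\<lambda>x. mat_adjoint U * \<pi> x * U)"
  interpret r: matrix_rep n \<rho> unfolding \<rho>_def by (rule conj_rep[OF U])
  have Uc: "U \<in> carrier_mat n n" and UU: "U * mat_adjoint U = 1\<^sub>m n" using U by (auto simp: unitary_mat_def)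
  have Dk: "\<rho> k $$ (l, m) = 0" if "l < n" "m < n" "l \<noteq> m" for l m
  proof -
    have "diagonal_mat (\<rho> k)" unfolding \<rho>_def by (rule D)
    then show ?thesis using that by (simp add: diagonal_mat_def)
  qed
  have "of_real (\<Sum>i<n. (cmod (\<pi> x $$ (i, j)))\<^sup>2) = \<pi> k $$ (j, j)"
    unfolding k_def using j by (simp add: entry_mult entry_star cmod_square mult.commute)
  also have "\<pi> k $$ (j, j) = (U * \<rho> k * mat_adjoint U) $$ (j, j)"
    using conj_inverse[OF U] by (simp add: \<rho>_def)
  also have "\<dots> = (\<Sum>l<n. (U * \<rho> k) $$ (j, l) * mat_adjoint U $$ (l, j))"
    by (rule mult_mat_index) (use j Uc in \<open>auto intro: mult_carrier_mat[OF Uc r.carrier]\<close>)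
  also have "\<dots> = (\<Sum>l<n. U $$ (j, l) * \<rho> k $$ (l, l) * cnj (U $$ (j, l)))"
  proof (rule sum.cong)
    fix l assume "l \<in> {..<n}"
    then have l: "l < n" by simp
    have "(U * \<rho> k) $$ (j, l) = (\<Sum>m<n. U $$ (j, m) * \<rho> k $$ (m, l))"
      by (rule mult_mat_index[OF Uc r.carrier j l])
    also have "\<dots> = (\<Sum>m<n. if m = l then U $$ (j, l) * \<rho> k $$ (l, l) else 0)"
      by (rule sum.cong) (use Dk l in auto)
    finally show "(U * \<rho> k) $$ (j, l) * mat_adjoint U $$ (l, j) = U $$ (j, l) * \<rho> k $$ (l, l) * cnj (U $$ (j, l))"
      using l j Uc by (simp del: index_mult_mat(1))
  qed simp
  finally have "cmod (complex_of_real (\<Sum>i<n. (cmod (\<pi> x $$ (i, j)))\<^sup>2)) =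
      cmod (\<Sum>l<n. U $$ (j, l) * \<rho> k $$ (l, l) * cnj (U $$ (j, l)))" by simp
  also have "\<dots> \<le> (\<Sum>l<n. cmod (U $$ (j, l) * \<rho> k $$ (l, l) * cnj (U $$ (j, l))))"
    by (rule norm_sum)
  also have "\<dots> \<le> (\<Sum>l<n. norm k * (cmod (U $$ (j, l)))\<^sup>2)"
  proof (rule sum_mono)
    fix l assume "l \<in> {..<n}"
    then have "cmod (\<rho> k $$ (l, l)) \<le> norm k"
      by (intro r.diag_bound) (use D in \<open>auto simp: \<rho>_def\<close>)
    then have "cmod (\<rho> k $$ (l, l)) * (cmod (U $$ (j, l)))\<^sup>2 \<le> norm k * (cmod (U $$ (j, l)))\<^sup>2"
      by (rule mult_right_mono) simp
    then show "cmod (U $$ (j, l) * \<rho> k $$ (l, l) * cnj (U $$ (j, l))) \<le> norm k * (cmod (U $$ (j, l)))\<^sup>2"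
      by (simp add: norm_mult power2_eq_square mult_ac)
  qed
  also have "\<dots> = norm k * (\<Sum>l<n. (cmod (U $$ (j, l)))\<^sup>2)" by (simp add: sum_distrib_left)
  also have "(\<Sum>l<n. (cmod (U $$ (j, l)))\<^sup>2) = 1"
  proof -
    have "complex_of_real (\<Sum>l<n. (cmod (U $$ (j, l)))\<^sup>2) = (\<Sum>l<n. U $$ (j, l) * mat_adjoint U $$ (l, j))"
      using Uc j by (simp add: cmod_square)
    also have "\<dots> = (U * mat_adjoint U) $$ (j, j)"
      by (rule mult_mat_index[symmetric]) (use Uc j in auto)
    also have "\<dots> = of_real 1" using UU j by simp
    finally show ?thesis using of_real_eq_iff by blast
  qed
  also have "norm k = (norm x)\<^sup>2" by (simp add: k_def cstar_identity)
  finally show ?thesis by (simp add: norm_of_real sum_nonneg del: of_real_sum of_real_power)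
qed

lemma entry_bound: 
  assumes "i < n" "j < n"
  shows "cmod (\<pi> x $$ (i, j)) \<le> norm x"
proof -
  have "(cmod (\<pi> x $$ (i, j)))\<^sup>2 \<le> (\<Sum>i<n. (cmod (\<pi> x $$ (i, j)))\<^sup>2)"
    using assms by (intro member_le_sum) auto
  also have "\<dots> \<le> (norm x)\<^sup>2" by (rule column_norm_bound[OF assms(2)])
  finally show ?thesis by (rule power2_le_imp_le) simp
qed

lemma bounded_linear_entry: "i < n \<Longrightarrow> j < n \<Longrightarrow> bounded_linear (\<lambda>x. \<pi> x $$ (i, j))"
  by (rule bounded_linear_intro[of _ 1])
    (simp_all only: entry_add entry_scaleR entry_bound scaleR_conv_of_real[where 'a = complex] mult_1_right)

lemma diagonal_subalgebra: "unital_cstar_subalgebra {x. diagonal_mat (\<pi> x)}"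
proof -
  have "{x. diagonal_mat (\<pi> x)} = (\<Inter>i\<in>{..<n}. \<Inter>j\<in>{..<n}-{i}. {x. \<pi> x $$ (i, j) = 0})"
    by (auto simp: diagonal_mat_def)
  moreover have "closed {x. \<pi> x $$ (i, j) = 0}" if "i < n" "j < n" for i j
    by (intro closed_Collect_eq continuous_intros linear_continuous_on bounded_linear_entry that)
  ultimately have "closed {x. diagonal_mat (\<pi> x)}" by (auto intro!: closed_INT)
  moreover have "diagonal_mat (\<pi> (x * y))" if "diagonal_mat (\<pi> x)" "diagonal_mat (\<pi> y)" for x y
    using that unfolding diagonal_mat_def by (simp add: entry_mult) (metis (no_types, lifting) lessThan_iff mult_not_zero sum.neutral)
  ultimately show ?thesis
    unfolding unital_cstar_subalgebra_def
    by (auto simp: one diagonal_mat_def entry_add entry_scaleC entry_star)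
qed

lemma diagonal_generated:
  assumes "\<And>i. diagonal_mat (\<pi> (A $ i))" "x \<in> cstar_generated (range (\<lambda>i. A $ i))"
  shows "diagonal_mat (\<pi> x)"
  using assms diagonal_subalgebra unfolding cstar_generated_def by blast

lemma diagonal_mult:
  assumes "diagonal_mat (\<pi> x)" "i < n" "j < n"
  shows "\<pi> (x * y) $$ (i, j) = \<pi> x $$ (i, i) * \<pi> y $$ (i, j)" "\<pi> (y * x) $$ (i, j) = \<pi> y $$ (i, j) * \<pi> x $$ (j, j)"
proof -
  have "\<pi> (x * y) $$ (i, j) = (\<Sum>l<n. if l = i then \<pi> x $$ (i, i) * \<pi> y $$ (i, j) else 0)"
    unfolding entry_mult[OF assms(2,3)] by (rule sum.cong) (use assms in \<open>auto simp: diagonal_mat_def\<close>)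
  then show "\<pi> (x * y) $$ (i, j) = \<pi> x $$ (i, i) * \<pi> y $$ (i, j)" using assms by simp
  have "\<pi> (y * x) $$ (i, j) = (\<Sum>l<n. if l = j then \<pi> y $$ (i, j) * \<pi> x $$ (j, j) else 0)"
    unfolding entry_mult[OF assms(2,3)] by (rule sum.cong) (use assms in \<open>auto simp: diagonal_mat_def\<close>)
  then show "\<pi> (y * x) $$ (i, j) = \<pi> y $$ (i, j) * \<pi> x $$ (j, j)" using assms by simp
qed

text \<open>The bridge between matrices and the functional calculus, which is defined through
  characters: joint eigenvalues of \<open>A\<close> in a representation are points of the joint
  spectrum.\<close>

lemma diagonal_character:
  assumes "\<And>i. diagonal_mat (\<pi> (A $ i))" "j < n"
  shows "character_on (cstar_generated (range (\<lambda>i. A $ i))) (\<lambda>x. \<pi> x $$ (j, j))"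
  unfolding character_on_def
proof (intro conjI ballI allI bexI[of _ 1])
  show "1 \<in> cstar_generated (range (\<lambda>i. A $ i))"
    by (auto simp: cstar_generated_def unital_cstar_subalgebra_def)
qed (use assms(2) diagonal_generated[OF assms(1)] in \<open>auto simp: one entry_add entry_scaleC diagonal_mult\<close>)

end

text \<open>Unitality follows from surjectivity: if \<open>\<pi> e\<close> is the identity matrix,
  then \<open>\<pi> 1 = \<pi> 1 * \<pi> e\<close>, which is the image of
  \<open>1 * e\<close>.\<close>

lemma rep_onto_matrix_rep:
  assumes "rep_onto_matrix_algebra n \<pi>"
  shows "matrix_rep n \<pi>"
proof -
  have c: "\<pi> x \<in> carrier_mat n n" for x
    using assms by (auto simp: rep_onto_matrix_algebra_def)
  obtain e where e: "\<pi> e = 1\<^sub>m n"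
    using assms by (auto simp: rep_onto_matrix_algebra_def) (metis one_carrier_mat rangeE)
  have "\<pi> (1 * e) = \<pi> 1 * \<pi> e" using assms by (simp only: rep_onto_matrix_algebra_def)
  then have "\<pi> 1 = 1\<^sub>m n" using e right_mult_one_mat[OF c] by simp
  then show ?thesis
    using assms by unfold_locales (auto simp: rep_onto_matrix_algebra_def c)
qed

subsection \<open>The arcsine series\<close>

text \<open>Termwise integration of the binomial series of 1 / sqrt (1 - x^2), whose coefficients
  \<open>b k\<close> are nonnegative. Nonnegativity is what makes the coefficients summable, with
  sum bounded by the supremum pi / 2 of arcsin.\<close>

lemma arcsin_series:
  obtains a :: "nat \<Rightarrow> real" where "\<And>k. a k \<ge> 0" "summable a" "suminf a \<le> pi / 2"
    "\<And>t. \<bar>t\<bar> < pi / 2 \<Longrightarrow> (\<lambda>k. a k * sin t ^ (2 * k + 1)) sums t"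
proof -
  define b where "b k = ((-1/2 :: real) gchoose k) * (-1) ^ k" for k :: nat
  have b0: "b k \<ge> 0" for k
  proof -
    have "b k = (-1) ^ k * (-1) ^ k * pochhammer (1/2) k / fact k"
      by (simp add: b_def gbinomial_pochhammer)
    also have "\<dots> = pochhammer (1/2) k / fact k" by (simp flip: power_mult_distrib)
    also have "\<dots> \<ge> 0" by (intro divide_nonneg_nonneg pochhammer_nonneg) auto
    finally show ?thesis .
  qed
  define a where "a k = b k / (2 * k + 1)" for k :: nat
  have a0: "a k \<ge> 0" for k using b0[of k] by (simp add: a_def)
  have bs: "(\<lambda>k. b k * x ^ (2 * k)) sums (1 / sqrt (1 - x\<^sup>2))" if "\<bar>x\<bar> < 1" for x :: real
  proof -
    have x2: "x\<^sup>2 < 1" using that by (simp add: abs_square_less_1)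
    have "(\<lambda>k. ((-1/2) gchoose k) * (- (x\<^sup>2)) ^ k) sums (1 + - (x\<^sup>2)) powr (-1/2)"
      by (rule gen_binomial_real) (use x2 in simp)
    moreover have "((-1/2) gchoose k) * (- (x\<^sup>2)) ^ k = b k * x ^ (2 * k)" for k
      by (simp add: b_def power_minus[of "x\<^sup>2"] flip: power_mult)
    moreover have "(1 + - (x\<^sup>2)) powr (-1/2) = 1 / sqrt (1 - x\<^sup>2)"
      using x2 by (simp add: powr_minus powr_half_sqrt[symmetric] divide_simps)
    ultimately show ?thesis by simp
  qed
  define c where "c m = (if even m then a (m div 2) else 0)" for m :: nat
  have reidx: "f sums s \<longleftrightarrow> (\<lambda>k. f (2 * k)) sums s" if "\<And>m. odd m \<Longrightarrow> f m = 0" for f :: "nat \<Rightarrow> real" and s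
    by (rule sums_mono_reindex[symmetric]) (use that in \<open>auto simp: strict_mono_def elim!: evenE\<close>)
  have cs: "(\<lambda>m. c m * real (Suc m) * x ^ m) sums (1 / sqrt (1 - x\<^sup>2))" if "\<bar>x\<bar> < 1" for x :: real
  proof -
    have "(\<lambda>k. c (2 * k) * real (Suc (2 * k)) * x ^ (2 * k)) = (\<lambda>k. b k * x ^ (2 * k))"
      by (auto simp: c_def a_def fun_eq_iff divide_simps)
    then show ?thesis
      by (subst reidx) (use bs[OF that] in \<open>auto simp: c_def\<close>)
  qed
  define F where "F x = (\<Sum>m. c m * x ^ Suc m)" for x :: real
  have dF: "DERIV F x :> 1 / sqrt (1 - x\<^sup>2)" if "\<bar>x\<bar> < 1" for x
  proof -
    have "DERIV F x :> (\<Sum>m. c m * real (Suc m) * x ^ m)"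
      unfolding F_def
    proof (rule DERIV_power_series'[where R = 1])
      fix y :: real assume "y \<in> {-1<..<1}"
      then have "\<bar>y\<bar> < 1" by auto
      then show "summable (\<lambda>m. c m * real (Suc m) * y ^ m)" using cs sums_summable by blast
    qed (use that in auto)
    also have "(\<Sum>m. c m * real (Suc m) * x ^ m) = 1 / sqrt (1 - x\<^sup>2)"
      using cs[OF that] by (rule sums_unique[symmetric])
    finally show ?thesis .
  qed
  have Fa: "F x = arcsin x" if x: "\<bar>x\<bar> < 1" for x
  proof -
    have "\<exists>d. \<forall>y\<in>{-1<..<1}. F y - arcsin y = d"
    proof (rule has_field_derivative_zero_constant)
      fix y :: real assume "y \<in> {-1<..<1}"
      then have y: "\<bar>y\<bar> < 1" by auto
      have "((\<lambda>y. F y - arcsin y) has_real_derivative (1 / sqrt (1 - y\<^sup>2) - inverse (sqrt (1 - y\<^sup>2)))) (at y)"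
        by (intro DERIV_diff dF DERIV_arcsin) (use y in auto)
      then show "((\<lambda>y. F y - arcsin y) has_field_derivative 0) (at y within {-1<..<1})"
        by (simp add: divide_inverse has_field_derivative_at_within)
    qed auto
    then obtain d where d: "\<And>y. y \<in> {-1<..<1} \<Longrightarrow> F y - arcsin y = d" by blast
    have "F 0 = 0" by (simp add: F_def)
    then have "d = 0" using d[of 0] by simp
    then show ?thesis using d[of x] x by (auto simp: abs_less_iff)
  qed
  have as: "(\<lambda>k. a k * x ^ (2 * k + 1)) sums arcsin x" if x: "\<bar>x\<bar> < 1" for x
  proof -
    have "summable (\<lambda>m. c m * x ^ Suc m)"
    proof (rule summable_comparison_test'[of "\<lambda>m. c m * real (Suc m) * \<bar>x\<bar> ^ m" 0])
      show "summable (\<lambda>m. c m * real (Suc m) * \<bar>x\<bar> ^ m)" using cs[of "\<bar>x\<bar>"] x sums_summable by auto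
      fix m
      have "c m * (\<bar>x\<bar> * \<bar>x\<bar> ^ m) \<le> c m * (real (Suc m) * \<bar>x\<bar> ^ m)"
        by (intro mult_left_mono mult_right_mono) (use x a0 in \<open>auto simp: c_def\<close>)
      then show "norm (c m * x ^ Suc m) \<le> c m * real (Suc m) * \<bar>x\<bar> ^ m"
        using a0 by (simp add: abs_mult power_abs c_def mult_ac)
    qed
    then have "(\<lambda>m. c m * x ^ Suc m) sums F x" unfolding F_def by (rule summable_sums)
    then have "(\<lambda>k. c (2 * k) * x ^ Suc (2 * k)) sums F x"
      by (subst (asm) reidx) (auto simp: c_def)
    then show ?thesis using Fa[OF x] by (simp add: c_def)
  qed
  \<comment> \<open>For 0 < x < 1 a partial sum is at most arcsin x. It is a polynomial in x, so the
    bound survives the limit x -> 1 without any convergence statement at 1.\<close>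
  have part: "sum a {..<K} \<le> pi / 2" for K
  proof (rule tendsto_upperbound)
    show "((\<lambda>x. \<Sum>k<K. a k * x ^ (2 * k + 1)) \<longlongrightarrow> sum a {..<K}) (at_left 1)"
      by (rule tendsto_eq_intros refl | simp)+
    have "\<forall>\<^sub>F x in at_left (1::real). x \<in> {0<..<1}"
      by (rule eventually_at_left_real) simp
    then show "\<forall>\<^sub>F x in at_left 1. (\<Sum>k<K. a k * x ^ (2 * k + 1)) \<le> pi / 2"
    proof eventually_elim
      case (elim x)
      then have s: "(\<lambda>k. a k * x ^ (2 * k + 1)) sums arcsin x" by (intro as) auto
      have "(\<Sum>k<K. a k * x ^ (2 * k + 1)) \<le> arcsin x"
        unfolding sums_unique[OF s]
        by (rule sum_le_suminf) (use elim a0 s in \<open>auto simp: sums_iff\<close>)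
      also have "arcsin x \<le> pi / 2" using elim by (intro arcsin_ubound) auto
      finally show ?case .
    qed
  qed simp
  have sa: "summable a" by (rule summableI_nonneg_bounded[OF a0 part])
  moreover have "suminf a \<le> pi / 2" by (rule suminf_le_const[OF sa part])
  moreover have "(\<lambda>k. a k * sin t ^ (2 * k + 1)) sums t" if t: "\<bar>t\<bar> < pi / 2" for t
  proof -
    have "\<bar>sin t\<bar> < 1"
      using sin_monotone_2pi[of t "pi/2"] sin_monotone_2pi[of "-(pi/2)" t] t by (auto simp: abs_less_iff)
    moreover have "arcsin (sin t) = t" using t by (intro arcsin_sin) auto
    ultimately show ?thesis using as[of "sin t"] by simp
  qed
  ultimately show ?thesis using that a0 by blast
qed

subsection \<open>Characters\<close>

lemma subalgebra_generated: "unital_cstar_subalgebra (cstar_generated X)"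
  unfolding cstar_generated_def unital_cstar_subalgebra_def by (auto intro!: closed_Inter)

lemma generated_superset: "x \<in> X \<Longrightarrow> x \<in> cstar_generated X"
  by (auto simp: cstar_generated_def)

context
  fixes S :: "'a::unital_cstar_algebra set"
  assumes S: "unital_cstar_subalgebra S"
begin

lemma sub_intros:
  "1 \<in> S" "x \<in> S \<Longrightarrow> y \<in> S \<Longrightarrow> x + y \<in> S" "x \<in> S \<Longrightarrow> y \<in> S \<Longrightarrow> x * y \<in> S" "x \<in> S \<Longrightarrow> c *\<^sub>C x \<in> S"
  "x \<in> S \<Longrightarrow> star x \<in> S" "closed S"
  using S by (auto simp: unital_cstar_subalgebra_def)

lemma sub_zero: "0 \<in> S"
  using sub_intros(4)[OF sub_intros(1), of 0] by simp

lemma sub_scaleR: "x \<in> S \<Longrightarrow> r *\<^sub>R x \<in> S"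
  using sub_intros(4)[of x "of_real r"] by (simp add: scaleC_of_real)

lemma sub_diff: "x \<in> S \<Longrightarrow> y \<in> S \<Longrightarrow> x - y \<in> S"
  using sub_intros(2)[of x "-1 *\<^sub>C y"] sub_intros(4)[of y "-1"] by (simp add: scaleC_minus1)

lemma sub_power: "x \<in> S \<Longrightarrow> x ^ k \<in> S"
  by (induction k) (auto intro: sub_intros)

lemma sub_sum: "(\<And>k. k \<in> I \<Longrightarrow> f k \<in> S) \<Longrightarrow> sum f I \<in> S"
  by (induction I rule: infinite_finite_induct) (auto intro: sub_intros sub_zero)

lemma sub_suminf: "f sums s \<Longrightarrow> (\<And>k. f k \<in> S) \<Longrightarrow> s \<in> S"
  unfolding sums_def by (rule closed_sequentially[OF sub_intros(6)]) (auto intro: sub_sum)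

context
  fixes \<phi> assumes chi: "character_on S \<phi>"
begin

lemma char_add: "x \<in> S \<Longrightarrow> y \<in> S \<Longrightarrow> \<phi> (x + y) = \<phi> x + \<phi> y"
  and char_mult: "x \<in> S \<Longrightarrow> y \<in> S \<Longrightarrow> \<phi> (x * y) = \<phi> x * \<phi> y"
  and char_scaleC: "x \<in> S \<Longrightarrow> \<phi> (c *\<^sub>C x) = c * \<phi> x"
  using chi by (auto simp: character_on_def)

lemma char_one: "\<phi> 1 = 1"
proof -
  obtain x where "x \<in> S" "\<phi> x \<noteq> 0" using chi by (auto simp: character_on_def)
  then show ?thesis using char_mult[of 1 x] sub_intros(1) by simp
qed

lemma char_scaleR: "x \<in> S \<Longrightarrow> \<phi> (r *\<^sub>R x) = of_real r * \<phi> x"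
  using char_scaleC[of x "of_real r"] by (simp add: scaleC_of_real)

lemma char_diff: "x \<in> S \<Longrightarrow> y \<in> S \<Longrightarrow> \<phi> (x - y) = \<phi> x - \<phi> y"
  using char_add[of x "-1 *\<^sub>C y"] char_scaleC[of y "-1"] sub_intros(4)[of y "-1"]
  by (simp add: scaleC_minus1)

lemma char_zero: "\<phi> 0 = 0"
  using char_scaleC[OF sub_intros(1), of 0] by simp

lemma char_sum: "(\<And>k. k \<in> I \<Longrightarrow> f k \<in> S) \<Longrightarrow> \<phi> (sum f I) = (\<Sum>k\<in>I. \<phi> (f k))"
  by (induction I rule: infinite_finite_induct) (auto simp: char_zero char_add sub_sum)

lemma char_bound: 
  assumes x: "x \<in> S"
  shows "cmod (\<phi> x) \<le> norm x"
proof (rule ccontr)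
  assume "\<not> ?thesis"
  then have l: "cmod (\<phi> x) > norm x" by simp
  then have l0: "\<phi> x \<noteq> 0" by auto
  define z where "z = inverse (\<phi> x) *\<^sub>C x"
  have zS: "z \<in> S" using x by (simp add: z_def sub_intros)
  have "norm z < 1" using l l0 by (simp add: z_def norm_scaleC norm_inverse norm_divide divide_simps)
  note y = left_inverse_one_minus[OF this]
  define y where "y = (\<Sum>k. z ^ k)"
  \<comment> \<open>The inverse has to lie in \<open>S\<close>, since \<open>\<phi>\<close> is
    multiplicative only there; closedness of \<open>S\<close> provides this.\<close>
  have yS: "y \<in> S" unfolding y_def by (rule sub_suminf[OF y(1)]) (rule sub_power[OF zS])
  have "\<phi> (y * (1 - z)) = \<phi> y * (1 - \<phi> z)"
    using yS zS by (simp add: char_mult char_diff sub_diff sub_intros(1) char_one)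
  also have "\<phi> z = 1" using x l0 by (simp add: z_def char_scaleC)
  finally show False using y(2) by (simp add: y_def char_one)
qed

text \<open>Adding \<open>\<i> t\<close> to \<open>h\<close> moves the imaginary part b of the value
  to b + t, while the norm bound on its squared modulus grows only by t^2. The squares of t cancel,
  and what remains bounds the linear function 2 b t of t from above; hence b = 0.\<close>

lemma char_self_adjoint_real:
  assumes h: "h \<in> S" "self_adjoint h"
  shows "\<phi> h = of_real (Re (\<phi> h))"
proof -
  define b where "b = Im (\<phi> h)"
  have ineq: "2 * b * t \<le> (norm h)\<^sup>2" for t :: real
  proof -
    define k where "k = h + (\<i> * of_real t) *\<^sub>C 1"
    have kS: "k \<in> S" unfolding k_def using h by (intro sub_intros)
    have "\<phi> k = \<phi> h + \<i> * of_real t" 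
      unfolding k_def using h by (simp add: char_add char_scaleC sub_intros char_one)
    then have "(cmod (\<phi> k))\<^sup>2 = (Re (\<phi> h))\<^sup>2 + (b + t)\<^sup>2"
      by (simp add: cmod_power2 b_def)
    moreover have "(cmod (\<phi> k))\<^sup>2 \<le> (norm k)\<^sup>2"
      by (rule power_mono[OF char_bound[OF kS]]) simp
    moreover have "(norm k)\<^sup>2 = norm (star k * k)" by (simp add: cstar_identity)
    moreover have "star k * k = h * h + (t\<^sup>2) *\<^sub>R 1"
    proof -
      have "star k = h - (\<i> * of_real t) *\<^sub>C 1"
        using h by (simp add: k_def star_add star_scaleC self_adjoint_def scaleC_minus_left)
      moreover have "(\<i> * of_real t) *\<^sub>C (\<i> * of_real t) *\<^sub>C (1 :: 'a) = (- (t\<^sup>2)) *\<^sub>R 1"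
      proof -
        have "\<i> * of_real t * (\<i> * of_real t) = complex_of_real (- (t\<^sup>2))"
          by (simp add: complex_eq_iff power2_eq_square)
        then show ?thesis unfolding scaleC_scaleC by (simp only: scaleC_of_real)
      qed
      ultimately show ?thesis
        unfolding k_def
        by (simp add: ring_distribs mult_scaleC_left mult_scaleC_right scaleC_diff_right)
    qed
    moreover have "norm (h * h + (t\<^sup>2) *\<^sub>R 1) \<le> (norm h)\<^sup>2 + t\<^sup>2"
      using norm_triangle_ineq[of "h * h" "(t\<^sup>2) *\<^sub>R (1 :: 'a)"] norm_mult_ineq[of h h]
      by (simp add: power2_eq_square)
    ultimately have "(Re (\<phi> h))\<^sup>2 + (b + t)\<^sup>2 \<le> (norm h)\<^sup>2 + t\<^sup>2" by simp
    then have "(Re (\<phi> h))\<^sup>2 + b\<^sup>2 + 2 * b * t \<le> (norm h)\<^sup>2" by (simp add: power2_sum)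
    then show ?thesis using zero_le_power2[of "Re (\<phi> h)"] zero_le_power2[of b] by linarith
  qed
  have "b = 0"
  proof (rule ccontr)
    assume "b \<noteq> 0"
    then have "2 * b * (((norm h)\<^sup>2 + 1) / (2 * b)) = (norm h)\<^sup>2 + 1" by simp
    then show False using ineq[of "((norm h)\<^sup>2 + 1) / (2 * b)"] by simp
  qed
  then show ?thesis by (simp add: b_def complex_eq_iff)
qed

end
end

subsection \<open>Subhomogeneous algebras\<close>

context matrix_rep
begin

lemma entry_sums: "f sums s \<Longrightarrow> i < n \<Longrightarrow> j < n \<Longrightarrow> (\<lambda>k. \<pi> (f k) $$ (i, j)) sums (\<pi> s $$ (i, j))"
  using bounded_linear.sums[OF bounded_linear_entry] .

lemma diagonal_power:
  assumes "diagonal_mat (\<pi> x)"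
  shows "diagonal_mat (\<pi> (x ^ k))" "j < n \<Longrightarrow> \<pi> (x ^ k) $$ (j, j) = \<pi> x $$ (j, j) ^ k"
proof -
  have "diagonal_mat (\<pi> (x ^ k)) \<and> (\<forall>j<n. \<pi> (x ^ k) $$ (j, j) = \<pi> x $$ (j, j) ^ k)"
  proof (induction k)
    case 0
    then show ?case by (auto simp: one diagonal_mat_def)
  next
    case (Suc k)
    then show ?case using assms unfolding diagonal_mat_def
      by (auto simp: diagonal_mult[OF assms])
  qed
  then show "diagonal_mat (\<pi> (x ^ k))" "j < n \<Longrightarrow> \<pi> (x ^ k) $$ (j, j) = \<pi> x $$ (j, j) ^ k" by auto
qed

lemma diagonal_sums:
  assumes "f sums s" "\<And>k. diagonal_mat (\<pi> (f k))"
  shows "diagonal_mat (\<pi> s)"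
  unfolding diagonal_mat_def
proof (intro allI impI)
  fix i j assume ij: "i < dim_row (\<pi> s)" "j < dim_col (\<pi> s)" "i \<noteq> j"
  then have "(\<lambda>k. \<pi> (f k) $$ (i, j)) sums (\<pi> s $$ (i, j))" by (intro entry_sums assms) auto
  moreover have "\<pi> (f k) $$ (i, j) = 0" for k using assms(2)[of k] ij by (simp add: diagonal_mat_def)
  ultimately show "\<pi> s $$ (i, j) = 0" by (simp add: sums_iff)
qed

lemma diagonal_exp:
  assumes "diagonal_mat (\<pi> x)"
  shows "diagonal_mat (\<pi> (exp x))" "j < n \<Longrightarrow> \<pi> (exp x) $$ (j, j) = exp (\<pi> x $$ (j, j))"
proof -
  have s: "(\<lambda>k. x ^ k /\<^sub>R fact k) sums exp x" by (rule exp_converges)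
  show "diagonal_mat (\<pi> (exp x))"
    by (rule diagonal_sums[OF s]) (use diagonal_power[OF assms] in \<open>auto simp: diagonal_mat_def entry_scaleR\<close>)
  assume j: "j < n"
  have "(\<lambda>k. \<pi> x $$ (j, j) ^ k /\<^sub>R fact k) sums (\<pi> (exp x) $$ (j, j))"
    using entry_sums[OF s j j] j diagonal_power(2)[OF assms j]
    by (simp add: entry_scaleR scaleR_conv_of_real[where 'a = complex])
  then show "\<pi> (exp x) $$ (j, j) = exp (\<pi> x $$ (j, j))"
    using exp_converges[of "\<pi> x $$ (j, j)"] sums_unique2 by blast
qed

end

lemma exp_rep_cong:
  assumes "matrix_rep n \<pi>" "\<pi> x = \<pi> y"
  shows "\<pi> (exp x) = \<pi> (exp y)"
proof -
  interpret matrix_rep n \<pi> by fact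
  have pw: "\<pi> (x ^ k) = \<pi> (y ^ k)" for k
    by (induction k) (simp_all add: mult assms(2))
  show ?thesis
  proof (rule eq_matI)
    fix i j assume "i < dim_row (\<pi> (exp y))" "j < dim_col (\<pi> (exp y))"
    then have ij: "i < n" "j < n" by auto
    have "(\<lambda>k. \<pi> (x ^ k /\<^sub>R fact k) $$ (i, j)) sums (\<pi> (exp x) $$ (i, j))"
      by (rule entry_sums[OF exp_converges ij])
    moreover have "(\<lambda>k. \<pi> (y ^ k /\<^sub>R fact k) $$ (i, j)) sums (\<pi> (exp y) $$ (i, j))"
      by (rule entry_sums[OF exp_converges ij])
    ultimately show "\<pi> (exp x) $$ (i, j) = \<pi> (exp y) $$ (i, j)"
      using ij by (simp add: entry_scaleR pw sums_iff)
  qed auto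
qed

locale subhom =
  fixes N :: nat and R :: "('a::unital_cstar_algebra \<Rightarrow> complex mat) set"
  assumes R: "\<And>\<pi>. \<pi> \<in> R \<Longrightarrow> \<exists>n. 1 \<le> n \<and> n \<le> N \<and> rep_onto_matrix_algebra n \<pi>"
    and inj_R: "inj (direct_sum_rep R)"
begin

lemma faithful:
  assumes "\<And>\<pi>. \<pi> \<in> R \<Longrightarrow> \<pi> x = \<pi> y"
  shows "x = y"
proof -
  have "direct_sum_rep R x = direct_sum_rep R y"
    using assms by (auto simp: direct_sum_rep_def restrict_def)
  then show ?thesis using inj_R by (simp add: inj_eq)
qed

lemma faithful_diagonal:
  assumes "\<And>\<pi> n. \<pi> \<in> R \<Longrightarrow> n \<le> N \<Longrightarrow> rep_onto_matrix_algebra n \<pi> \<Longrightarrow> \<exists>U. unitary_mat n U \<and>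
      diagonal_mat (mat_adjoint U * \<pi> x * U) \<and> diagonal_mat (mat_adjoint U * \<pi> y * U) \<and>
      (\<forall>j<n. (mat_adjoint U * \<pi> x * U) $$ (j, j) = (mat_adjoint U * \<pi> y * U) $$ (j, j))"
  shows "x = y"
proof (rule faithful)
  fix \<pi> assume pi: "\<pi> \<in> R"
  obtain n where n: "rep_onto_matrix_algebra n \<pi>" "n \<le> N" using R[OF pi] by blast
  interpret matrix_rep n \<pi> by (rule rep_onto_matrix_rep[OF n(1)])
  obtain U where U: "unitary_mat n U" and D: "diagonal_mat (mat_adjoint U * \<pi> x * U)"
      "diagonal_mat (mat_adjoint U * \<pi> y * U)"
    and e: "\<And>j. j < n \<Longrightarrow> (mat_adjoint U * \<pi> x * U) $$ (j, j) = (mat_adjoint U * \<pi> y * U) $$ (j, j)"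
    using assms[OF pi n(2,1)] by blast
  have Uc: "U \<in> carrier_mat n n" using U by (simp add: unitary_mat_def)
  have "mat_adjoint U * \<pi> x * U = mat_adjoint U * \<pi> y * U"
  proof (rule eq_matI)
    fix i j assume "i < dim_row (mat_adjoint U * \<pi> y * U)" "j < dim_col (mat_adjoint U * \<pi> y * U)"
    then have "i < n" "j < n" using Uc by auto
    then show "(mat_adjoint U * \<pi> x * U) $$ (i, j) = (mat_adjoint U * \<pi> y * U) $$ (i, j)"
      using D e Uc unfolding diagonal_mat_def by (cases "i = j") (auto simp del: index_mult_mat(1))
  qed (use Uc in auto)
  then show "\<pi> x = \<pi> y" using conj_inverse[OF U] by metis
qed

text \<open>
  If all eigenvalues of the matrices \<open>\<rho>(h)\<close> (\<open>\<rho> \<in> R\<close>) lie in \<open>(-\<pi>/2, \<pi>/2)\<close> then \<open>h = arcsin (sin h)\<close>, and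
  the right-hand side has norm at most \<open>\<pi>/2\<close>, because the arcsine series has nonnegative
  coefficients with sum \<open>\<pi>/2\<close> and \<open>sin h\<close> is half the difference of two unitaries.
\<close>

lemma norm_self_adjoint_le:
  assumes h: "self_adjoint h"
    and le: "\<And>\<pi> n. \<pi> \<in> R \<Longrightarrow> n \<le> N \<Longrightarrow> rep_onto_matrix_algebra n \<pi> \<Longrightarrow> \<exists>U. unitary_mat n U \<and>
      diagonal_mat (mat_adjoint U * \<pi> h * U) \<and> (\<forall>j<n. cmod ((mat_adjoint U * \<pi> h * U) $$ (j, j)) \<le> r)"
  shows "norm h \<le> r"
proof -
  have r0: "r \<ge> 0"
  proof -
    \<comment> \<open>The sign of \<open>r\<close> can only be read off from an eigenvalue, so some
      representation is required. An empty family cannot be faithful because 0 and 1 differ.\<close>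
    have "R \<noteq> {}"
    proof
      assume "R = {}"
      then have "(0 :: 'a) = 1" by (intro faithful) auto
      then show False by simp
    qed
    then obtain \<pi> where pi: "\<pi> \<in> R" by blast
    obtain n where n: "1 \<le> n" "rep_onto_matrix_algebra n \<pi>" "n \<le> N" using R[OF pi] by blast
    then obtain U where "\<forall>j<n. cmod ((mat_adjoint U * \<pi> h * U) $$ (j, j)) \<le> r"
      using le[OF pi n(3,2)] by blast
    then have "cmod ((mat_adjoint U * \<pi> h * U) $$ (0, 0)) \<le> r" using n by auto
    then show ?thesis by (rule order_trans[OF norm_ge_zero])
  qed
  obtain a :: "nat \<Rightarrow> real" where a: "\<And>k. a k \<ge> 0" "summable a" "suminf a \<le> pi / 2"
    "\<And>t. \<bar>t\<bar> < pi / 2 \<Longrightarrow> (\<lambda>k. a k * sin t ^ (2 * k + 1)) sums t"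
    using arcsin_series by metis
  show ?thesis
  proof (rule field_le_epsilon)
    fix e :: real assume e: "e > 0"
    \<comment> \<open>The scaling moves all eigenvalues into the open interval on which arcsin
      inverts sin; the slack \<open>e\<close> makes the inclusion strict and covers r = 0.\<close>
    define c where "c = pi / 2 / (r + e)"
    have c: "c > 0" "c * r < pi / 2" using e r0 by (auto simp: c_def divide_simps mult_less_cancel_left_pos)
    define k where "k = c *\<^sub>R h"
    define s where "s = (- \<i> / 2) *\<^sub>C (expi k - expi (- k))"
    have sak: "self_adjoint k" "self_adjoint (- k)"
      using h by (auto simp: k_def self_adjoint_def star_scaleR star_minus)
    have "norm s \<le> 1"
      using norm_triangle_ineq4[of "expi k" "expi (- k)"] norm_unitary[OF unitary_expi[OF sak(1)]]
        norm_unitary[OF unitary_expi[OF sak(2)]] by (simp add: s_def norm_scaleC norm_divide)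
    then have ns: "norm (s ^ l) \<le> 1" for l
      using norm_power_ineq[of s l] power_le_one[of "norm s" l] by simp
    have nt: "norm (a l *\<^sub>R s ^ (2 * l + 1)) \<le> a l" for l
      using mult_left_mono[OF ns[of "2 * l + 1"] a(1)[of l]] a(1)[of l] by simp
    have sg: "summable (\<lambda>l. a l *\<^sub>R s ^ (2 * l + 1))"
      by (rule summable_comparison_test'[OF a(2)]) (rule nt)
    define g where "g = (\<Sum>l. a l *\<^sub>R s ^ (2 * l + 1))"
    have gs: "(\<lambda>l. a l *\<^sub>R s ^ (2 * l + 1)) sums g" unfolding g_def using sg by (rule summable_sums)
    have "norm g \<le> suminf a"
      unfolding g_def by (rule norm_suminf_le[OF nt a(2)])
    then have ng: "norm g \<le> pi / 2" using a(3) by simp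
    have "k = g"
    proof (rule faithful_diagonal)
      fix \<pi> n assume pi: "\<pi> \<in> R" "n \<le> N" "rep_onto_matrix_algebra n \<pi>"
      obtain U where U: "unitary_mat n U" and D: "diagonal_mat (mat_adjoint U * \<pi> h * U)"
        and b: "\<And>j. j < n \<Longrightarrow> cmod ((mat_adjoint U * \<pi> h * U) $$ (j, j)) \<le> r"
        using le[OF pi] by blast
      define \<rho> where "\<rho> = (\<lambda>x. mat_adjoint U * \<pi> x * U)"
      interpret r: matrix_rep n \<rho>
        unfolding \<rho>_def by (rule matrix_rep.conj_rep[OF rep_onto_matrix_rep[OF pi(3)] U])
      have Dh: "diagonal_mat (\<rho> h)" using D by (simp only: \<rho>_def)
      have Dk: "diagonal_mat (\<rho> k)" using Dh by (auto simp: k_def diagonal_mat_def r.entry_scaleR)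
      have Dik: "diagonal_mat (\<rho> (d *\<^sub>C k))" for d using Dk by (auto simp: diagonal_mat_def r.entry_scaleC)
      have Di: "diagonal_mat (\<rho> (\<i> *\<^sub>C k))" "diagonal_mat (\<rho> (\<i> *\<^sub>C (- k)))"
        using Dik[of \<i>] Dik[of "- \<i>"] by (auto simp: scaleC_minus_right scaleC_minus_left)
      have Ds: "diagonal_mat (\<rho> s)"
        using r.diagonal_exp(1)[OF Di(1)] r.diagonal_exp(1)[OF Di(2)]
        by (auto simp: s_def expi_def diagonal_mat_def r.entry_scaleC r.entry_diff)
      have Dg: "diagonal_mat (\<rho> g)"
      proof (rule r.diagonal_sums[OF gs])
        have "diagonal_mat (\<rho> (d *\<^sub>R s ^ m))" for d m
          using r.diagonal_power(1)[OF Ds, of m] by (auto simp: diagonal_mat_def r.entry_scaleR)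
        then show "diagonal_mat (\<rho> (a l *\<^sub>R s ^ (2 * l + 1)))" for l .
      qed
      have "\<rho> k $$ (j, j) = \<rho> g $$ (j, j)" if j: "j < n" for j
      proof -
        define t where "t = Re (\<rho> k $$ (j, j))"
        have "cnj (\<rho> k $$ (j, j)) = \<rho> k $$ (j, j)"
          using r.entry_star[OF j j, of k] sak by (simp add: self_adjoint_def)
        then have t: "\<rho> k $$ (j, j) = of_real t"
          by (simp add: t_def complex_eq_iff)
        have "cmod (\<rho> k $$ (j, j)) \<le> c * r"
          using b[OF j] c by (simp add: k_def r.entry_scaleR j norm_mult) (simp add: \<rho>_def)
        then have tb: "\<bar>t\<bar> < pi / 2" using c t by simp
        have sj: "\<rho> s $$ (j, j) = of_real (sin t)"
        proof -
          have "\<rho> s $$ (j, j) = (- \<i> / 2) * (exp (\<i> * of_real t) - exp (- (\<i> * of_real t)))"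
            using j by (simp add: s_def expi_def r.entry_scaleC r.entry_diff r.diagonal_exp(2)[OF Di(1)]
                r.diagonal_exp(2)[OF Di(2)] t r.entry_minus)
          also have "\<dots> = sin (of_real t)" by (simp add: sin_exp_eq field_simps)
          finally show ?thesis by (simp add: sin_of_real)
        qed
        have "(\<lambda>l. \<rho> (a l *\<^sub>R s ^ (2 * l + 1)) $$ (j, j)) sums (\<rho> g $$ (j, j))"
          by (rule r.entry_sums[OF gs j j])
        moreover have "\<rho> (a l *\<^sub>R s ^ (2 * l + 1)) $$ (j, j) = of_real (a l * sin t ^ (2 * l + 1))" for l
          using j by (simp only: r.entry_scaleR r.diagonal_power(2)[OF Ds j] sj of_real_mult of_real_power)
        moreover have "(\<lambda>l. complex_of_real (a l * sin t ^ (2 * l + 1))) sums of_real t"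
          using a(4)[OF tb] by (rule sums_of_real)
        ultimately show ?thesis using t by (simp add: sums_iff)
      qed
      then show "\<exists>U. unitary_mat n U \<and>
          diagonal_mat (mat_adjoint U * \<pi> k * U) \<and> diagonal_mat (mat_adjoint U * \<pi> g * U) \<and>
          (\<forall>j<n. (mat_adjoint U * \<pi> k * U) $$ (j, j) = (mat_adjoint U * \<pi> g * U) $$ (j, j))"
        using U Dk Dg unfolding \<rho>_def by blast
    qed
    then have "norm (c *\<^sub>R h) \<le> pi / 2" using ng by (simp only: k_def)
    then have "c * norm h \<le> pi / 2" using c by simp
    then show "norm h \<le> r + e" using e r0 by (simp add: c_def divide_simps)
  qed
qed

end

subsection \<open>The joint functional calculus\<close>

abbreviation gen_alg :: "('a::unital_cstar_algebra) ^ 'm \<Rightarrow> 'a set"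
  where "gen_alg A \<equiv> cstar_generated (range (\<lambda>i. A $ i))"

abbreviation spec_point :: "('a::unital_cstar_algebra) ^ 'm \<Rightarrow> ('a \<Rightarrow> complex) \<Rightarrow> real ^ 'm"
  where "spec_point A \<phi> \<equiv> (\<chi> i. Re (\<phi> (A $ i)))"

lemma gen_alg_component: "A $ i \<in> gen_alg A"
  by (rule generated_superset) simp

lemmas gen_alg_sub = sub_intros[OF subalgebra_generated] sub_zero[OF subalgebra_generated]
  sub_scaleR[OF subalgebra_generated] sub_diff[OF subalgebra_generated] sub_sum[OF subalgebra_generated]
  gen_alg_component

lemma spec_point_bound:
  assumes "character_on (gen_alg A) \<phi>"
  shows "\<bar>spec_point A \<phi> $ i\<bar> \<le> norm (A $ i)"
  using order_trans[OF abs_Re_le_cmod char_bound[OF subalgebra_generated assms gen_alg_component]] by simp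

context subhom
begin

context
  fixes A :: "'a ^ 'm"
  assumes A: "abelian_family A"
begin

text \<open>In a basis that diagonalizes \<open>A\<close> the diagonal entries are characters, so
  characters separate the points of the generated algebra because the representations in
  \<open>R\<close> do. The same reduction yields the two lemmas that follow, on self-adjointness and
  on the norm.\<close>

lemma generated_eqI:
  assumes xy: "x \<in> gen_alg A" "y \<in> gen_alg A"
    and eq: "\<And>\<phi>. character_on (gen_alg A) \<phi> \<Longrightarrow> \<phi> x = \<phi> y"
  shows "x = y"
proof (rule faithful_diagonal)
  fix \<pi> n assume pi: "\<pi> \<in> R" "n \<le> N" "rep_onto_matrix_algebra n \<pi>"
  interpret p: matrix_rep n \<pi> by (rule rep_onto_matrix_rep[OF pi(3)])
  obtain U where U: "unitary_mat n U" and D: "\<And>i. diagonal_mat (mat_adjoint U * \<pi> (A $ i) * U)"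
    using p.diagonalize[OF A] by blast
  interpret r: matrix_rep n "\<lambda>x. mat_adjoint U * \<pi> x * U" by (rule p.conj_rep[OF U])
  show "\<exists>U. unitary_mat n U \<and>
      diagonal_mat (mat_adjoint U * \<pi> x * U) \<and> diagonal_mat (mat_adjoint U * \<pi> y * U) \<and>
      (\<forall>j<n. (mat_adjoint U * \<pi> x * U) $$ (j, j) = (mat_adjoint U * \<pi> y * U) $$ (j, j))"
    using U r.diagonal_generated[of A, OF D] xy eq[OF r.diagonal_character[of A, OF D]] by blast
qed

lemma generated_self_adjointI:
  assumes x: "x \<in> gen_alg A"
    and real: "\<And>\<phi>. character_on (gen_alg A) \<phi> \<Longrightarrow> \<phi> x \<in> \<real>"
  shows "self_adjoint x"
  unfolding self_adjoint_def
proof (rule faithful_diagonal)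
  fix \<pi> n assume pi: "\<pi> \<in> R" "n \<le> N" "rep_onto_matrix_algebra n \<pi>"
  interpret p: matrix_rep n \<pi> by (rule rep_onto_matrix_rep[OF pi(3)])
  obtain U where U: "unitary_mat n U" and D: "\<And>i. diagonal_mat (mat_adjoint U * \<pi> (A $ i) * U)"
    using p.diagonalize[OF A] by blast
  interpret r: matrix_rep n "\<lambda>x. mat_adjoint U * \<pi> x * U" by (rule p.conj_rep[OF U])
  have "(mat_adjoint U * \<pi> (star x) * U) $$ (j, j) = (mat_adjoint U * \<pi> x * U) $$ (j, j)" if "j < n" for j
    using real[OF r.diagonal_character[of A, OF D that]] r.entry_star[OF that that, of x]
    by (simp add: Reals_cnj_iff del: index_mult_mat(1))
  then show "\<exists>U. unitary_mat n U \<and>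
      diagonal_mat (mat_adjoint U * \<pi> (star x) * U) \<and> diagonal_mat (mat_adjoint U * \<pi> x * U) \<and>
      (\<forall>j<n. (mat_adjoint U * \<pi> (star x) * U) $$ (j, j) = (mat_adjoint U * \<pi> x * U) $$ (j, j))"
    using U r.diagonal_generated[of A, OF D] x gen_alg_sub(5)[OF x] by blast
qed

lemma generated_norm_le:
  assumes x: "x \<in> gen_alg A" "self_adjoint x"
    and le: "\<And>\<phi>. character_on (gen_alg A) \<phi> \<Longrightarrow> cmod (\<phi> x) \<le> r"
  shows "norm x \<le> r"
proof (rule norm_self_adjoint_le[OF x(2)])
  fix \<pi> n assume pi: "\<pi> \<in> R" "n \<le> N" "rep_onto_matrix_algebra n \<pi>"
  interpret p: matrix_rep n \<pi> by (rule rep_onto_matrix_rep[OF pi(3)])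
  obtain U where U: "unitary_mat n U" and D: "\<And>i. diagonal_mat (mat_adjoint U * \<pi> (A $ i) * U)"
    using p.diagonalize[OF A] by blast
  interpret r: matrix_rep n "\<lambda>x. mat_adjoint U * \<pi> x * U" by (rule p.conj_rep[OF U])
  show "\<exists>U. unitary_mat n U \<and> diagonal_mat (mat_adjoint U * \<pi> x * U) \<and>
      (\<forall>j<n. cmod ((mat_adjoint U * \<pi> x * U) $$ (j, j)) \<le> r)"
    using U r.diagonal_generated[of A, OF D] x(1) le[OF r.diagonal_character[of A, OF D]] by blast
qed

lemma component_char: "character_on (gen_alg A) \<phi> \<Longrightarrow> \<phi> (A $ i) = of_real (Re (\<phi> (A $ i)))"
  by (rule char_self_adjoint_real[OF subalgebra_generated _ gen_alg_component])
    (use A in \<open>auto simp: abelian_family_def\<close>)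

lemma polynomial_calculus:
  assumes "real_polynomial_function f"
  shows "\<exists>c\<in>gen_alg A. \<forall>\<phi>. character_on (gen_alg A) \<phi> \<longrightarrow> \<phi> c = of_real (f (spec_point A \<phi>))"
  using assms
proof (induction f rule: real_polynomial_function.induct)
  case (linear f)
  define c where "c = (\<Sum>i\<in>UNIV. f (axis i 1) *\<^sub>R A $ i)"
  have "\<phi> c = of_real (f (spec_point A \<phi>))" if phi: "character_on (gen_alg A) \<phi>" for \<phi>
  proof -
    have "\<phi> c = (\<Sum>i\<in>UNIV. of_real (f (axis i 1)) * \<phi> (A $ i))"
      unfolding c_def by (simp add: char_sum[OF subalgebra_generated phi] gen_alg_sub
          char_scaleR[OF subalgebra_generated phi])
    also have "\<dots> = of_real (\<Sum>i\<in>UNIV. f (axis i 1) * Re (\<phi> (A $ i)))"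
      using component_char[OF phi] by (metis (no_types, lifting) of_real_mult of_real_sum sum.cong)
    also have "(\<Sum>i\<in>UNIV. f (axis i 1) * Re (\<phi> (A $ i))) = f (\<Sum>i\<in>UNIV. Re (\<phi> (A $ i)) *\<^sub>R axis i 1)"
      using bounded_linear.linear[OF linear] by (simp add: linear_sum linear_scale mult.commute)
    also have "(\<Sum>i\<in>UNIV. Re (\<phi> (A $ i)) *\<^sub>R axis i 1) = spec_point A \<phi>"
      using basis_expansion[of "spec_point A \<phi>"] by (simp add: scalar_mult_eq_scaleR)
    finally show ?thesis .
  qed
  moreover have "c \<in> gen_alg A" unfolding c_def by (intro gen_alg_sub)
  ultimately show ?case by blast
next
  case (const r)
  show ?case
    by (rule bexI[of _ "r *\<^sub>R 1"])
      (auto simp: gen_alg_sub char_scaleR[OF subalgebra_generated] char_one[OF subalgebra_generated])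
next
  case (add f g)
  then obtain c d where "c \<in> gen_alg A" "\<forall>\<phi>. character_on (gen_alg A) \<phi> \<longrightarrow> \<phi> c = of_real (f (spec_point A \<phi>))"
    "d \<in> gen_alg A" "\<forall>\<phi>. character_on (gen_alg A) \<phi> \<longrightarrow> \<phi> d = of_real (g (spec_point A \<phi>))" by blast
  then show ?case
    by (intro bexI[of _ "c + d"]) (auto simp: gen_alg_sub char_add[OF subalgebra_generated])
next
  case (mult f g)
  then obtain c d where "c \<in> gen_alg A" "\<forall>\<phi>. character_on (gen_alg A) \<phi> \<longrightarrow> \<phi> c = of_real (f (spec_point A \<phi>))"
    "d \<in> gen_alg A" "\<forall>\<phi>. character_on (gen_alg A) \<phi> \<longrightarrow> \<phi> d = of_real (g (spec_point A \<phi>))" by blast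
  then show ?case
    by (intro bexI[of _ "c * d"]) (auto simp: gen_alg_sub char_mult[OF subalgebra_generated])
qed

text \<open>A box around the joint spectrum. Its compactness is evident, so approximation and
  covering arguments can do without a topology on the set of characters.\<close>

definition spec_box :: "(real ^ 'm) set"
  where "spec_box = {v. \<forall>i. \<bar>v $ i\<bar> \<le> norm (A $ i)}"

lemma spec_box: "compact spec_box" "0 \<in> spec_box" "character_on (gen_alg A) \<phi> \<Longrightarrow> spec_point A \<phi> \<in> spec_box"
proof -
  have "spec_box = cbox (\<chi> i. - norm (A $ i)) (\<chi> i. norm (A $ i))"
    by (auto simp: spec_box_def mem_box_cart abs_le_iff minus_le_iff)
  then show "compact spec_box" by simp
qed (use spec_point_bound in \<open>auto simp: spec_box_def\<close>)

text \<open>Polynomials that approximate \<open>f\<close> uniformly on the box give a Cauchy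
  sequence, because characters control the norm of self-adjoint elements of the generated algebra.
  Characters are contractive, so their values pass to the limit.\<close>

lemma continuous_calculus:
  assumes f: "continuous_on UNIV f"
  shows "\<exists>c\<in>gen_alg A. \<forall>\<phi>. character_on (gen_alg A) \<phi> \<longrightarrow> \<phi> c = of_real (f (spec_point A \<phi>))"
proof -
  have "\<exists>c\<in>gen_alg A. self_adjoint c \<and> (\<forall>\<phi>. character_on (gen_alg A) \<phi> \<longrightarrow>
      cmod (\<phi> c - of_real (f (spec_point A \<phi>))) \<le> inverse (Suc k))" for k
  proof -
    obtain g where g: "real_polynomial_function g" "\<And>x. x \<in> spec_box \<Longrightarrow> \<bar>f x - g x\<bar> < inverse (Suc k)"
      using Stone_Weierstrass_real_polynomial_function[OF spec_box(1), of f "inverse (Suc k)"]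
        continuous_on_subset[OF f] by (metis inverse_positive_iff_positive of_nat_0_less_iff subset_UNIV zero_less_Suc)
    obtain c where c: "c \<in> gen_alg A" "\<And>\<phi>. character_on (gen_alg A) \<phi> \<Longrightarrow> \<phi> c = of_real (g (spec_point A \<phi>))"
      using polynomial_calculus[OF g(1)] by blast
    have "self_adjoint c"
      using c(2) by (intro generated_self_adjointI[OF c(1)]) (metis Reals_of_real)
    moreover have "cmod (\<phi> c - of_real (f (spec_point A \<phi>))) \<le> inverse (Suc k)"
      if "character_on (gen_alg A) \<phi>" for \<phi>
    proof -
      have "\<phi> c - of_real (f (spec_point A \<phi>)) = of_real (g (spec_point A \<phi>) - f (spec_point A \<phi>))"
        using c that by simp
      then have "cmod (\<phi> c - of_real (f (spec_point A \<phi>))) = \<bar>g (spec_point A \<phi>) - f (spec_point A \<phi>)\<bar>"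
        by (simp only: norm_of_real)
      then show ?thesis using g(2)[OF spec_box(3)[OF that]] by simp
    qed
    ultimately show ?thesis using c(1) by blast
  qed
  then obtain c where c: "\<And>k. c k \<in> gen_alg A" "\<And>k. self_adjoint (c k)"
    and le: "\<And>k \<phi>. character_on (gen_alg A) \<phi> \<Longrightarrow> cmod (\<phi> (c k) - of_real (f (spec_point A \<phi>))) \<le> inverse (Suc k)"
    by metis
  have dist: "norm (c k - c l) \<le> inverse (Suc k) + inverse (Suc l)" for k l
  proof (rule generated_norm_le)
    fix \<phi> assume phi: "character_on (gen_alg A) \<phi>"
    have "\<phi> (c k - c l) = (\<phi> (c k) - of_real (f (spec_point A \<phi>))) - (\<phi> (c l) - of_real (f (spec_point A \<phi>)))"
      by (simp add: char_diff[OF subalgebra_generated phi] c)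
    then show "cmod (\<phi> (c k - c l)) \<le> inverse (Suc k) + inverse (Suc l)"
      using norm_triangle_ineq4 le[OF phi, of k] le[OF phi, of l] by (smt (verit))
  qed (use c in \<open>auto intro: gen_alg_sub self_adjoint_intros\<close>)
  have "Cauchy c"
  proof (rule metric_CauchyI)
    fix e :: real assume "e > 0"
    then obtain M where M: "inverse (real (Suc M)) < e / 2"
      using reals_Archimedean[of "e / 2"] by auto
    have "dist (c k) (c l) < e" if "k \<ge> M" "l \<ge> M" for k l
    proof -
      have "inverse (real (Suc k)) \<le> inverse (real (Suc M))" "inverse (real (Suc l)) \<le> inverse (real (Suc M))"
        using that by (auto intro!: le_imp_inverse_le)
      then show ?thesis using dist[of k l] M unfolding dist_norm by linarith
    qed
    then show "\<exists>M. \<forall>k\<ge>M. \<forall>l\<ge>M. dist (c k) (c l) < e" by blast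
  qed
  then obtain x where x: "c \<longlonglongrightarrow> x" using Cauchy_convergent_iff convergent_def by blast
  have xS: "x \<in> gen_alg A" by (rule closed_sequentially[OF gen_alg_sub(6) c(1) x])
  have "\<phi> x = of_real (f (spec_point A \<phi>))" if phi: "character_on (gen_alg A) \<phi>" for \<phi>
  proof -
    have inv0: "(\<lambda>k. inverse (real (Suc k))) \<longlonglongrightarrow> 0" by (rule LIMSEQ_inverse_real_of_nat)
    have "(\<lambda>k. norm (c k - x)) \<longlonglongrightarrow> 0"
      using tendsto_norm_zero[OF LIM_zero[OF x]] .
    then have "(\<lambda>k. norm (c k - x) + inverse (real (Suc k))) \<longlonglongrightarrow> 0 + 0"
      by (rule tendsto_add[OF _ inv0])
    moreover have "cmod (\<phi> x - of_real (f (spec_point A \<phi>))) \<le> norm (c k - x) + inverse (real (Suc k))" for k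
    proof -
      have "\<phi> x - of_real (f (spec_point A \<phi>)) = (\<phi> (c k) - of_real (f (spec_point A \<phi>))) - \<phi> (c k - x)"
        by (simp add: char_diff[OF subalgebra_generated phi] c xS)
      then have "cmod (\<phi> x - of_real (f (spec_point A \<phi>)))
          \<le> cmod (\<phi> (c k) - of_real (f (spec_point A \<phi>))) + cmod (\<phi> (c k - x))"
        using norm_triangle_ineq4 by metis
      moreover have "cmod (\<phi> (c k - x)) \<le> norm (c k - x)"
        by (rule char_bound[OF subalgebra_generated phi]) (intro gen_alg_sub c xS)
      ultimately show ?thesis using le[OF phi, of k] by linarith
    qed
    ultimately have "cmod (\<phi> x - of_real (f (spec_point A \<phi>))) \<le> 0 + 0"
      by (intro LIMSEQ_le_const) auto
    then show ?thesis by simp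
  qed
  then show ?thesis using xS by blast
qed

lemma joint_fun_calc_eqI:
  assumes "c \<in> gen_alg A" "\<And>\<phi>. character_on (gen_alg A) \<phi> \<Longrightarrow> \<phi> c = of_real (f (spec_point A \<phi>))"
  shows "joint_fun_calc f A = c"
  unfolding joint_fun_calc_def Let_def
proof (rule the_equality)
  fix d assume "d \<in> gen_alg A \<and> (\<forall>\<phi>. character_on (gen_alg A) \<phi> \<longrightarrow> \<phi> d = of_real (f (spec_point A \<phi>)))"
  then show "d = c" using assms by (intro generated_eqI) auto
qed (use assms in auto)

lemma joint_fun_calc:
  assumes "continuous_on UNIV f"
  shows "joint_fun_calc f A \<in> gen_alg A"
    and "character_on (gen_alg A) \<phi> \<Longrightarrow> \<phi> (joint_fun_calc f A) = of_real (f (spec_point A \<phi>))"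
    and "self_adjoint (joint_fun_calc f A)"
proof -
  obtain c where c: "c \<in> gen_alg A" "\<And>\<phi>. character_on (gen_alg A) \<phi> \<Longrightarrow> \<phi> c = of_real (f (spec_point A \<phi>))"
    using continuous_calculus[OF assms] by blast
  then have e: "joint_fun_calc f A = c" by (rule joint_fun_calc_eqI)
  then show "joint_fun_calc f A \<in> gen_alg A"
    "character_on (gen_alg A) \<phi> \<Longrightarrow> \<phi> (joint_fun_calc f A) = of_real (f (spec_point A \<phi>))"
    using c by auto
  show "self_adjoint (joint_fun_calc f A)"
    unfolding e using c(2) by (intro generated_self_adjointI[OF c(1)]) (metis Reals_of_real)
qed

lemma joint_fun_calc_diagonal:
  assumes "matrix_rep n \<pi>" "\<And>i. diagonal_mat (\<pi> (A $ i))" "continuous_on UNIV f"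
  shows "diagonal_mat (\<pi> (joint_fun_calc f A))"
    and "j < n \<Longrightarrow> \<pi> (joint_fun_calc f A) $$ (j, j) = of_real (f (\<chi> i. Re (\<pi> (A $ i) $$ (j, j))))"
proof -
  interpret matrix_rep n \<pi> by fact
  show "diagonal_mat (\<pi> (joint_fun_calc f A))"
    by (rule diagonal_generated[OF assms(2) joint_fun_calc(1)[OF assms(3)]])
  assume "j < n"
  then show "\<pi> (joint_fun_calc f A) $$ (j, j) = of_real (f (\<chi> i. Re (\<pi> (A $ i) $$ (j, j))))"
    using joint_fun_calc(2)[OF assms(3) diagonal_character[OF assms(2)]] by simp
qed

text \<open>Positivity of an element is always expressed by a square, since this is the form in
  which tracial states respect it.\<close>

lemma joint_fun_calc_square:
  assumes "continuous_on UNIV f" "\<And>x. x \<in> spec_box \<Longrightarrow> f x \<ge> 0"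
  obtains s where "self_adjoint s" "joint_fun_calc f A = s * s"
proof -
  define g where "g x = sqrt (max 0 (f x))" for x
  have g: "continuous_on UNIV g" unfolding g_def by (intro continuous_intros assms)
  have "joint_fun_calc f A = joint_fun_calc g A * joint_fun_calc g A"
  proof (rule joint_fun_calc_eqI)
    fix \<phi> assume phi: "character_on (gen_alg A) \<phi>"
    have "g (spec_point A \<phi>) * g (spec_point A \<phi>) = f (spec_point A \<phi>)"
      using assms(2)[OF spec_box(3)[OF phi]] by (simp add: g_def)
    then show "\<phi> (joint_fun_calc g A * joint_fun_calc g A) = of_real (f (spec_point A \<phi>))"
      using phi by (simp add: char_mult[OF subalgebra_generated phi] joint_fun_calc[OF g] flip: of_real_mult)
  qed (intro gen_alg_sub joint_fun_calc g)
  then show ?thesis using that joint_fun_calc(3)[OF g] by blast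
qed

lemma joint_fun_calc_affine:
  "joint_fun_calc (\<lambda>x. c + a \<bullet> x) A = c *\<^sub>R 1 + (\<Sum>i\<in>UNIV. a $ i *\<^sub>R A $ i)"
proof (rule joint_fun_calc_eqI)
  fix \<phi> assume phi: "character_on (gen_alg A) \<phi>"
  have "\<phi> (c *\<^sub>R 1 + (\<Sum>i\<in>UNIV. a $ i *\<^sub>R A $ i)) = of_real c + (\<Sum>i\<in>UNIV. of_real (a $ i) * \<phi> (A $ i))"
    by (simp add: char_add[OF subalgebra_generated phi] char_scaleR[OF subalgebra_generated phi]
        char_sum[OF subalgebra_generated phi] char_one[OF subalgebra_generated phi] gen_alg_sub)
  also have "(\<Sum>i\<in>UNIV. of_real (a $ i) * \<phi> (A $ i)) = of_real (\<Sum>i\<in>UNIV. a $ i * Re (\<phi> (A $ i)))"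
    using component_char[OF phi] by (metis (no_types, lifting) of_real_mult of_real_sum sum.cong)
  finally show "\<phi> (c *\<^sub>R 1 + (\<Sum>i\<in>UNIV. a $ i *\<^sub>R A $ i)) = of_real (c + a \<bullet> spec_point A \<phi>)"
    by (simp add: inner_vec_def)
qed (intro gen_alg_sub)

end

subsection \<open>Tracial states\<close>

lemma tracial_state_linear:
  assumes "tracial_state \<tau>"
  shows "\<tau> (x + y) = \<tau> x + \<tau> y" "\<tau> (c *\<^sub>C x) = c * \<tau> x" "\<tau> (r *\<^sub>R x) = of_real r * \<tau> x"
    "\<tau> (x - y) = \<tau> x - \<tau> y" "\<tau> 0 = 0" "\<tau> (sum g I) = (\<Sum>k\<in>I. \<tau> (g k))"
    "\<tau> (x * y) = \<tau> (y * x)" "\<tau> 1 = 1"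
proof -
  interpret l: Vector_Spaces.linear "(*\<^sub>C)" "(*)" \<tau> using assms by (simp add: tracial_state_def)
  show "\<tau> (x + y) = \<tau> x + \<tau> y" "\<tau> (c *\<^sub>C x) = c * \<tau> x" "\<tau> (r *\<^sub>R x) = of_real r * \<tau> x"
    "\<tau> (x - y) = \<tau> x - \<tau> y" "\<tau> 0 = 0" "\<tau> (sum g I) = (\<Sum>k\<in>I. \<tau> (g k))"
    by (simp_all add: l.add l.scale l.diff l.zero l.sum scaleC_of_real[symmetric])
  show "\<tau> (x * y) = \<tau> (y * x)" "\<tau> 1 = 1" using assms by (simp_all add: tracial_state_def)
qed

lemma tracial_state_square:
  assumes "tracial_state \<tau>"
  shows "Re (\<tau> (star x * x)) \<ge> 0" "Im (\<tau> (star x * x)) = 0"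
proof -
  have "\<tau> (star x * x) \<in> \<real>\<^sub>\<ge>\<^sub>0" using assms unfolding tracial_state_def by blast
  then show "Re (\<tau> (star x * x)) \<ge> 0" "Im (\<tau> (star x * x)) = 0"
    by (simp_all only: complex_nonneg_Reals_iff)
qed

text \<open>Positivity of \<open>\<tau>\<close> is given only on elements \<open>star x * x\<close>;
  the calculus for the family with the single member \<open>h\<close> writes
  \<open>norm h *\<^sub>R 1 - h\<close> in this form.\<close>

lemma tracial_state_self_adjoint:
  fixes h :: 'a
  assumes t: "tracial_state \<tau>" and h: "self_adjoint h"
  shows "Im (\<tau> h) = 0" "Re (\<tau> h) \<le> norm h"
proof -
  define H :: "'a ^ 1" where "H = (\<chi> i. h)"
  have H: "abelian_family H" using h by (simp add: abelian_family_def H_def)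
  have ax: "(axis 1 1 :: real ^ 1) \<bullet> x = x $ 1" for x by (simp add: inner_axis' )
  have "continuous_on UNIV (\<lambda>x :: real ^ 1. norm h + (- axis 1 1) \<bullet> x)" by (intro continuous_intros)
  then obtain s where s: "self_adjoint s" "joint_fun_calc (\<lambda>x :: real ^ 1. norm h + (- axis 1 1) \<bullet> x) H = s * s"
  proof (rule joint_fun_calc_square[OF H])
    fix x :: "real ^ 1" assume "x \<in> spec_box H"
    then have "\<bar>x $ 1\<bar> \<le> norm (H $ 1)" unfolding spec_box_def[OF H] by blast
    then show "norm h + (- axis 1 1) \<bullet> x \<ge> 0" by (simp add: ax H_def)
  qed
  then have "norm h *\<^sub>R 1 - h = star s * s"
    unfolding joint_fun_calc_affine[OF H] by (simp add: H_def axis_def self_adjoint_def sum_negf)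
  then have "of_real (norm h) - \<tau> h = \<tau> (star s * s)"
    using tracial_state_linear[OF t] by (metis mult.right_neutral)
  then have "Re (of_real (norm h) - \<tau> h) \<ge> 0" "Im (of_real (norm h) - \<tau> h) = 0"
    using tracial_state_square[OF t] by auto
  then show "Im (\<tau> h) = 0" "Re (\<tau> h) \<le> norm h" by auto
qed

text \<open>Continuity is automatic for states: only the self-adjoint part of \<open>x\<close>
  contributes to \<open>Re (\<tau> x)\<close>, and the norm of this part is at most that of
  \<open>x\<close>.\<close>

lemma bounded_linear_tracial_state:
  fixes \<tau> :: "'a \<Rightarrow> complex"
  assumes t: "tracial_state \<tau>"
  shows "bounded_linear (\<lambda>x. Re (\<tau> x))"
proof (rule bounded_linear_intro[of _ 1])
  have le: "Re (\<tau> x) \<le> norm x" for x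
  proof -
    define a b where "a = (1/2) *\<^sub>R (x + star x)" and "b = (- \<i> / 2) *\<^sub>C (x - star x)"
    have ab: "self_adjoint a" "self_adjoint b"
      by (simp_all add: a_def b_def self_adjoint_def star_scaleR star_scaleC star_add star_diff star_star add.commute
          scaleC_diff_right scaleC_minus_left)
    have "x = a + \<i> *\<^sub>C b"
    proof -
      have "\<i> *\<^sub>C b = (1/2) *\<^sub>R (x - star x)"
        by (simp add: b_def scaleC_scaleC flip: scaleC_of_real)
      then have "a + \<i> *\<^sub>C b = (1/2) *\<^sub>R ((x + star x) + (x - star x))"
        by (simp only: a_def scaleR_add_right)
      also have "(x + star x) + (x - star x) = 2 *\<^sub>R x" by (simp add: scaleR_2)
      finally show ?thesis by simp
    qed
    then have "Re (\<tau> x) = Re (\<tau> a)"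
      using tracial_state_linear(1,2)[OF t] tracial_state_self_adjoint(1)[OF t ab(2)] by simp
    also have "\<dots> \<le> norm a" by (rule tracial_state_self_adjoint[OF t ab(1)])
    also have "\<dots> \<le> norm x" using norm_triangle_ineq[of x "star x"] by (simp add: a_def)
    finally show ?thesis .
  qed
  show "norm (Re (\<tau> x)) \<le> norm x * 1" for x
    using le[of x] le[of "- x"] tracial_state_linear(3)[OF t, of "-1" x] by (simp add: abs_le_iff)
qed (simp_all add: tracial_state_linear[OF t])

end

section \<open>Majorization from membership in the closed convex hull\<close>

lemma convex_affine_minorant:
  fixes f :: "'b::euclidean_space \<Rightarrow> real"
  assumes f: "convex_on UNIV f" "continuous_on UNIV f" and e: "e > 0"
  obtains c a where "\<And>x. c + a \<bullet> x \<le> f x" "c + a \<bullet> y > f y - e"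
proof -
  define E where "E = {p :: 'b \<times> real. f (fst p) \<le> snd p}"
  have "epigraph UNIV f = E" by (auto simp: epigraph_def E_def)
  then have cE: "convex E" using f(1) convex_epigraph[of UNIV f] by simp
  have clE: "closed E" unfolding E_def
    by (intro closed_Collect_le continuous_intros continuous_on_compose2[OF f(2)]) auto
  \<comment> \<open>The minorant will take the value \<open>f y - e / 2\<close> at \<open>y\<close>;
    half of \<open>e\<close> leaves room for the strict inequality.\<close>
  have "(y, f y - e / 2) \<notin> E" using e by (simp add: E_def)
  then obtain q b where q: "q \<bullet> (y, f y - e / 2) < b" "\<And>x. x \<in> E \<Longrightarrow> q \<bullet> x > b"
    using separating_hyperplane_closed_point[OF cE clE] by metis
  obtain u s where us: "q = (u, s)" by (cases q)
  have q1: "u \<bullet> y + s * (f y - e / 2) < b" using q(1) us by simp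
  have q2: "u \<bullet> x + s * f x > b" for x using q(2)[of "(x, f x)"] us by (simp add: E_def)
  \<comment> \<open>The separated point lies vertically below a point of the epigraph, so the
    hyperplane is not vertical, and dividing by \<open>s\<close> makes it the graph of an affine
    function.\<close>
  have "s * (e / 2) > 0" using q1 q2[of y] by (simp add: algebra_simps)
  then have s: "s > 0" using e by (simp add: zero_less_mult_iff)
  show ?thesis
  proof (rule that[of "f y - e / 2 + (u \<bullet> y) / s" "(- 1 / s) *\<^sub>R u"])
    fix x
    have "s * (f y - e / 2) + u \<bullet> y - u \<bullet> x \<le> s * f x" using q1 q2[of x] by linarith
    then have "(s * (f y - e / 2) + u \<bullet> y - u \<bullet> x) / s \<le> f x" using s by (simp add: divide_le_eq mult.commute)
    then show "f y - e / 2 + (u \<bullet> y) / s + ((- 1 / s) *\<^sub>R u) \<bullet> x \<le> f x"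
      using s by (simp add: add_divide_distrib diff_divide_distrib)
  qed (use e s in auto)
qed

text \<open>The components of \<open>X\<close> need not commute. This matters because
  \<open>X\<close> ranges over a convex hull, where affine functions still make sense but the
  functional calculus does not.\<close>

definition affine_at :: "real \<Rightarrow> real ^ 'm \<Rightarrow> ('a::unital_cstar_algebra) ^ 'm \<Rightarrow> 'a"
  where "affine_at c a X = c *\<^sub>R 1 + (\<Sum>i\<in>UNIV. a $ i *\<^sub>R X $ i)"

lemma continuous_affine_at: "continuous_on T (affine_at c a)"
  unfolding affine_at_def by (intro continuous_intros)

lemma affine_at_convex:
  fixes X Y :: "('a::unital_cstar_algebra) ^ 'm"
  assumes "u + v = 1"
  shows "affine_at c a (u *\<^sub>R X + v *\<^sub>R Y) = u *\<^sub>R affine_at c a X + v *\<^sub>R affine_at c a Y"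
proof -
  let ?S = "\<lambda>Z. \<Sum>i\<in>UNIV. a $ i *\<^sub>R Z $ i"
  have e: "u *\<^sub>R c *\<^sub>R 1 + v *\<^sub>R c *\<^sub>R 1 = c *\<^sub>R (1 :: 'a)"
    using assms by (simp flip: scaleR_add_left distrib_right)
  have "affine_at c a (u *\<^sub>R X + v *\<^sub>R Y) = c *\<^sub>R 1 + (u *\<^sub>R ?S X + v *\<^sub>R ?S Y)"
    by (simp add: affine_at_def scaleR_add_right sum.distrib scaleR_sum_right mult.commute)
  also have "\<dots> = (u *\<^sub>R c *\<^sub>R 1 + v *\<^sub>R c *\<^sub>R 1) + (u *\<^sub>R ?S X + v *\<^sub>R ?S Y)"
    by (simp only: e)
  also have "\<dots> = u *\<^sub>R affine_at c a X + v *\<^sub>R affine_at c a Y"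
    by (simp only: affine_at_def scaleR_add_right add_ac)
  finally show ?thesis .
qed

lemma affine_at_conj:
  assumes "star u * u = 1"
  shows "affine_at c a (\<chi> i. star u * B $ i * u) = star u * affine_at c a B * u"
  using assms by (simp add: affine_at_def ring_distribs sum_distrib_left sum_distrib_right mult.assoc)

context subhom
begin

lemma majorized_if_closure:
  fixes A B :: "'a ^ 'm"
  assumes A: "abelian_family A" and B: "abelian_family B"
    and cl: "A \<in> closure (convex hull unitary_orbit B)"
  shows "A \<prec>\<^sub>t\<^sub>r B"
  unfolding tracially_majorized_def
proof (intro allI impI)
  fix \<tau> :: "'a \<Rightarrow> complex" and f :: "real ^ 'm \<Rightarrow> real"
  assume t: "tracial_state \<tau>" and fc: "continuous_on UNIV f" and fx: "convex_on UNIV f"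
  note tl = tracial_state_linear[OF t]
  interpret bl: bounded_linear "\<lambda>x. Re (\<tau> x)" by (rule bounded_linear_tracial_state[OF t])
  have sq: "Re (\<tau> (s * s)) \<ge> 0" if "self_adjoint s" for s
    using tracial_state_square(1)[OF t, of s] that by (simp add: self_adjoint_def)
  let ?K = "spec_box A"
  note K = spec_box[OF A]
  show "Re (\<tau> (joint_fun_calc f A)) \<le> Re (\<tau> (joint_fun_calc f B))"
  proof (rule field_le_epsilon)
    fix e :: real assume e: "e > 0"
    have "\<exists>c a. (\<forall>x. c + a \<bullet> x \<le> f x) \<and> c + a \<bullet> y > f y - e" for y
      using convex_affine_minorant[OF fx fc e] by metis
    then obtain c a where ca: "\<And>y x. c y + a y \<bullet> x \<le> f x" "\<And>y. c y + a y \<bullet> y > f y - e" by metis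
    \<comment> \<open>Positive exactly where the minorant attached to \<open>y\<close> comes within
      \<open>e\<close> of \<open>f\<close>. Normalizing finitely many of these functions gives the
      partition of unity.\<close>
    define g where "g y x = max 0 (c y + a y \<bullet> x - f x + e)" for y x
    have gc: "continuous_on UNIV (g y)" for y
      unfolding g_def by (intro continuous_intros fc)
    define O' where "O' y = {x. f x - e < c y + a y \<bullet> x}" for y
    have "open (O' y)" for y
      unfolding O'_def by (intro open_Collect_less continuous_intros fc)
    moreover have "?K \<subseteq> (\<Union>y\<in>?K. O' y)" using ca(2) by (auto simp: O'_def)
    ultimately obtain Y where Y: "Y \<subseteq> ?K" "finite Y" "?K \<subseteq> (\<Union>y\<in>Y. O' y)"
      using compactE_image[OF K(1), of ?K O'] by metis
    define G where "G x = (\<Sum>y\<in>Y. g y x)" for x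
    have Gc: "continuous_on UNIV G" unfolding G_def by (intro continuous_intros gc)
    have Gpos: "G x > 0" if x: "x \<in> ?K" for x
    proof -
      obtain y where y: "y \<in> Y" "x \<in> O' y" using x Y(3) by blast
      then have "g y x > 0" by (simp add: g_def O'_def)
      then show ?thesis unfolding G_def
        by (intro sum_pos2[OF Y(2) y(1)]) (auto simp: g_def)
    qed
    obtain x0 where x0: "x0 \<in> ?K" "\<And>x. x \<in> ?K \<Longrightarrow> G x0 \<le> G x"
      using continuous_attains_inf[OF K(1) _ continuous_on_subset[OF Gc]] K(2) by blast
    define d where "d = G x0"
    have d: "d > 0" "\<And>x. x \<in> ?K \<Longrightarrow> d \<le> G x" using x0 Gpos by (auto simp: d_def)
    \<comment> \<open>On the box \<open>max d (G x)\<close> is just \<open>G x\<close>; outside, it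
      keeps the quotient defined and continuous, since the calculus takes functions on the whole
      space.\<close>
    define p where "p y x = g y x / max d (G x)" for y x
    have pc: "continuous_on UNIV (p y)" for y
      unfolding p_def using d(1) by (intro continuous_intros gc Gc) auto
    have p0: "p y x \<ge> 0" for y x
      unfolding p_def using d(1) by (intro divide_nonneg_nonneg) (auto simp: g_def)
    have p1: "(\<Sum>y\<in>Y. p y x) = 1" if "x \<in> ?K" for x
      using d(2)[OF that] Gpos[OF that] by (simp add: p_def max_def flip: sum_divide_distrib) (simp add: G_def)
    define h where "h x = (\<Sum>y\<in>Y. p y x * (c y + a y \<bullet> x)) + e - f x" for x
    have hc: "continuous_on UNIV h" unfolding h_def by (intro continuous_intros pc fc)
    have h0: "h x \<ge> 0" if x: "x \<in> ?K" for x
    proof -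
      have "p y x * (f x - e) \<le> p y x * (c y + a y \<bullet> x)" for y
      proof (cases "c y + a y \<bullet> x > f x - e")
        case True
        then show ?thesis using p0 by (intro mult_left_mono) auto
      qed (auto simp: p_def g_def)
      then have "(\<Sum>y\<in>Y. p y x * (f x - e)) \<le> (\<Sum>y\<in>Y. p y x * (c y + a y \<bullet> x))" by (rule sum_mono)
      then show ?thesis using p1[OF x] by (simp add: h_def flip: sum_distrib_right)
    qed
    define P where "P y = joint_fun_calc (p y) A" for y
    have P1: "(\<Sum>y\<in>Y. P y) = 1"
    proof (rule generated_eqI[OF A])
      show "sum P Y \<in> gen_alg A" "1 \<in> gen_alg A" unfolding P_def by (intro gen_alg_sub joint_fun_calc A pc)+
      fix \<phi> assume phi: "character_on (gen_alg A) \<phi>"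
      have "\<phi> (sum P Y) = of_real (\<Sum>y\<in>Y. p y (spec_point A \<phi>))"
        unfolding P_def by (simp add: char_sum[OF subalgebra_generated phi] joint_fun_calc[OF A pc] phi)
      then show "\<phi> (sum P Y) = \<phi> 1"
        using p1[OF K(3)[OF phi]] char_one[OF subalgebra_generated phi] by simp
    qed
    have "joint_fun_calc h A = (\<Sum>y\<in>Y. P y * affine_at (c y) (a y) A) + e *\<^sub>R 1 - joint_fun_calc f A"
    proof (rule joint_fun_calc_eqI[OF A])
      have L: "affine_at (c y) (a y) A = joint_fun_calc (\<lambda>x. c y + a y \<bullet> x) A" for y
        by (simp add: affine_at_def joint_fun_calc_affine[OF A])
      have Lc: "continuous_on UNIV (\<lambda>x. c y + a y \<bullet> x)" for y by (intro continuous_intros)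
      show "(\<Sum>y\<in>Y. P y * affine_at (c y) (a y) A) + e *\<^sub>R 1 - joint_fun_calc f A \<in> gen_alg A"
        unfolding P_def L by (intro gen_alg_sub joint_fun_calc A pc Lc fc)
      fix \<phi> assume phi: "character_on (gen_alg A) \<phi>"
      note cr = subalgebra_generated phi
      note jc = joint_fun_calc(1)[OF A]
      have "\<phi> ((\<Sum>y\<in>Y. P y * affine_at (c y) (a y) A) + e *\<^sub>R 1 - joint_fun_calc f A)
        = (\<Sum>y\<in>Y. \<phi> (P y) * \<phi> (affine_at (c y) (a y) A)) + of_real e - \<phi> (joint_fun_calc f A)"
        unfolding P_def L
        by (simp add: char_sum[OF cr] char_mult[OF cr] char_add[OF cr] char_diff[OF cr] char_scaleR[OF cr]
            char_one[OF cr] gen_alg_sub jc pc Lc fc)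
      also have "\<dots> = of_real (h (spec_point A \<phi>))"
        unfolding P_def L joint_fun_calc(2)[OF A pc phi] joint_fun_calc(2)[OF A Lc phi] joint_fun_calc(2)[OF A fc phi]
        by (simp add: h_def)
      finally show "\<phi> ((\<Sum>y\<in>Y. P y * affine_at (c y) (a y) A) + e *\<^sub>R 1 - joint_fun_calc f A) = of_real (h (spec_point A \<phi>))" .
    qed
    moreover obtain s where "self_adjoint s" "joint_fun_calc h A = s * s"
      using joint_fun_calc_square[OF A hc h0] by metis
    ultimately have "0 \<le> Re (\<tau> ((\<Sum>y\<in>Y. P y * affine_at (c y) (a y) A) + e *\<^sub>R 1 - joint_fun_calc f A))"
      using sq by metis
    also have "\<dots> = (\<Sum>y\<in>Y. Re (\<tau> (P y * affine_at (c y) (a y) A))) + e - Re (\<tau> (joint_fun_calc f A))"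
      by (simp add: tl)
    finally have 1: "Re (\<tau> (joint_fun_calc f A)) \<le> (\<Sum>y\<in>Y. Re (\<tau> (P y * affine_at (c y) (a y) A))) + e" by simp
    \<comment> \<open>The weights \<open>P y\<close> stay frozen at \<open>A\<close>, so that
      \<open>L\<close> is affine and continuous in \<open>X\<close>. The inequality can then be
      checked on the orbit alone.\<close>
    define L where "L X = (\<Sum>y\<in>Y. Re (\<tau> (P y * affine_at (c y) (a y) X)))" for X
    define H where "H = {X. L X \<le> Re (\<tau> (joint_fun_calc f B))}"
    have "closed H"
      unfolding H_def L_def
      by (intro closed_Collect_le continuous_intros bl.continuous_on continuous_affine_at)
    moreover have "convex H"
    proof (rule convexI)
      fix X Z and u v :: real assume XZ: "X \<in> H" "Z \<in> H" and uv: "0 \<le> u" "0 \<le> v" "u + v = 1"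
      have "L (u *\<^sub>R X + v *\<^sub>R Z) = u * L X + v * L Z"
        unfolding L_def affine_at_convex[OF uv(3)]
        by (simp add: ring_distribs tl sum.distrib sum_distrib_left)
      also have "\<dots> \<le> u * Re (\<tau> (joint_fun_calc f B)) + v * Re (\<tau> (joint_fun_calc f B))"
        using XZ uv by (intro add_mono mult_left_mono) (auto simp: H_def)
      also have "\<dots> = Re (\<tau> (joint_fun_calc f B))" using uv(3) by (simp flip: distrib_right)
      finally show "u *\<^sub>R X + v *\<^sub>R Z \<in> H" by (simp add: H_def)
    qed
    moreover have "unitary_orbit B \<subseteq> H"
    proof
      fix X assume "X \<in> unitary_orbit B"
      then obtain u where u: "unitary u" and X: "X = (\<chi> i. star u * B $ i * u)" by (auto simp: unitary_orbit_def)
      have uu: "star u * u = 1" "u * star u = 1" using u by (auto simp: unitary_def)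
      have tm: "Re (\<tau> (P y * affine_at (c y) (a y) X)) \<le> Re (\<tau> (P y * (star u * joint_fun_calc f B * u)))" for y
      proof -
        have Lc: "continuous_on UNIV (\<lambda>x. c y + a y \<bullet> x)" by (intro continuous_intros)
        have "continuous_on UNIV (\<lambda>x. f x - (c y + a y \<bullet> x))" by (intro continuous_intros fc)
        then obtain s where s: "self_adjoint s" "joint_fun_calc (\<lambda>x. f x - (c y + a y \<bullet> x)) B = s * s"
          by (rule joint_fun_calc_square[OF B]) (use ca(1) in auto)
        have "joint_fun_calc (\<lambda>x. f x - (c y + a y \<bullet> x)) B = joint_fun_calc f B - affine_at (c y) (a y) B"
          unfolding affine_at_def joint_fun_calc_affine[OF B, symmetric]
          by (rule joint_fun_calc_eqI[OF B])
            (auto intro!: gen_alg_sub joint_fun_calc B fc Lc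
              simp: char_diff[OF subalgebra_generated] joint_fun_calc[OF B] fc Lc)
        then have ss: "joint_fun_calc f B - affine_at (c y) (a y) B = s * s" using s by simp
        obtain q where q: "self_adjoint q" "P y = q * q"
          unfolding P_def by (rule joint_fun_calc_square[OF A pc p0])
        \<comment> \<open>Both factors come from squares of self-adjoint elements; cyclicity of the
          trace rewrites the value on the product as one on \<open>star z * z\<close> with
          \<open>z = s * u * q\<close>.\<close>
        have "\<tau> (P y * (star u * (joint_fun_calc f B - affine_at (c y) (a y) B) * u))
            = \<tau> (q * (q * star u * s * s * u))"
          by (simp add: ss q mult.assoc)
        also have "\<dots> = \<tau> (star (s * u * q) * (s * u * q))"
          using s(1) q(1) by (subst tl(7)) (simp add: star_mult self_adjoint_def mult.assoc)
        finally have "Re (\<tau> (P y * (star u * (joint_fun_calc f B - affine_at (c y) (a y) B) * u))) \<ge> 0"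
          using tracial_state_square(1)[OF t] by simp
        then show ?thesis
          unfolding X affine_at_conj[OF uu(1)] by (simp add: ring_distribs tl)
      qed
      have "L X \<le> (\<Sum>y\<in>Y. Re (\<tau> (P y * (star u * joint_fun_calc f B * u))))"
        unfolding L_def by (rule sum_mono) (rule tm)
      also have "\<dots> = Re (\<tau> ((\<Sum>y\<in>Y. P y) * (star u * joint_fun_calc f B * u)))"
        by (simp only: sum_distrib_right tl Re_sum)
      also have "\<tau> ((\<Sum>y\<in>Y. P y) * (star u * joint_fun_calc f B * u)) = \<tau> (joint_fun_calc f B * (u * star u))"
        unfolding P1 using tl(7)[of "star u" "joint_fun_calc f B * u"] by (simp add: mult.assoc)
      finally show "X \<in> H" using uu by (simp add: H_def)
    qed
    ultimately have "closure (convex hull unitary_orbit B) \<subseteq> H"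
      by (intro closure_minimal hull_minimal)
    then have "L A \<le> Re (\<tau> (joint_fun_calc f B))" using cl by (auto simp: H_def)
    then show "Re (\<tau> (joint_fun_calc f A)) \<le> Re (\<tau> (joint_fun_calc f B)) + e"
      using 1 by (simp add: L_def)
  qed
qed

end

subsection \<open>Cyclic monotonicity\<close>

fun chain_sum :: "('b \<Rightarrow> 'b \<Rightarrow> real) \<Rightarrow> 'b list \<Rightarrow> real"
  where "chain_sum d (x # y # zs) = d x y + chain_sum d (y # zs)"
  | "chain_sum d _ = 0"

lemma chain_sum_append: "chain_sum d (xs @ [x]) = chain_sum d xs + (if xs = [] then 0 else d (last xs) x)"
  by (induction d xs rule: chain_sum.induct) auto

lemma chain_sum_split: "chain_sum d (xs @ y # ys) = chain_sum d (xs @ [y]) + chain_sum d (y # ys)"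
  by (induction d xs rule: chain_sum.induct) simp_all

lemma cycle_permutation:
  assumes "distinct (x # xs)"
  obtains p where "p permutes set (x # xs)"
    "(\<Sum>y\<in>set (x # xs). d y (p y)) = chain_sum d (x # xs @ [x])"
proof -
  define c where "c = x # xs"
  have dc: "distinct c" "c \<noteq> []" using assms by (auto simp: c_def)
  have p: "cycle_of_list c permutes set c"
    by (rule cycle_permutes)
  have m: "map (cycle_of_list c) c = rotate1 c"
    using cyclic_rotation[of c 1] dc(1) by simp
  have "(\<Sum>y\<in>set c. d y (cycle_of_list c y)) = sum_list (map (\<lambda>y. d y (cycle_of_list c y)) c)"
    using dc by (simp add: sum_list_distinct_conv_sum_set)
  also have "map (\<lambda>y. d y (cycle_of_list c y)) c = map (\<lambda>(y, z). d y z) (zip c (rotate1 c))"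
    unfolding m[symmetric] by (simp add: zip_map2 zip_same_conv_map)
  also have "sum_list (map (\<lambda>(y, z). d y z) (zip c (rotate1 c))) = chain_sum d (c @ [x])"
  proof -
    have "sum_list (map (\<lambda>(y, z). d y z) (zip (x # ys) (ys @ [z]))) = chain_sum d (x # ys @ [z])" for x ys z
      by (induction ys arbitrary: x) auto
    then show ?thesis by (simp add: c_def)
  qed
  finally show ?thesis using that p by (simp add: c_def)
qed

text \<open>
  The potential of \<open>j\<close> is the largest weight of a path without repetitions that ends in \<open>j\<close>.
\<close>

lemma potential_exists:
  fixes d :: "nat \<Rightarrow> nat \<Rightarrow> real"
  assumes opt: "\<And>p. p permutes {..<n} \<Longrightarrow> (\<Sum>i<n. d i (p i)) \<le> 0" and d0: "\<And>i. d i i = 0"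
  obtains v where "\<And>i j. i < n \<Longrightarrow> j < n \<Longrightarrow> v i + d i j \<le> v j"
proof -
  \<comment> \<open>A cycle without repetitions is a permutation that fixes all other indices, and
    fixed indices contribute \<open>d i i = 0\<close>.\<close>
  have cyc: "chain_sum d (x # xs @ [x]) \<le> 0" if dx: "distinct (x # xs)" and sub: "set (x # xs) \<subseteq> {..<n}" for x xs
  proof -
    obtain p where p: "p permutes set (x # xs)" "(\<Sum>y\<in>set (x # xs). d y (p y)) = chain_sum d (x # xs @ [x])"
      by (rule cycle_permutation[OF dx])
    have "(\<Sum>y\<in>set (x # xs). d y (p y)) = (\<Sum>i<n. d i (p i))"
      by (rule sum.mono_neutral_left) (use sub p(1) d0 in \<open>auto simp: permutes_def\<close>)
    then show ?thesis using opt[OF permutes_subset[OF p(1) sub]] p(2) by simp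
  qed
  define PT where "PT j = {xs. distinct (xs @ [j]) \<and> set xs \<subseteq> {..<n}}" for j
  have fin: "finite (PT j)" for j
  proof (rule finite_subset)
    show "PT j \<subseteq> {xs. set xs \<subseteq> {..<n} \<and> length xs \<le> n}"
    proof
      fix xs assume "xs \<in> PT j"
      then have xs: "distinct xs" "set xs \<subseteq> {..<n}" by (auto simp: PT_def)
      then have "length xs \<le> card {..<n}" using card_mono[OF _ xs(2)] distinct_card[OF xs(1)] by simp
      then show "xs \<in> {xs. set xs \<subseteq> {..<n} \<and> length xs \<le> n}" using xs by simp
    qed
  qed (rule finite_lists_length_le, simp)
  define v where "v j = Max ((\<lambda>xs. chain_sum d (xs @ [j])) ` PT j)" for j
  have ne: "[] \<in> PT j" for j by (simp add: PT_def)
  have ge: "chain_sum d (xs @ [j]) \<le> v j" if "xs \<in> PT j" for xs j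
    unfolding v_def using fin that by (intro Max_ge) auto
  have "v i + d i j \<le> v j" if ij: "i < n" "j < n" for i j
  proof -
    have "v i \<in> (\<lambda>xs. chain_sum d (xs @ [i])) ` PT i"
      unfolding v_def using fin ne by (intro Max_in) auto
    then obtain xs where xs: "xs \<in> PT i" "v i = chain_sum d (xs @ [i])" by blast
    have e: "v i + d i j = chain_sum d (xs @ [i, j])"
      using chain_sum_append[of d "xs @ [i]" j] xs by simp
    show ?thesis
    proof (cases "j \<in> set (xs @ [i])")
      case False
      then have "xs @ [i] \<in> PT j" using xs ij by (auto simp: PT_def)
      then show ?thesis using ge e by fastforce
    next
      case True
      then obtain ys zs where yz: "xs @ [i] = ys @ j # zs" by (meson split_list)
      have dis: "distinct (ys @ j # zs)" "set (ys @ j # zs) \<subseteq> {..<n}"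
        using xs ij unfolding yz[symmetric] by (auto simp: PT_def)
      have "chain_sum d (xs @ [i, j]) = chain_sum d (ys @ j # (zs @ [j]))"
        using arg_cong[OF yz, of "\<lambda>z. chain_sum d (z @ [j])"] by simp
      also have "\<dots> = chain_sum d (ys @ [j]) + chain_sum d (j # zs @ [j])"
        by (rule chain_sum_split)
      also have "\<dots> \<le> v j + 0"
        using dis by (intro add_mono ge cyc) (auto simp: PT_def)
      finally show ?thesis using e by simp
    qed
  qed
  then show ?thesis using that by blast
qed

text \<open>This is the support function form of the assertion that \<open>l\<close> lies in the
  convex hull of the rearrangements of \<open>m\<close>. For a \<open>p\<close> that maximizes the
  right-hand side no cyclic exchange is profitable, so there is a potential \<open>v\<close>. The
  maximum of the affine functions v i + w i . (x - m (p i)) is convex, is at most v j at m (p j),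
  and is at least v j + w j . (l j - m (p j)) at l j; majorization applied to it gives the
  inequality.\<close>

lemma majorization_permutation:
  fixes l m w :: "nat \<Rightarrow> 'b::euclidean_space"
  assumes maj: "\<And>f. continuous_on UNIV f \<Longrightarrow> convex_on UNIV f \<Longrightarrow> (\<Sum>j<n. f (l j)) \<le> (\<Sum>j<n. f (m j) :: real)"
  obtains p where "p permutes {..<n}" "(\<Sum>j<n. w j \<bullet> l j) \<le> (\<Sum>j<n. w j \<bullet> m (p j))"
proof (cases "n = 0")
  case True
  then show ?thesis using that[of id] by (simp add: permutes_id)
next
  case False
  let ?P = "{p. p permutes {..<n}}"
  have fin: "finite ?P" by (rule finite_permutations) simp
  define F where "F p = (\<Sum>j<n. w j \<bullet> m (p j))" for p
  have "Max (F ` ?P) \<in> F ` ?P" using fin by (intro Max_in) (auto intro: permutes_id)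
  then obtain p where p: "p permutes {..<n}" and pm: "F p = Max (F ` ?P)" by auto
  have pmax: "F q \<le> F p" if "q permutes {..<n}" for q
    unfolding pm using fin that by (intro Max_ge) auto
  define d where "d i j = w i \<bullet> (m (p j) - m (p i))" for i j
  obtain v where v: "\<And>i j. i < n \<Longrightarrow> j < n \<Longrightarrow> v i + d i j \<le> v j"
  proof (rule potential_exists[of n d])
    fix q assume q: "q permutes {..<n}"
    have "(\<Sum>i<n. d i (q i)) = F (p \<circ> q) - F p"
      by (simp add: d_def F_def inner_diff_right sum_subtractf)
    then show "(\<Sum>i<n. d i (q i)) \<le> 0" using pmax[OF permutes_compose[OF q p]] by simp
  qed (auto simp: d_def)
  define f where "f x = Max ((\<lambda>i. v i + w i \<bullet> (x - m (p i))) ` {..<n})" for x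
  have f_ge: "v i + w i \<bullet> (x - m (p i)) \<le> f x" if "i < n" for i x
    unfolding f_def using that by (intro Max_ge) auto
  have f_m: "f (m (p j)) \<le> v j" if "j < n" for j
    unfolding f_def using v that False by (subst Max_le_iff) (auto simp: d_def)
  have "convex_on UNIV f"
  proof (rule convex_onI)
    fix t :: real and x y :: 'b assume t: "0 < t" "t < 1"
    have "v i + w i \<bullet> ((1 - t) *\<^sub>R x + t *\<^sub>R y - m (p i)) \<le> (1 - t) * f x + t * f y" if i: "i < n" for i
    proof -
      have "v i + w i \<bullet> ((1 - t) *\<^sub>R x + t *\<^sub>R y - m (p i))
          = (1 - t) * (v i + w i \<bullet> (x - m (p i))) + t * (v i + w i \<bullet> (y - m (p i)))"
        by (simp add: inner_diff_right inner_add_right algebra_simps)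
      also have "\<dots> \<le> (1 - t) * f x + t * f y"
        using t f_ge[OF i] by (intro add_mono mult_left_mono) auto
      finally show ?thesis .
    qed
    then show "f ((1 - t) *\<^sub>R x + t *\<^sub>R y) \<le> (1 - t) * f x + t * f y"
      using False by (subst (1) f_def, subst Max_le_iff) auto
  qed simp
  then have "(\<Sum>j<n. f (l j)) \<le> (\<Sum>j<n. f (m j))"
    by (intro maj) (auto intro: convex_on_continuous)
  also have "\<dots> = (\<Sum>j<n. f (m (p j)))"
    by (rule sum.permute[OF p, unfolded o_def])
  also have "\<dots> \<le> (\<Sum>j<n. v j)" by (rule sum_mono) (use f_m in auto)
  finally have "(\<Sum>j<n. f (l j)) \<le> (\<Sum>j<n. v j)" .
  moreover have "(\<Sum>j<n. v j + w j \<bullet> (l j - m (p j))) \<le> (\<Sum>j<n. f (l j))"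
    by (rule sum_mono) (use f_ge in auto)
  ultimately have "(\<Sum>j<n. w j \<bullet> l j) \<le> (\<Sum>j<n. w j \<bullet> m (p j))"
    by (simp add: inner_diff_right sum.distrib sum_subtractf)
  then show ?thesis using that p by blast
qed

subsection \<open>The Hilbert--Schmidt norm of a tuple in a representation\<close>

text \<open>On self-adjoint tuples this norm comes from a trace inner product, on which the
  minimization in \<open>local_approximation\<close> rests. Since it is defined through entries, it
  is a seminorm on all tuples.\<close>

definition hs_norm :: "nat \<Rightarrow> ('a::unital_cstar_algebra \<Rightarrow> complex mat) \<Rightarrow> 'a ^ 'm \<Rightarrow> real"
  where "hs_norm n \<pi> X = L2_set (\<lambda>(i, j, k). cmod (\<pi> (X $ i) $$ (j, k))) (UNIV \<times> {..<n} \<times> {..<n})"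

definition conj_by :: "'a::unital_cstar_algebra \<Rightarrow> 'a ^ 'm \<Rightarrow> 'a ^ 'm"
  where "conj_by u X = (\<chi> i. star u * X $ i * u)"

definition sa_tuple :: "('a::unital_cstar_algebra) ^ 'm \<Rightarrow> bool"
  where "sa_tuple X \<longleftrightarrow> (\<forall>i. self_adjoint (X $ i))"

text \<open>For a self-adjoint tuple the trace of this single element is the squared Hilbert-Schmidt
  norm. It turns smallness of a tuple into a condition on one self-adjoint element, to which the
  calculus in one variable applies.\<close>

definition sum_sq :: "('a::unital_cstar_algebra) ^ 'm \<Rightarrow> 'a"
  where "sum_sq X = (\<Sum>i\<in>UNIV. X $ i * X $ i)"

lemma self_adjoint_sum: "(\<And>i. i \<in> I \<Longrightarrow> self_adjoint (f i)) \<Longrightarrow> self_adjoint (sum f I)"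
  by (simp add: self_adjoint_def star_sum)

lemma sa_sum_sq: "sa_tuple X \<Longrightarrow> self_adjoint (sum_sq X)"
  unfolding sum_sq_def by (rule self_adjoint_sum) (simp add: sa_tuple_def self_adjoint_def star_mult)

lemma sa_tuple_intros:
  "sa_tuple X \<Longrightarrow> sa_tuple Y \<Longrightarrow> sa_tuple (X + Y)" "sa_tuple X \<Longrightarrow> sa_tuple Y \<Longrightarrow> sa_tuple (X - Y)"
  "sa_tuple X \<Longrightarrow> sa_tuple (r *\<^sub>R X)" "sa_tuple X \<Longrightarrow> sa_tuple (conj_by u X)" "abelian_family X \<Longrightarrow> sa_tuple X"
  by (auto simp: sa_tuple_def self_adjoint_intros conj_by_def abelian_family_def)
    (simp add: self_adjoint_def star_mult star_star mult.assoc)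

context matrix_rep
begin

lemma hs_norm_nonneg: "hs_norm n \<pi> X \<ge> 0"
  by (simp add: hs_norm_def L2_set_nonneg)

lemma hs_norm_triangle: "hs_norm n \<pi> (X + Y) \<le> hs_norm n \<pi> X + hs_norm n \<pi> Y"
proof -
  have "hs_norm n \<pi> (X + Y) \<le> L2_set (\<lambda>p. (case p of (i, j, k) \<Rightarrow> cmod (\<pi> (X $ i) $$ (j, k))) +
      (case p of (i, j, k) \<Rightarrow> cmod (\<pi> (Y $ i) $$ (j, k)))) (UNIV \<times> {..<n} \<times> {..<n})"
    unfolding hs_norm_def by (rule L2_set_mono) (auto simp: entry_add norm_triangle_ineq)
  also have "\<dots> \<le> hs_norm n \<pi> X + hs_norm n \<pi> Y"
    unfolding hs_norm_def by (rule L2_set_triangle_ineq)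
  finally show ?thesis .
qed

lemma hs_norm_scaleR: "hs_norm n \<pi> (r *\<^sub>R X) = \<bar>r\<bar> * hs_norm n \<pi> X"
proof -
  have "hs_norm n \<pi> (r *\<^sub>R X) = L2_set (\<lambda>p. \<bar>r\<bar> * (case p of (i, j, k) \<Rightarrow> cmod (\<pi> (X $ i) $$ (j, k))))
      (UNIV \<times> {..<n} \<times> {..<n})"
    unfolding hs_norm_def by (rule L2_set_cong) (auto simp: entry_scaleR norm_mult)
  also have "\<dots> = \<bar>r\<bar> * hs_norm n \<pi> X" unfolding hs_norm_def by (rule L2_set_right_distrib[symmetric]) simp
  finally show ?thesis .
qed

lemma hs_norm_zero: "(\<And>i. \<pi> (X $ i) = 0\<^sub>m n n) \<Longrightarrow> hs_norm n \<pi> X = 0"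
  unfolding hs_norm_def by (subst L2_set_eq_0_iff) auto

lemma hs_norm_sum: "hs_norm n \<pi> (sum F I) \<le> (\<Sum>i\<in>I. hs_norm n \<pi> (F i))"
proof (induction I rule: infinite_finite_induct)
  case (insert i I)
  then show ?case using hs_norm_triangle[of "F i" "sum F I"] by simp
qed (simp_all add: hs_norm_zero zero)

lemma hs_norm_minus: "hs_norm n \<pi> (X - Y) = hs_norm n \<pi> (Y - X)"
  using hs_norm_scaleR[of "-1" "X - Y"] by simp

lemma hs_norm_triangle3: "hs_norm n \<pi> (X - Z) \<le> hs_norm n \<pi> (X - Y) + hs_norm n \<pi> (Y - Z)"
  using hs_norm_triangle[of "X - Y" "Y - Z"] by simp

lemma mtr_pi_comm: "mtr (\<pi> (x * y)) = mtr (\<pi> (y * x))"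
  unfolding mult by (rule mtr_comm) auto

lemma mtr_pi_add: "mtr (\<pi> (x + y)) = mtr (\<pi> x) + mtr (\<pi> y)"
  unfolding add by (rule mtr_add) auto

lemma mtr_pi_scaleC: "mtr (\<pi> (c *\<^sub>C x)) = c * mtr (\<pi> x)"
  unfolding scaleC by (rule mtr_smult) auto

lemma mtr_pi_scaleR: "mtr (\<pi> (r *\<^sub>R x)) = of_real r * mtr (\<pi> x)"
  using mtr_pi_scaleC[of "of_real r" x] by (simp add: scaleC_of_real)

lemma mtr_pi_diff: "mtr (\<pi> (x - y)) = mtr (\<pi> x) - mtr (\<pi> y)"
  using mtr_pi_add[of "x - y" y] by simp

lemma mtr_pi_zero: "mtr (\<pi> 0) = 0"
  by (simp add: zero mtr_def)

lemma mtr_pi_sum: "mtr (\<pi> (sum f I)) = (\<Sum>i\<in>I. mtr (\<pi> (f i)))"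
  by (induction I rule: infinite_finite_induct) (simp_all add: mtr_pi_zero mtr_pi_add)

lemma mtr_pi_star: "mtr (\<pi> (star x)) = cnj (mtr (\<pi> x))"
  by (simp add: mtr_def entry_star)

lemma mtr_pi_real: "self_adjoint x \<Longrightarrow> mtr (\<pi> x) = of_real (Re (mtr (\<pi> x)))"
  using mtr_pi_star[of x] by (simp add: self_adjoint_def complex_eq_iff)

lemma mtr_pi_square:
  "mtr (\<pi> (star x * x)) = of_real (\<Sum>j<n. \<Sum>i<n. (cmod (\<pi> x $$ (i, j)))\<^sup>2)"
  unfolding mult star by (rule mtr_adjoint_mult) simp

lemma hs_norm_square:
  assumes "sa_tuple X"
  shows "(hs_norm n \<pi> X)\<^sup>2 = Re (mtr (\<pi> (sum_sq X)))"
proof -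
  have "(hs_norm n \<pi> X)\<^sup>2 = (\<Sum>(i, j, k)\<in>UNIV \<times> {..<n} \<times> {..<n}. (cmod (\<pi> (X $ i) $$ (j, k)))\<^sup>2)"
    unfolding hs_norm_def L2_set_def by (simp add: sum_nonneg case_prod_unfold)
  also have "\<dots> = (\<Sum>i\<in>UNIV. \<Sum>j<n. \<Sum>k<n. (cmod (\<pi> (X $ i) $$ (j, k)))\<^sup>2)"
    by (simp add: sum.cartesian_product case_prod_unfold)
  also have "\<dots> = (\<Sum>i\<in>UNIV. Re (mtr (\<pi> (X $ i * X $ i))))"
  proof (rule sum.cong)
    fix i
    have "star (X $ i) = X $ i" using assms by (simp add: sa_tuple_def self_adjoint_def)
    then have "Re (mtr (\<pi> (X $ i * X $ i))) = (\<Sum>k<n. \<Sum>j<n. (cmod (\<pi> (X $ i) $$ (j, k)))\<^sup>2)"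
      using mtr_pi_square[of "X $ i"] by (simp only: Re_complex_of_real)
    also have "\<dots> = (\<Sum>j<n. \<Sum>k<n. (cmod (\<pi> (X $ i) $$ (j, k)))\<^sup>2)" by (rule sum.swap)
    finally show "(\<Sum>j<n. \<Sum>k<n. (cmod (\<pi> (X $ i) $$ (j, k)))\<^sup>2) = Re (mtr (\<pi> (X $ i * X $ i)))" ..
  qed simp
  finally show ?thesis by (simp add: sum_sq_def mtr_pi_sum)
qed

lemma hs_norm_bound: "hs_norm n \<pi> X \<le> sqrt n * norm X"
proof -
  have "(hs_norm n \<pi> X)\<^sup>2 = (\<Sum>(i, j, k)\<in>UNIV \<times> {..<n} \<times> {..<n}. (cmod (\<pi> (X $ i) $$ (j, k)))\<^sup>2)"
    unfolding hs_norm_def L2_set_def by (simp add: sum_nonneg case_prod_unfold)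
  also have "\<dots> = (\<Sum>i\<in>UNIV. \<Sum>j<n. \<Sum>k<n. (cmod (\<pi> (X $ i) $$ (j, k)))\<^sup>2)"
    by (simp add: sum.cartesian_product case_prod_unfold)
  also have "\<dots> = (\<Sum>i\<in>UNIV. \<Sum>k<n. \<Sum>j<n. (cmod (\<pi> (X $ i) $$ (j, k)))\<^sup>2)"
    by (intro sum.cong refl sum.swap)
  also have "\<dots> \<le> (\<Sum>i\<in>UNIV. \<Sum>k<n. (norm (X $ i))\<^sup>2)"
    by (intro sum_mono column_norm_bound) simp
  also have "\<dots> = n * (norm X)\<^sup>2"
    by (simp add: norm_vec_def L2_set_def sum_nonneg sum_distrib_left)
  also have "\<dots> = (sqrt n * norm X)\<^sup>2" by (simp add: power_mult_distrib)
  finally show ?thesis by (rule power2_le_imp_le) simp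
qed

lemma hs_norm_conj_by:
  assumes X: "sa_tuple X" and u: "unitary u"
  shows "hs_norm n \<pi> (conj_by u X) = hs_norm n \<pi> X"
proof -
  have uu: "u * star u = 1" using u by (simp add: unitary_def)
  have "mtr (\<pi> (conj_by u X $ i * conj_by u X $ i)) = mtr (\<pi> (X $ i * X $ i))" for i
  proof -
    have "conj_by u X $ i * conj_by u X $ i = star u * (X $ i * (u * star u) * X $ i * u)"
      by (simp add: conj_by_def mult.assoc)
    then have "mtr (\<pi> (conj_by u X $ i * conj_by u X $ i)) = mtr (\<pi> (X $ i * X $ i * (u * star u)))"
      by (simp only: mtr_pi_comm[of "star u"] uu) (simp add: mult.assoc uu)
    then show ?thesis by (simp add: uu)
  qed
  then have "(hs_norm n \<pi> (conj_by u X))\<^sup>2 = (hs_norm n \<pi> X)\<^sup>2"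
    by (simp add: hs_norm_square X sa_tuple_intros sum_sq_def mtr_pi_sum)
  then show ?thesis by (rule power2_eq_imp_eq[OF _ hs_norm_nonneg hs_norm_nonneg])
qed

end

subsection \<open>Products of exponentials\<close>

definition expi_prod :: "'a::unital_cstar_algebra list \<Rightarrow> 'a"
  where "expi_prod hs = prod_list (map expi hs)"

text \<open>Scaling the exponents deforms each of these unitaries to 1 through unitaries, which the
  gluing argument requires. By \<open>onto_lift_unitary\<close> the set still maps onto all unitary
  matrices in every irreducible representation.\<close>

definition expi_group :: "'a::unital_cstar_algebra set"
  where "expi_group = {expi_prod hs | hs. \<forall>h\<in>set hs. self_adjoint h}"

lemma unitary_expi_prod: "\<forall>h\<in>set hs. self_adjoint h \<Longrightarrow> unitary (expi_prod hs)"
  by (induction hs) (auto simp: expi_prod_def unitary_one intro!: unitary_mult unitary_expi)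

lemma expi_group_unitary: "u \<in> expi_group \<Longrightarrow> unitary u"
  by (auto simp: expi_group_def unitary_expi_prod)

lemma expi_group_mult: "u \<in> expi_group \<Longrightarrow> v \<in> expi_group \<Longrightarrow> u * v \<in> expi_group"
proof -
  assume "u \<in> expi_group" "v \<in> expi_group"
  then obtain hs ks where "u = expi_prod hs" "\<forall>h\<in>set hs. self_adjoint h"
    "v = expi_prod ks" "\<forall>h\<in>set ks. self_adjoint h" by (auto simp: expi_group_def)
  then show "u * v \<in> expi_group"
    by (auto simp: expi_group_def expi_prod_def intro!: exI[of _ "hs @ ks"])
qed

lemma expi_group_one: "1 \<in> expi_group"
  by (auto simp: expi_group_def expi_prod_def intro!: exI[of _ "[]"])

lemma expi_group_expi: "self_adjoint h \<Longrightarrow> expi h \<in> expi_group"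
  by (auto simp: expi_group_def expi_prod_def intro!: exI[of _ "[h]"])

lemma star_expi: "self_adjoint h \<Longrightarrow> star (expi h) = expi (- h)"
  by (simp add: expi_def star_exp star_scaleC self_adjoint_def scaleC_minus_left scaleC_minus_right)

lemma expi_group_star: "u \<in> expi_group \<Longrightarrow> star u \<in> expi_group"
proof -
  assume "u \<in> expi_group"
  then obtain hs where hs: "u = expi_prod hs" "\<forall>h\<in>set hs. self_adjoint h" by (auto simp: expi_group_def)
  from hs(2) have "star (expi_prod hs) \<in> expi_group"
  proof (induction hs)
    case Nil
    then show ?case using expi_group_one by (simp add: expi_prod_def)
  next
    case (Cons h hs)
    then have "star (expi_prod hs) * expi (- h) \<in> expi_group"
      by (intro expi_group_mult expi_group_expi) (auto simp: self_adjoint_def star_minus)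
    then show ?case using Cons.prems by (simp add: expi_prod_def star_mult star_expi)
  qed
  then show "star u \<in> expi_group" using hs by simp
qed

definition orbit_hull :: "('a::unital_cstar_algebra) ^ 'm \<Rightarrow> ('a ^ 'm) set"
  where "orbit_hull B = convex hull ((\<lambda>u. conj_by u B) ` expi_group)"

lemma orbit_hull_subset: "orbit_hull B \<subseteq> convex hull unitary_orbit B"
  unfolding orbit_hull_def
  by (rule hull_mono) (use expi_group_unitary in \<open>auto simp: unitary_orbit_def conj_by_def\<close>)

lemma convex_orbit_hull: "convex (orbit_hull B)"
  unfolding orbit_hull_def by simp

lemma orbit_hull_base: "u \<in> expi_group \<Longrightarrow> conj_by u B \<in> orbit_hull B"
  unfolding orbit_hull_def by (rule hull_inc) simp

lemma orbit_hull_sa: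
  assumes "sa_tuple B" "X \<in> orbit_hull B"
  shows "sa_tuple X"
proof -
  have "orbit_hull B \<subseteq> {X. sa_tuple X}"
    unfolding orbit_hull_def
    by (rule hull_minimal) (use assms(1) in \<open>auto simp: convex_def intro: sa_tuple_intros\<close>)
  then show ?thesis using assms(2) by blast
qed

lemma (in matrix_rep) hs_norm_orbit_hull:
  fixes B :: "'a ^ 'm"
  assumes "sa_tuple B" "X \<in> orbit_hull B"
  shows "hs_norm n \<pi> X \<le> hs_norm n \<pi> B"
proof -
  have "orbit_hull B \<subseteq> {X :: 'a ^ 'm. hs_norm n \<pi> X \<le> hs_norm n \<pi> B}"
    unfolding orbit_hull_def
  proof (rule hull_minimal)
    show "(\<lambda>u. conj_by u B) ` expi_group \<subseteq> {X :: 'a ^ 'm. hs_norm n \<pi> X \<le> hs_norm n \<pi> B}"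
      using assms(1) by (auto simp: hs_norm_conj_by expi_group_unitary)
    show "convex {X :: 'a ^ 'm. hs_norm n \<pi> X \<le> hs_norm n \<pi> B}"
    proof (rule convexI)
      fix X Y :: "'a ^ 'm" and u v :: real
      assume "X \<in> {X :: 'a ^ 'm. hs_norm n \<pi> X \<le> hs_norm n \<pi> B}" "Y \<in> {X :: 'a ^ 'm. hs_norm n \<pi> X \<le> hs_norm n \<pi> B}"
        and uv: "0 \<le> u" "0 \<le> v" "u + v = 1"
      then have "u * hs_norm n \<pi> X + v * hs_norm n \<pi> Y \<le> u * hs_norm n \<pi> B + v * hs_norm n \<pi> B"
        by (intro add_mono mult_left_mono) auto
      also have "\<dots> = hs_norm n \<pi> B" using uv(3) by (simp flip: distrib_right)
      finally show "u *\<^sub>R X + v *\<^sub>R Y \<in> {X :: 'a ^ 'm. hs_norm n \<pi> X \<le> hs_norm n \<pi> B}"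
        using hs_norm_triangle[of "u *\<^sub>R X" "v *\<^sub>R Y"] uv by (simp add: hs_norm_scaleR)
    qed
  qed
  then show ?thesis using assms(2) by blast
qed

subsection \<open>Approximation in a single irreducible representation\<close>

lemma onto_lift:
  assumes "rep_onto_matrix_algebra n \<pi>" "M \<in> carrier_mat n n"
  obtains x where "\<pi> x = M"
  using assms unfolding rep_onto_matrix_algebra_def by (metis rangeE)

lemma onto_lift_self_adjoint:
  assumes onto: "rep_onto_matrix_algebra n \<pi>" and M: "M \<in> carrier_mat n n" "mat_adjoint M = M"
  obtains h where "self_adjoint h" "\<pi> h = M"
proof -
  interpret matrix_rep n \<pi> by (rule rep_onto_matrix_rep[OF onto])
  obtain x where x: "\<pi> x = M" using onto_lift[OF onto M(1)] .
  define h where "h = (1/2) *\<^sub>R (x + star x)"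
  have "\<pi> (star x) = M" using x M by (simp add: star)
  then have "\<pi> h = M"
    using x M(1) by (intro eq_matI) (auto simp: h_def entry_scaleR entry_add)
  moreover have "self_adjoint h" by (simp add: h_def self_adjoint_def star_scaleR star_add star_star add.commute)
  ultimately show ?thesis using that by blast
qed

lemma unitary_mat_mult:
  assumes "unitary_mat n U" "unitary_mat n V"
  shows "unitary_mat n (U * V)"
proof -
  have c: "U \<in> carrier_mat n n" "V \<in> carrier_mat n n" "mat_adjoint U \<in> carrier_mat n n" "mat_adjoint V \<in> carrier_mat n n"
    using assms by (auto simp: unitary_mat_def)
  have "mat_adjoint (U * V) * (U * V) = mat_adjoint V * (mat_adjoint U * (U * V))"
    unfolding mat_adjoint_mult[OF c(1,2)] by (rule assoc_mult_mat[OF c(4,3) mult_carrier_mat[OF c(1,2)]])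
  also have "mat_adjoint U * (U * V) = V"
    using assoc_mult_mat[OF c(3,1,2)] assms left_mult_one_mat[OF c(2)] by (simp add: unitary_mat_def)
  finally have "mat_adjoint (U * V) * (U * V) = 1\<^sub>m n" using assms by (simp add: unitary_mat_def)
  then show ?thesis using c by (intro isometry_mat_square) (simp add: isometry_mat_def)
qed

text \<open>A preimage of a unitary matrix need not be unitary. But the matrix is the exponential of
  \<open>\<i>\<close> times a Hermitian matrix, Hermitian matrices have self-adjoint preimages, and
  representations respect the exponential of these.\<close>

lemma onto_lift_unitary:
  assumes onto: "rep_onto_matrix_algebra n \<pi>" and M: "unitary_mat n M"
  obtains u where "u \<in> expi_group" "\<pi> u = M"
proof -
  interpret p: matrix_rep n \<pi> by (rule rep_onto_matrix_rep[OF onto])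
  have Mc: "M \<in> carrier_mat n n" and MM: "mat_adjoint M * M = 1\<^sub>m n" "M * mat_adjoint M = 1\<^sub>m n"
    using M by (auto simp: unitary_mat_def)
  obtain m where m: "\<pi> m = M" using onto_lift[OF onto Mc] .
  have pm: "\<pi> (star m * m) = 1\<^sub>m n" "\<pi> (m * star m) = 1\<^sub>m n"
    using m MM by (simp_all add: p.mult p.star)
  \<comment> \<open>Multiples of the real and imaginary parts of \<open>m\<close>. They commute only
    after applying \<open>\<pi>\<close>, where \<open>m\<close> becomes normal, and this suffices to
    diagonalize their images jointly.\<close>
  define x y where "x = m + star m" and "y = \<i> *\<^sub>C (m - star m)"
  have xy: "self_adjoint x" "self_adjoint y"
    by (simp_all add: x_def y_def self_adjoint_def star_add star_diff star_scaleC star_star add.commute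
        scaleC_minus_left scaleC_diff_right)
  have comm: "\<pi> (x * y) = \<pi> (y * x)"
  proof -
    have "x * y - y * x = \<i> *\<^sub>C ((m + star m) * (m - star m) - (m - star m) * (m + star m))"
      by (simp add: x_def y_def mult_scaleC_left mult_scaleC_right flip: scaleC_diff_right)
    also have "(m + star m) * (m - star m) - (m - star m) * (m + star m) = 2 *\<^sub>R (star m * m - m * star m)"
      by (simp add: ring_distribs scaleR_2)
    finally have "\<pi> (x * y - y * x) = \<pi> (\<i> *\<^sub>C 2 *\<^sub>R (star m * m - m * star m))" by simp
    also have "\<dots> = 0\<^sub>m n n"
      by (rule eq_matI) (auto simp: p.entry_scaleC p.entry_scaleR p.entry_diff pm)
    finally have z: "\<pi> (x * y - y * x) = 0\<^sub>m n n" .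
    show ?thesis
    proof (rule eq_matI)
      fix i j assume "i < dim_row (\<pi> (y * x))" "j < dim_col (\<pi> (y * x))"
      then have "i < n" "j < n" by auto
      then show "\<pi> (x * y) $$ (i, j) = \<pi> (y * x) $$ (i, j)"
        using arg_cong[OF z, of "\<lambda>K. K $$ (i, j)"] by (simp add: p.entry_diff)
    qed auto
  qed
  obtain Q where Q: "unitary_mat n Q"
    and DQ: "\<And>b. b \<in> UNIV \<Longrightarrow> diagonal_mat (mat_adjoint Q * \<pi> (if b then x else y) * Q)"
  proof (rule joint_diagonalization[of "UNIV :: bool set" "\<lambda>b. \<pi> (if b then x else y)" n])
    fix b c :: bool
    show "mat_adjoint (\<pi> (if b then x else y)) = \<pi> (if b then x else y)"
      using xy by (simp add: p.star[symmetric] self_adjoint_def)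
    show "\<pi> (if b then x else y) * \<pi> (if c then x else y) = \<pi> (if c then x else y) * \<pi> (if b then x else y)"
      using comm by (simp add: p.mult[symmetric])
  qed auto
  define \<rho> where "\<rho> = (\<lambda>x. mat_adjoint Q * \<pi> x * Q)"
  interpret r: matrix_rep n \<rho> unfolding \<rho>_def by (rule p.conj_rep[OF Q])
  have D: "diagonal_mat (\<rho> x)" "diagonal_mat (\<rho> y)"
    using DQ[of True] DQ[of False] by (simp_all add: \<rho>_def)
  have m_eq: "m = (1/2) *\<^sub>R (x + (- \<i>) *\<^sub>C y)"
  proof -
    have "(- \<i>) *\<^sub>C y = m - star m" by (simp add: y_def scaleC_scaleC)
    then have "x + (- \<i>) *\<^sub>C y = 2 *\<^sub>R m" by (simp add: x_def scaleR_2)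
    then show ?thesis by simp
  qed
  have Dm: "diagonal_mat (\<rho> m)"
    using D by (subst m_eq) (auto simp: diagonal_mat_def r.entry_scaleR r.entry_add r.entry_scaleC)
  define \<theta> where "\<theta> j = Arg (\<rho> m $$ (j, j))" for j
  have th: "\<rho> m $$ (j, j) = exp (\<i> * of_real (\<theta> j))" if j: "j < n" for j
  proof -
    have "\<rho> (star m * m) = \<rho> 1" using pm p.one by (simp add: \<rho>_def)
    then have "1 = cnj (\<rho> m $$ (j, j)) * \<rho> m $$ (j, j)"
      using r.diagonal_mult(2)[OF Dm j j, of "star m"] j by (simp add: r.one r.entry_star)
    then have "complex_of_real ((cmod (\<rho> m $$ (j, j)))\<^sup>2) = of_real 1"
      by (simp add: cmod_square mult.commute)
    then have "(cmod (\<rho> m $$ (j, j)))\<^sup>2 = 1" using of_real_eq_iff by blast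
    then have "cmod (\<rho> m $$ (j, j)) = 1" by (simp add: power2_eq_1_iff) (smt (verit) norm_ge_zero)
    moreover from this have "\<rho> m $$ (j, j) \<noteq> 0" by (metis norm_zero zero_neq_one)
    ultimately show ?thesis using Arg_eq[of "\<rho> m $$ (j, j)"] by (simp add: \<theta>_def)
  qed
  define T where "T = mat n n (\<lambda>(i, j). if i = j then complex_of_real (\<theta> j) else 0)"
  have Tc: "T \<in> carrier_mat n n" and Ta: "mat_adjoint T = T"
    by (auto simp: T_def intro!: eq_matI)
  have Qc: "Q \<in> carrier_mat n n" and Qa: "mat_adjoint Q \<in> carrier_mat n n"
    and QQ: "mat_adjoint Q * Q = 1\<^sub>m n" using Q by (auto simp: unitary_mat_def)
  have QT: "Q * T \<in> carrier_mat n n" using Qc Tc by simp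
  have H: "Q * T * mat_adjoint Q \<in> carrier_mat n n" using QT Qa by simp
  have "mat_adjoint (Q * T * mat_adjoint Q) = Q * T * mat_adjoint Q"
    unfolding mat_adjoint_mult[OF QT Qa] mat_adjoint_mult[OF Qc Tc] Ta mat_adjoint_adjoint
    by (rule assoc_mult_mat[OF Qc Tc Qa, symmetric])
  then obtain h where h: "self_adjoint h" "\<pi> h = Q * T * mat_adjoint Q"
    using onto_lift_self_adjoint[OF onto H] by blast
  have rh: "\<rho> h = T"
  proof -
    have "\<rho> h = mat_adjoint Q * (Q * T * mat_adjoint Q) * Q" by (simp add: \<rho>_def h)
    also have "mat_adjoint Q * (Q * T * mat_adjoint Q) = T * mat_adjoint Q"
    proof -
      have "mat_adjoint Q * (Q * T * mat_adjoint Q) = mat_adjoint Q * (Q * T) * mat_adjoint Q"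
        by (rule assoc_mult_mat[OF Qa QT Qa, symmetric])
      also have "mat_adjoint Q * (Q * T) = T"
        using assoc_mult_mat[OF Qa Qc Tc] QQ left_mult_one_mat[OF Tc] by simp
      finally show ?thesis .
    qed
    also have "T * mat_adjoint Q * Q = T"
      using assoc_mult_mat[OF Tc Qa Qc] QQ right_mult_one_mat[OF Tc] by simp
    finally show ?thesis .
  qed
  have Di: "diagonal_mat (\<rho> (\<i> *\<^sub>C h))"
    by (auto simp: diagonal_mat_def r.entry_scaleC rh T_def)
  have "\<rho> (expi h) = \<rho> m"
  proof (rule eq_matI)
    fix i j assume "i < dim_row (\<rho> m)" "j < dim_col (\<rho> m)"
    then have ij: "i < n" "j < n" by auto
    show "\<rho> (expi h) $$ (i, j) = \<rho> m $$ (i, j)"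
    proof (cases "i = j")
      case True
      then show ?thesis
        using ij by (simp add: expi_def r.diagonal_exp(2)[OF Di] r.entry_scaleC rh T_def th)
    next
      case False
      then show ?thesis
        using ij r.diagonal_exp(1)[OF Di] Dm by (simp add: expi_def diagonal_mat_def)
    qed
  qed auto
  then have "\<pi> (expi h) = \<pi> m"
    using p.conj_inverse[OF Q] unfolding \<rho>_def by metis
  then show ?thesis using that expi_group_expi[OF h(1)] m by blast
qed

lemma permuted_unitary:
  assumes U: "unitary_mat n U" and p: "p permutes {..<n}"
  defines "V \<equiv> mat n n (\<lambda>(a, b). U $$ (a, p b))"
  shows "unitary_mat n V"
    and "X \<in> carrier_mat n n \<Longrightarrow> j < n \<Longrightarrow> k < n \<Longrightarrow> (mat_adjoint V * X * V) $$ (j, k) = (mat_adjoint U * X * U) $$ (p j, p k)"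
proof -
  have Uc: "U \<in> carrier_mat n n" and Ua: "mat_adjoint U \<in> carrier_mat n n" using U by (auto simp: unitary_mat_def)
  have Vc: "V \<in> carrier_mat n n" by (simp add: V_def)
  have Va: "mat_adjoint V \<in> carrier_mat n n" using Vc by simp
  have pl: "p j < n" if "j < n" for j using permutes_in_image[OF p, of j] that by simp
  have e: "(mat_adjoint V * X * V) $$ (j, k) = (mat_adjoint U * X * U) $$ (p j, p k)"
    if X: "X \<in> carrier_mat n n" and jk: "j < n" "k < n" for X j k
  proof -
    have 1: "(mat_adjoint V * X) $$ (j, b) = (mat_adjoint U * X) $$ (p j, b)" if b: "b < n" for b
      unfolding mult_mat_index[OF Va X jk(1) b] mult_mat_index[OF Ua X pl[OF jk(1)] b]
      using jk Uc pl by (intro sum.cong) (auto simp: V_def)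
    have "(mat_adjoint V * X * V) $$ (j, k) = (\<Sum>b<n. (mat_adjoint V * X) $$ (j, b) * V $$ (b, k))"
      by (rule mult_mat_index[OF mult_carrier_mat[OF Va X] Vc jk])
    also have "\<dots> = (\<Sum>b<n. (mat_adjoint U * X) $$ (p j, b) * U $$ (b, p k))"
      by (rule sum.cong) (use jk 1 in \<open>auto simp: V_def simp del: index_mult_mat(1)\<close>)
    also have "\<dots> = (mat_adjoint U * X * U) $$ (p j, p k)"
      by (rule mult_mat_index[OF mult_carrier_mat[OF Ua X] Uc pl[OF jk(1)] pl[OF jk(2)], symmetric])
    finally show ?thesis .
  qed
  then show "X \<in> carrier_mat n n \<Longrightarrow> j < n \<Longrightarrow> k < n \<Longrightarrow> (mat_adjoint V * X * V) $$ (j, k) = (mat_adjoint U * X * U) $$ (p j, p k)" .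
  have "mat_adjoint V * V = 1\<^sub>m n"
  proof (rule eq_matI)
    fix j k assume "j < dim_row (1\<^sub>m n :: complex mat)" "k < dim_col (1\<^sub>m n :: complex mat)"
    then have jk: "j < n" "k < n" by auto
    have "(mat_adjoint V * V) $$ (j, k) = (mat_adjoint U * U) $$ (p j, p k)"
      using e[OF one_carrier_mat jk] right_mult_one_mat[OF Va] right_mult_one_mat[OF Ua] by simp
    also have "\<dots> = 1\<^sub>m n $$ (p j, p k)" using U by (simp add: unitary_mat_def)
    also have "\<dots> = 1\<^sub>m n $$ (j, k)" using jk pl permutes_inj[OF p] by (auto simp: inj_eq)
    finally show "(mat_adjoint V * V) $$ (j, k) = 1\<^sub>m n $$ (j, k)" .
  qed (use Vc in auto)
  then show "unitary_mat n V" using Vc by (intro isometry_mat_square) (simp add: isometry_mat_def)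
qed

lemma tracial_state_rep:
  assumes "matrix_rep n \<pi>" "n \<ge> 1"
  shows "tracial_state (\<lambda>x. mtr (\<pi> x) / of_nat n)"
proof -
  interpret matrix_rep n \<pi> by fact
  have "Vector_Spaces.linear (*\<^sub>C) (*) (\<lambda>x. mtr (\<pi> x) / of_nat n)"
    unfolding Vector_Spaces.linear_iff
    using vector_space_scaleC vector_space_over_itself.vector_space_axioms
    by (auto simp: mtr_pi_add mtr_pi_scaleC add_divide_distrib)
  moreover have "mtr (\<pi> (star x * x)) / of_nat n \<in> \<real>\<^sub>\<ge>\<^sub>0" for x
  proof -
    have "mtr (\<pi> (star x * x)) / of_nat n = of_real ((\<Sum>j<n. \<Sum>i<n. (cmod (\<pi> x $$ (i, j)))\<^sup>2) / real n)"
      unfolding mtr_pi_square by simp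
    then show ?thesis by (simp only: nonneg_Reals_of_real_iff) (intro divide_nonneg_nonneg sum_nonneg; simp)
  qed
  ultimately show ?thesis
    using assms(2) by (simp add: tracial_state_def one mtr_pi_comm)
qed

context subhom
begin

text \<open>Let \<open>Y\<close> almost minimize the distance to \<open>A\<close> over the hull, and
  let W = A - Y. The first variation shows that the inner product of W with Z - Y is almost
  nonpositive for every Z in the hull. Majorization provides a conjugate Z of \<open>B\<close> whose
  inner product with W is at least that of \<open>A\<close>. Hence W, paired with itself, is bounded
  by its pairing with Z - Y and is small.\<close>

lemma local_approximation:
  fixes A B :: "'a ^ 'm"
  assumes A: "abelian_family A" and B: "abelian_family B" and maj: "A \<prec>\<^sub>t\<^sub>r B"
    and onto: "rep_onto_matrix_algebra n \<pi>" and n: "n \<ge> 1" and e: "e > 0"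
  obtains Y where "Y \<in> orbit_hull B" "(hs_norm n \<pi> (A - Y))\<^sup>2 < e"
proof -
  interpret p: matrix_rep n \<pi> by (rule rep_onto_matrix_rep[OF onto])
  have saA: "sa_tuple A" and saB: "sa_tuple B" using A B by (auto intro: sa_tuple_intros)
  define ip where "ip X Y = (\<Sum>i\<in>UNIV. Re (mtr (\<pi> (X $ i * Y $ i))))" for X Y :: "'a ^ 'm"
  have ip_sq: "ip X X = (hs_norm n \<pi> X)\<^sup>2" if "sa_tuple X" for X
    using that by (simp add: ip_def p.hs_norm_square sum_sq_def p.mtr_pi_sum)
  have ip_comm: "ip X Y = ip Y X" for X Y
    unfolding ip_def by (rule sum.cong) (simp_all add: p.mtr_pi_comm)
  have ip_add: "ip X (Y + Z) = ip X Y + ip X Z" for X Y Z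
    by (simp add: ip_def ring_distribs p.mtr_pi_add sum.distrib)
  have ip_diff: "ip X (Y - Z) = ip X Y - ip X Z" for X Y Z
    by (simp add: ip_def ring_distribs p.mtr_pi_diff sum_subtractf)
  have ip_left: "ip (Y - r *\<^sub>R Z) X = ip Y X - r * ip Z X" for X Y Z r
    by (simp add: ip_def ring_distribs p.mtr_pi_diff p.mtr_pi_scaleR sum_subtractf sum_distrib_left)
  have ip_scale: "ip X (r *\<^sub>R Y) = r * ip X Y" for X Y r
    by (simp add: ip_def p.mtr_pi_scaleR sum_distrib_left)
  define D where "D = (\<lambda>Y. (hs_norm n \<pi> (A - Y))\<^sup>2) ` orbit_hull B"
  have Dne: "D \<noteq> {}" using orbit_hull_base[OF expi_group_one, of B] by (auto simp: D_def)
  have Dbb: "bdd_below D" unfolding D_def by (rule bdd_belowI[of _ 0]) auto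
  define M where "M = (2 * hs_norm n \<pi> B)\<^sup>2"
  \<comment> \<open>The infimum need not be attained. A step of size \<delta> from a point that is
    optimal up to \<delta>^2 leaves an error of \<delta> (1 + M) / 2 in the first variation, where
    \<open>M\<close> bounds the squared diameter of the hull.\<close>
  define \<delta> where "\<delta> = min 1 (e / (1 + M))"
  have M0: "M \<ge> 0" by (simp add: M_def)
  have d: "\<delta> > 0" "\<delta> \<le> 1" "\<delta> * (1 + M) \<le> e"
  proof -
    show "\<delta> > 0" "\<delta> \<le> 1" using e M0 by (auto simp: \<delta>_def)
    have "\<delta> * (1 + M) \<le> e / (1 + M) * (1 + M)" using M0 by (intro mult_right_mono) (auto simp: \<delta>_def)
    then show "\<delta> * (1 + M) \<le> e" using M0 by simp
  qed
  have "Inf D < Inf D + \<delta>\<^sup>2" using d by simp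
  then obtain y where "y \<in> D" "y < Inf D + \<delta>\<^sup>2" using cInf_lessD[OF Dne] by metis
  then obtain Y where Y: "Y \<in> orbit_hull B" "(hs_norm n \<pi> (A - Y))\<^sup>2 < Inf D + \<delta>\<^sup>2" by (auto simp: D_def)
  have saY: "sa_tuple Y" by (rule orbit_hull_sa[OF saB Y(1)])
  define W where "W = A - Y"
  have saW: "sa_tuple W" unfolding W_def by (rule sa_tuple_intros(2)[OF saA saY])
  have var: "ip W (Z - Y) \<le> \<delta> * (1 + M) / 2" if Z: "Z \<in> orbit_hull B" for Z
  proof -
    have saZ: "sa_tuple Z" by (rule orbit_hull_sa[OF saB Z])
    have saZY: "sa_tuple (Z - Y)" by (rule sa_tuple_intros(2)[OF saZ saY])
    define Yt where "Yt = (1 - \<delta>) *\<^sub>R Y + \<delta> *\<^sub>R Z"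
    have "Yt \<in> orbit_hull B" unfolding Yt_def using convex_orbit_hull Y(1) Z d by (intro convexD) auto
    then have "Inf D \<le> (hs_norm n \<pi> (A - Yt))\<^sup>2" using Dbb by (intro cInf_lower) (auto simp: D_def)
    moreover have AY: "A - Yt = W - \<delta> *\<^sub>R (Z - Y)" by (simp add: W_def Yt_def algebra_simps)
    have sa2: "sa_tuple (W - \<delta> *\<^sub>R (Z - Y))" by (intro sa_tuple_intros saW saZY)
    have "(hs_norm n \<pi> (A - Yt))\<^sup>2 = ip W W - 2 * \<delta> * ip W (Z - Y) + \<delta>\<^sup>2 * ip (Z - Y) (Z - Y)"
      unfolding AY ip_sq[OF sa2, symmetric] ip_left
      by (simp only: ip_diff[of _ W] ip_scale ip_comm[of "Z - Y" W]) (simp add: algebra_simps power2_eq_square)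
    moreover have "ip (Z - Y) (Z - Y) \<le> M"
    proof -
      have "hs_norm n \<pi> (Z - Y) \<le> hs_norm n \<pi> Z + hs_norm n \<pi> Y"
        using p.hs_norm_triangle[of Z "(-1) *\<^sub>R Y"] p.hs_norm_scaleR[of "-1" Y] by simp
      also have "\<dots> \<le> 2 * hs_norm n \<pi> B"
        using p.hs_norm_orbit_hull[OF saB Z] p.hs_norm_orbit_hull[OF saB Y(1)] by simp
      finally show ?thesis unfolding ip_sq[OF saZY] M_def
        by (rule power_mono[OF _ p.hs_norm_nonneg])
    qed
    then have "\<delta>\<^sup>2 * ip (Z - Y) (Z - Y) \<le> \<delta>\<^sup>2 * M" by (rule mult_left_mono) simp
    moreover have "ip W W < Inf D + \<delta>\<^sup>2" using Y(2) unfolding W_def[symmetric] by (simp only: ip_sq[OF saW])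
    ultimately have "2 * \<delta> * ip W (Z - Y) \<le> \<delta>\<^sup>2 + \<delta>\<^sup>2 * M" by linarith
    then have "\<delta> * (2 * ip W (Z - Y)) \<le> \<delta> * (\<delta> * (1 + M))" by (simp add: algebra_simps power2_eq_square)
    then show ?thesis using d(1) by simp
  qed
  obtain UA where UA: "unitary_mat n UA" and DA: "\<And>i. diagonal_mat (mat_adjoint UA * \<pi> (A $ i) * UA)"
    using p.diagonalize[OF A] by blast
  obtain UB where UB: "unitary_mat n UB" and DB: "\<And>i. diagonal_mat (mat_adjoint UB * \<pi> (B $ i) * UB)"
    using p.diagonalize[OF B] by blast
  define \<alpha> where "\<alpha> = (\<lambda>x. mat_adjoint UA * \<pi> x * UA)"
  define \<beta> where "\<beta> = (\<lambda>x. mat_adjoint UB * \<pi> x * UB)"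
  interpret a: matrix_rep n \<alpha> unfolding \<alpha>_def by (rule p.conj_rep[OF UA])
  interpret b: matrix_rep n \<beta> unfolding \<beta>_def by (rule p.conj_rep[OF UB])
  have DA': "diagonal_mat (\<alpha> (A $ i))" and DB': "diagonal_mat (\<beta> (B $ i))" for i
    using DA DB by (simp_all only: \<alpha>_def \<beta>_def)
  have tra: "mtr (\<alpha> x) = mtr (\<pi> x)" and trb: "mtr (\<beta> x) = mtr (\<pi> x)" for x
    unfolding \<alpha>_def \<beta>_def by (rule p.conj_mtr[OF UA], rule p.conj_mtr[OF UB])
  \<comment> \<open>\<open>l\<close> and \<open>m\<close> list the joint eigenvalues of
    \<open>A\<close> and \<open>B\<close>. Of \<open>W\<close> only the diagonal in the eigenbasis
    of \<open>A\<close> enters, because it is paired only with tuples that are diagonal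
    there.\<close>
  define l m w where "l j = (\<chi> i. Re (\<alpha> (A $ i) $$ (j, j)))"
    and "m j = (\<chi> i. Re (\<beta> (B $ i) $$ (j, j)))" and "w j = (\<chi> i. Re (\<alpha> (W $ i) $$ (j, j)))" for j
  have reA: "\<alpha> (A $ i) $$ (j, j) = of_real (l j $ i)" if "j < n" for i j
    using a.entry_star[OF that that, of "A $ i"] saA by (simp add: l_def sa_tuple_def self_adjoint_def complex_eq_iff)
  have reB: "\<beta> (B $ i) $$ (j, j) = of_real (m j $ i)" if "j < n" for i j
    using b.entry_star[OF that that, of "B $ i"] saB by (simp add: m_def sa_tuple_def self_adjoint_def complex_eq_iff)
  have "(\<Sum>j<n. f (l j)) \<le> (\<Sum>j<n. f (m j))" if f: "continuous_on UNIV f" "convex_on UNIV f" for f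
  proof -
    have "Re (mtr (\<pi> (joint_fun_calc f A)) / of_nat n) \<le> Re (mtr (\<pi> (joint_fun_calc f B)) / of_nat n)"
      using maj tracial_state_rep[OF p.matrix_rep_axioms n] f unfolding tracially_majorized_def by blast
    moreover have "mtr (\<pi> (joint_fun_calc f A)) = of_real (\<Sum>j<n. f (l j))"
      unfolding tra[symmetric] mtr_carrier[OF a.carrier]
      using joint_fun_calc_diagonal(2)[OF A a.matrix_rep_axioms DA' f(1)] by (simp add: l_def)
    moreover have "mtr (\<pi> (joint_fun_calc f B)) = of_real (\<Sum>j<n. f (m j))"
      unfolding trb[symmetric] mtr_carrier[OF b.carrier]
      using joint_fun_calc_diagonal(2)[OF B b.matrix_rep_axioms DB' f(1)] by (simp add: m_def)
    ultimately have "Re (of_real ((\<Sum>j<n. f (l j)) / real n)) \<le> Re (of_real ((\<Sum>j<n. f (m j)) / real n))"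
      by (simp only: of_real_divide of_real_of_nat_eq)
    then show ?thesis using n by (simp add: divide_le_cancel)
  qed
  then obtain q where q: "q permutes {..<n}" "(\<Sum>j<n. w j \<bullet> l j) \<le> (\<Sum>j<n. w j \<bullet> m (q j))"
    using majorization_permutation[of l n m w] by blast
  define V where "V = mat n n (\<lambda>(a, b). UB $$ (a, q b))"
  have V: "unitary_mat n V" unfolding V_def by (rule permuted_unitary[OF UB q(1)])
  \<comment> \<open>This unitary takes the eigenbasis of \<open>A\<close> to that of
    \<open>B\<close> rearranged by \<open>q\<close>, so the conjugate of \<open>B\<close> is
    diagonal in the eigenbasis of \<open>A\<close> with entries \<open>m (q j)\<close>.\<close>
  obtain u where u: "u \<in> expi_group" "\<pi> u = V * mat_adjoint UA"
    using onto_lift_unitary[OF onto unitary_mat_mult[OF V unitary_mat_adjoint[OF UA]]] .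
  define Z where "Z = conj_by u B"
  have Zh: "Z \<in> orbit_hull B" unfolding Z_def by (rule orbit_hull_base[OF u(1)])
  have aZ: "\<alpha> (Z $ i) $$ (j, k) = (if j = k then of_real (m (q j) $ i) else 0)" if jk: "j < n" "k < n" for i j k
  proof -
    have c: "V \<in> carrier_mat n n" "mat_adjoint V \<in> carrier_mat n n" "UA \<in> carrier_mat n n" "mat_adjoint UA \<in> carrier_mat n n"
      and UU: "mat_adjoint UA * UA = 1\<^sub>m n"
      using V UA by (auto simp: unitary_mat_def)
    have aV: "mat_adjoint V * \<pi> (B $ i) \<in> carrier_mat n n" using c by (intro mult_carrier_mat[OF c(2) p.carrier])
    have "\<pi> (Z $ i) = mat_adjoint (V * mat_adjoint UA) * \<pi> (B $ i) * (V * mat_adjoint UA)"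
      by (simp add: Z_def conj_by_def p.mult p.star u)
    also have "mat_adjoint (V * mat_adjoint UA) = UA * mat_adjoint V"
      using mat_adjoint_mult[OF c(1,4)] by simp
    also have "UA * mat_adjoint V * \<pi> (B $ i) * (V * mat_adjoint UA) = UA * (mat_adjoint V * \<pi> (B $ i) * V) * mat_adjoint UA"
      using assoc_mult_mat[OF c(3,2) p.carrier] assoc_mult_mat[OF c(3) aV mult_carrier_mat[OF c(1,4)]]
        assoc_mult_mat[OF aV c(1,4)] assoc_mult_mat[OF c(3) mult_carrier_mat[OF aV c(1)] c(4)] by simp
    finally have "\<alpha> (Z $ i) = mat_adjoint UA * (UA * (mat_adjoint V * \<pi> (B $ i) * V) * mat_adjoint UA) * UA"
      by (simp add: \<alpha>_def)
    also have "\<dots> = mat_adjoint V * \<pi> (B $ i) * V"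
    proof -
      let ?X = "mat_adjoint V * \<pi> (B $ i) * V"
      have X: "?X \<in> carrier_mat n n" using mult_carrier_mat[OF aV c(1)] .
      have "mat_adjoint UA * (UA * ?X * mat_adjoint UA) = mat_adjoint UA * (UA * ?X) * mat_adjoint UA"
        by (rule assoc_mult_mat[OF c(4) mult_carrier_mat[OF c(3) X] c(4), symmetric])
      also have "mat_adjoint UA * (UA * ?X) = ?X"
        using assoc_mult_mat[OF c(4,3) X] UU left_mult_one_mat[OF X] by simp
      finally have "mat_adjoint UA * (UA * ?X * mat_adjoint UA) = ?X * mat_adjoint UA" .
      then show ?thesis
        using assoc_mult_mat[OF X c(4,3)] UU right_mult_one_mat[OF X] by simp
    qed
    finally have "\<alpha> (Z $ i) $$ (j, k) = \<beta> (B $ i) $$ (q j, q k)"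
      using permuted_unitary(2)[OF UB q(1) p.carrier jk] by (simp only: V_def \<beta>_def)
    moreover have "q j < n" "q k < n" using jk permutes_in_image[OF q(1)] by auto
    moreover have "q j = q k \<longleftrightarrow> j = k" using permutes_inj[OF q(1)] by (simp add: inj_eq)
    ultimately show ?thesis using DB'[of i] reB by (auto simp: diagonal_mat_def)
  qed
  have DZ: "diagonal_mat (\<alpha> (Z $ i))" for i using aZ by (simp add: diagonal_mat_def)
  have ipd: "ip W X = (\<Sum>j<n. w j \<bullet> v j)"
    if X: "\<And>i. diagonal_mat (\<alpha> (X $ i))" "\<And>i j. j < n \<Longrightarrow> \<alpha> (X $ i) $$ (j, j) = of_real (v j $ i)" for X and v :: "nat \<Rightarrow> real ^ 'm"
  proof -
    have "Re (mtr (\<pi> (W $ i * X $ i))) = (\<Sum>j<n. w j $ i * v j $ i)" for i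
      unfolding tra[symmetric] mtr_carrier[OF a.carrier] by (simp add: a.diagonal_mult(2)[OF X(1)] X(2) w_def)
    then have "ip W X = (\<Sum>i\<in>UNIV. \<Sum>j<n. w j $ i * v j $ i)" by (simp add: ip_def)
    also have "\<dots> = (\<Sum>j<n. \<Sum>i\<in>UNIV. w j $ i * v j $ i)" by (rule sum.swap)
    finally show ?thesis by (simp add: inner_vec_def)
  qed
  have "ip W A = (\<Sum>j<n. w j \<bullet> l j)" by (rule ipd) (use DA' reA in auto)
  moreover have "ip W Z = (\<Sum>j<n. w j \<bullet> m (q j))" by (rule ipd) (use DZ aZ in auto)
  ultimately have "ip W A \<le> ip W Z" using q(2) by simp
  then have "ip W W \<le> \<delta> * (1 + M) / 2" using var[OF Zh] ip_diff[of W A Y] ip_diff[of W Z Y] by (simp add: W_def)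
  also have "\<dots> < e" using d e by linarith
  finally have "(hs_norm n \<pi> W)\<^sup>2 < e" by (simp only: ip_sq[OF saW])
  then show ?thesis using that[OF Y(1)] by (simp only: W_def)
qed

end

subsection \<open>Elements that act as scalars\<close>

definition real_calc :: "(real \<Rightarrow> real) \<Rightarrow> 'a::unital_cstar_algebra \<Rightarrow> 'a"
  where "real_calc f h = joint_fun_calc (\<lambda>x :: real ^ 1. f (x $ 1)) (\<chi> i. h)"

context matrix_rep
begin

definition acts_scalar :: "'a \<Rightarrow> complex \<Rightarrow> bool"
  where "acts_scalar x c \<longleftrightarrow> (\<forall>y<n. \<forall>z<n. \<pi> x $$ (y, z) = (if y = z then c else 0))"

lemma acts_scalar_iff: "acts_scalar x c \<longleftrightarrow> \<pi> x = c \<cdot>\<^sub>m 1\<^sub>m n"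
proof
  assume "acts_scalar x c"
  then show "\<pi> x = c \<cdot>\<^sub>m 1\<^sub>m n" by (intro eq_matI) (auto simp: acts_scalar_def)
qed (auto simp: acts_scalar_def)

lemma acts_scalar_diagonal: "acts_scalar x c \<Longrightarrow> diagonal_mat (\<pi> x)"
  by (auto simp: acts_scalar_def diagonal_mat_def)

lemma acts_scalar_mult: "acts_scalar x c \<Longrightarrow> acts_scalar y d \<Longrightarrow> acts_scalar (x * y) (c * d)"
  unfolding acts_scalar_def[of "x * y"]
proof (intro allI impI)
  fix i j assume "acts_scalar x c" "acts_scalar y d" "i < n" "j < n"
  then show "\<pi> (x * y) $$ (i, j) = (if i = j then c * d else 0)"
    using diagonal_mult(1)[OF acts_scalar_diagonal, of x c i j y] by (simp add: acts_scalar_def)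
qed

lemma acts_scalar_intros:
  "acts_scalar x c \<Longrightarrow> acts_scalar y d \<Longrightarrow> acts_scalar (x + y) (c + d)"
  "acts_scalar x c \<Longrightarrow> acts_scalar y d \<Longrightarrow> acts_scalar (x - y) (c - d)"
  "acts_scalar x c \<Longrightarrow> acts_scalar (r *\<^sub>R x) (of_real r * c)"
  "acts_scalar x c \<Longrightarrow> acts_scalar (star x) (cnj c)"
  by (auto simp: acts_scalar_def entry_add entry_diff entry_scaleR entry_star)

end

lemma acts_scalar_conj:
  assumes "matrix_rep n \<pi>" and U: "unitary_mat n U"
    and s: "matrix_rep.acts_scalar n (\<lambda>x. mat_adjoint U * \<pi> x * U) x c"
  shows "matrix_rep.acts_scalar n \<pi> x c"
proof -
  interpret p: matrix_rep n \<pi> by fact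
  interpret r: matrix_rep n "\<lambda>x. mat_adjoint U * \<pi> x * U" by (rule p.conj_rep[OF U])
  have Uc: "U \<in> carrier_mat n n" and Ua: "mat_adjoint U \<in> carrier_mat n n" and UU: "U * mat_adjoint U = 1\<^sub>m n"
    using U by (auto simp: unitary_mat_def)
  have e: "mat_adjoint U * \<pi> x * U = c \<cdot>\<^sub>m 1\<^sub>m n" using s unfolding r.acts_scalar_iff .
  have "\<pi> x = U * (mat_adjoint U * \<pi> x * U) * mat_adjoint U" by (rule p.conj_inverse[OF U, symmetric])
  also have "\<dots> = U * (c \<cdot>\<^sub>m 1\<^sub>m n) * mat_adjoint U" by (simp only: e)
  also have "U * (c \<cdot>\<^sub>m 1\<^sub>m n) = c \<cdot>\<^sub>m U"
    by (simp only: mult_smult_distrib[OF Uc one_carrier_mat] right_mult_one_mat[OF Uc])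
  also have "c \<cdot>\<^sub>m U * mat_adjoint U = c \<cdot>\<^sub>m 1\<^sub>m n"
    by (simp only: mult_smult_assoc_mat[OF Uc Ua] UU)
  finally show ?thesis by (simp only: p.acts_scalar_iff)
qed

context subhom
begin

lemma real_calc_family: "self_adjoint h \<Longrightarrow> abelian_family ((\<chi> i. h) :: 'a ^ 1)"
  by (simp add: abelian_family_def)

lemma real_calc_continuous: "continuous_on UNIV f \<Longrightarrow> continuous_on UNIV (\<lambda>x :: real ^ 1. f (x $ 1))"
  by (rule continuous_on_compose2[of UNIV f]) (auto intro: continuous_intros)

lemma real_calc_self_adjoint:
  fixes h :: 'a
  assumes "self_adjoint h" "continuous_on UNIV f"
  shows "self_adjoint (real_calc f h)"
  unfolding real_calc_def
  by (rule joint_fun_calc(3)[OF real_calc_family[OF assms(1)] real_calc_continuous[OF assms(2)]])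

lemma real_calc_diagonal:
  fixes h :: 'a
  assumes "self_adjoint h" "continuous_on UNIV f" "matrix_rep n \<pi>" "diagonal_mat (\<pi> h)"
  shows "diagonal_mat (\<pi> (real_calc f h))"
    and "j < n \<Longrightarrow> \<pi> (real_calc f h) $$ (j, j) = of_real (f (Re (\<pi> h $$ (j, j))))"
  using joint_fun_calc_diagonal[OF real_calc_family[OF assms(1)] assms(3) _ real_calc_continuous[OF assms(2)]] assms(4)
  unfolding real_calc_def by simp_all

lemma real_calc_scalar:
  fixes h :: 'a
  assumes "self_adjoint h" "continuous_on UNIV f" "matrix_rep n \<pi>" "matrix_rep.acts_scalar n \<pi> h (of_real s)"
  shows "matrix_rep.acts_scalar n \<pi> (real_calc f h) (of_real (f s))"
proof -
  interpret matrix_rep n \<pi> by fact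
  have d: "diagonal_mat (\<pi> h)" by (rule acts_scalar_diagonal[OF assms(4)])
  show ?thesis
    using real_calc_diagonal[OF assms(1,2,3) d] assms(4)
    by (auto simp: acts_scalar_def diagonal_mat_def)
qed

end

subsection \<open>Central elements of the ideal of irreducible representations of maximal dimension\<close>

primrec path_prod :: "(nat \<Rightarrow> 'a::monoid_mult) \<Rightarrow> nat \<Rightarrow> nat \<Rightarrow> 'a"
  where "path_prod b i 0 = 1"
  | "path_prod b i (Suc t) = path_prod b i t * b (i + t)"

text \<open>Closed paths with two turns rather than one: wherever such a path is cut in its first
  turn, at least n consecutive factors remain after the cut, so that \<open>path_prod_zero\<close>
  still applies to the piece.\<close>

definition loop_sum :: "nat \<Rightarrow> (nat \<Rightarrow> 'a::ring_1) \<Rightarrow> 'a"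
  where "loop_sum n b = (\<Sum>i<n. path_prod b i (2 * n))"

text \<open>Inserting \<open>a\<close> at the n successive positions of the first turn meets each
  diagonal entry of \<open>a\<close> once; in this way the trace of \<open>a\<close> is produced by
  an element of the algebra.\<close>

definition loop_trace :: "nat \<Rightarrow> (nat \<Rightarrow> 'a::ring_1) \<Rightarrow> 'a \<Rightarrow> 'a"
  where "loop_trace n b a = (\<Sum>i<n. \<Sum>t<n. path_prod b i (Suc t) * a * path_prod b (i + Suc t) (2 * n - Suc t))"

lemma rotation_bij:
  assumes n: "n > 0"
  shows "bij_betw (\<lambda>l. (i + l) mod n) {..<n} {..<n :: nat}"
proof -
  have lt: False if "l < l'" "l' < n" "(i + l) mod n = (i + l') mod n" for l l'
  proof -
    have "n dvd (i + l') - (i + l)"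
      by (subst mod_eq_dvd_iff_nat[symmetric]) (use that in auto)
    then have "n dvd l' - l" by simp
    then show False using that dvd_imp_le[of n "l' - l"] by simp
  qed
  have inj: "inj_on (\<lambda>l. (i + l) mod n) {..<n}"
  proof (rule inj_onI)
    fix l l' assume "l \<in> {..<n}" "l' \<in> {..<n}" "(i + l) mod n = (i + l') mod n"
    then show "l = l'" using lt[of l l'] lt[of l' l] by (cases l l' rule: linorder_cases) auto
  qed
  moreover have "(\<lambda>l. (i + l) mod n) ` {..<n} = {..<n}"
    by (rule endo_inj_surj[OF _ _ inj]) (use n in auto)
  ultimately show ?thesis by (simp add: bij_betw_def)
qed

lemma prod_lessThan_split:
  fixes f :: "nat \<Rightarrow> 'b::comm_monoid_mult"
  shows "(\<Prod>l<m + k. f l) = (\<Prod>l<m. f l) * (\<Prod>l<k. f (m + l))"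
  by (induction k) (simp_all add: mult.assoc)

lemma prod_rotation:
  fixes f :: "nat \<Rightarrow> 'b::comm_monoid_mult"
  assumes "n > 0" "\<And>j. f (j mod n) = f j"
  shows "(\<Prod>l<n. f (i + l)) = (\<Prod>l<n. f l)"
proof -
  have "(\<Prod>l<n. f (i + l)) = (\<Prod>l<n. f ((i + l) mod n))" by (simp add: assms(2))
  also have "\<dots> = (\<Prod>l<n. f l)" by (rule prod.reindex_bij_betw[OF rotation_bij[OF assms(1)]])
  finally show ?thesis .
qed

lemma sum_rotation:
  fixes f :: "nat \<Rightarrow> 'b::comm_monoid_add"
  assumes "n > 0" "\<And>j. f (j mod n) = f j"
  shows "(\<Sum>l<n. f (i + l)) = (\<Sum>l<n. f l)"
proof -
  have "(\<Sum>l<n. f (i + l)) = (\<Sum>l<n. f ((i + l) mod n))" by (simp add: assms(2))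
  also have "\<dots> = (\<Sum>l<n. f l)" by (rule sum.reindex_bij_betw[OF rotation_bij[OF assms(1)]])
  finally show ?thesis .
qed

context matrix_rep
begin

lemma path_prod_zero:
  assumes z: "\<pi> (b j) = 0\<^sub>m n n" and m: "m > 0" "\<And>j. b (j mod m) = b j" and t: "t \<ge> m"
  shows "\<pi> (path_prod b i t) = 0\<^sub>m n n"
proof -
  have "j mod m \<in> (\<lambda>l. (i + l) mod m) ` {..<m}"
    using bij_betw_imp_surj_on[OF rotation_bij[OF m(1)]] m(1) by simp
  then obtain l where l: "l < m" "j mod m = (i + l) mod m" by auto
  have "b (i + l) = b j" using m(2)[of j] m(2)[of "i + l"] l(2) by simp
  then have b0: "\<pi> (b (i + l)) = 0\<^sub>m n n" using z by simp
  have "\<pi> (path_prod b i t) = 0\<^sub>m n n" if "l < t" for t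
    using that
  proof (induction t)
    case (Suc t)
    show ?case
    proof (cases "t = l")
      case True
      then show ?thesis using right_mult_zero_mat[OF carrier] by (simp add: mult b0)
    next
      case False
      then show ?thesis using Suc left_mult_zero_mat[OF carrier] by (simp add: mult)
    qed
  qed simp
  then show ?thesis using l t by simp
qed

lemma loop_zero:
  assumes "\<pi> (b j) = 0\<^sub>m n n" "m > 0" "\<And>j. b (j mod m) = b j"
  shows "acts_scalar (loop_sum m b) 0" "acts_scalar (loop_trace m b a) 0"
proof -
  note z = path_prod_zero[OF assms]
  show "acts_scalar (loop_sum m b) 0"
    by (auto simp: acts_scalar_def loop_sum_def entry_sum z)
  have "\<pi> (path_prod b i (Suc t) * a * path_prod b (i + Suc t) (2 * m - Suc t)) = 0\<^sub>m n n" if "t < m" for i t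
  proof -
    have e: "\<pi> (path_prod b (i + Suc t) (2 * m - Suc t)) = 0\<^sub>m n n" by (rule z) (use that in simp)
    show ?thesis
      unfolding mult[of "path_prod b i (Suc t) * a"] e by (rule right_mult_zero_mat[OF carrier])
  qed
  then show "acts_scalar (loop_trace m b a) 0"
    by (auto simp: acts_scalar_def loop_trace_def entry_sum)
qed

context
  fixes b :: "nat \<Rightarrow> 'a" and x :: "nat \<Rightarrow> nat" and \<beta> :: "nat \<Rightarrow> complex"
  assumes n: "n > 0"
    and x: "bij_betw x {..<n} {..<n}" "\<And>j. x (j mod n) = x j"
    and \<beta>: "\<And>j. \<beta> (j mod n) = \<beta> j"
    and b: "\<And>j y z. y < n \<Longrightarrow> z < n \<Longrightarrow> \<pi> (b j) $$ (y, z) = (if y = x j \<and> z = x (Suc j) then \<beta> j else 0)"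
begin

lemma x_less: "x j < n"
proof -
  have "x (j mod n) \<in> {..<n}" using bij_betwE[OF x(1)] n by simp
  then show ?thesis by (simp add: x(2))
qed

lemma path_entry:
  "y < n \<Longrightarrow> z < n \<Longrightarrow> \<pi> (path_prod b i (Suc t)) $$ (y, z) =
    (if y = x i \<and> z = x (i + Suc t) then \<Prod>l<Suc t. \<beta> (i + l) else 0)"
proof (induction t arbitrary: z)
  case 0
  then show ?case by (simp add: b)
next
  case (Suc t)
  have "\<pi> (path_prod b i (Suc (Suc t))) $$ (y, z) = (\<Sum>v<n. \<pi> (path_prod b i (Suc t)) $$ (y, v) * \<pi> (b (i + Suc t)) $$ (v, z))"
    using Suc.prems by (simp only: path_prod.simps(2)[of b i "Suc t"] entry_mult)
  also have "\<dots> = (\<Sum>v<n. if v = x (i + Suc t) then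
      (if y = x i \<and> z = x (i + Suc (Suc t)) then (\<Prod>l<Suc t. \<beta> (i + l)) * \<beta> (i + Suc t) else 0) else 0)"
    using Suc.prems by (intro sum.cong) (auto simp: Suc.IH b simp del: path_prod.simps(2) prod.lessThan_Suc)
  also have "\<dots> = (if y = x i \<and> z = x (i + Suc (Suc t)) then (\<Prod>l<Suc t. \<beta> (i + l)) * \<beta> (i + Suc t) else 0)"
    using x_less by simp
  finally show ?case by simp
qed

lemma prod_two_turns: "(\<Prod>l<2 * n. \<beta> (i + l)) = (\<Prod>l<n. \<beta> l)\<^sup>2"
proof -
  have "(\<Prod>l<n + n. \<beta> (i + l)) = (\<Prod>l<n. \<beta> (i + l)) * (\<Prod>l<n. \<beta> (i + n + l))"
    by (simp only: prod_lessThan_split add.assoc)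
  then show ?thesis
    unfolding prod_rotation[of n \<beta>, OF n \<beta>] by (simp add: power2_eq_square mult_2)
qed

text \<open>Each \<open>b j\<close> is a multiple of a matrix unit that leads from one basis vector
  to the next in a cyclic enumeration. A loop starting at \<open>x i\<close> is a multiple of the
  diagonal matrix unit at \<open>x i\<close>, the factor does not depend on the starting point, and
  the diagonal units add up to the identity.\<close>

lemma loop_sum_scalar: "acts_scalar (loop_sum n b) ((\<Prod>l<n. \<beta> l)\<^sup>2)"
  unfolding acts_scalar_def
proof (intro allI impI)
  fix y z assume yz: "y < n" "z < n"
  obtain m where m: "2 * n = Suc m" using n by (cases "2 * n") auto
  have per: "x (i + 2 * n) = x i" for i using x(2)[of "i + 2 * n"] x(2)[of i] by simp
  have "\<pi> (loop_sum n b) $$ (y, z) = (\<Sum>i<n. if y = x i \<and> z = x i then (\<Prod>l<n. \<beta> l)\<^sup>2 else 0)"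
    unfolding loop_sum_def entry_sum[OF yz]
    by (rule sum.cong) (use path_entry[OF yz, of _ m] m per prod_two_turns in auto)
  also have "\<dots> = (\<Sum>v<n. if y = v \<and> z = v then (\<Prod>l<n. \<beta> l)\<^sup>2 else 0)"
    by (rule sum.reindex_bij_betw[OF x(1)])
  also have "\<dots> = (\<Sum>v<n. if v = y then (if y = z then (\<Prod>l<n. \<beta> l)\<^sup>2 else 0) else 0)"
    by (rule sum.cong) auto
  finally show "\<pi> (loop_sum n b) $$ (y, z) = (if y = z then (\<Prod>l<n. \<beta> l)\<^sup>2 else 0)"
    using yz by simp
qed

text \<open>With \<open>a\<close> inserted after t + 1 steps, the loop from \<open>x i\<close> picks
  up the diagonal entry of \<open>a\<close> at \<open>x (i + Suc t)\<close>. As t runs through one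
  turn, this entry runs through the whole diagonal.\<close>

lemma loop_trace_scalar: "acts_scalar (loop_trace n b a) ((\<Prod>l<n. \<beta> l)\<^sup>2 * mtr (\<pi> a))"
  unfolding acts_scalar_def
proof (intro allI impI)
  fix y z assume yz: "y < n" "z < n"
  let ?g = "(\<Prod>l<n. \<beta> l)\<^sup>2"
  have per: "x (i + 2 * n) = x i" for i using x(2)[of "i + 2 * n"] x(2)[of i] by simp
  have tm: "\<pi> (path_prod b i (Suc t) * a * path_prod b (i + Suc t) (2 * n - Suc t)) $$ (y, z)
      = (if y = x i \<and> z = x i then ?g * \<pi> a $$ (x (i + Suc t), x (i + Suc t)) else 0)" if t: "t < n" for i t
  proof -
    obtain m where m: "2 * n - Suc t = Suc m" using t by (cases "2 * n - Suc t") auto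
    have l: "\<pi> (path_prod b i (Suc t) * a) $$ (y, v) =
        (if y = x i then (\<Prod>l<Suc t. \<beta> (i + l)) * \<pi> a $$ (x (i + Suc t), v) else 0)" if v: "v < n" for v
    proof -
      have "\<pi> (path_prod b i (Suc t) * a) $$ (y, v) = (\<Sum>u<n. \<pi> (path_prod b i (Suc t)) $$ (y, u) * \<pi> a $$ (u, v))"
        by (rule entry_mult[OF yz(1) v])
      also have "\<dots> = (\<Sum>u<n. if u = x (i + Suc t) then
          (if y = x i then (\<Prod>l<Suc t. \<beta> (i + l)) * \<pi> a $$ (x (i + Suc t), v) else 0) else 0)"
        by (rule sum.cong) (use yz path_entry in \<open>auto simp del: path_prod.simps(2) prod.lessThan_Suc\<close>)
      finally show ?thesis using x_less by simp
    qed
    have e: "i + Suc t + Suc m = i + 2 * n" using m t by simp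
    have "\<pi> (path_prod b i (Suc t) * a * path_prod b (i + Suc t) (2 * n - Suc t)) $$ (y, z)
        = (\<Sum>v<n. \<pi> (path_prod b i (Suc t) * a) $$ (y, v) * \<pi> (path_prod b (i + Suc t) (Suc m)) $$ (v, z))"
      unfolding m by (rule entry_mult[OF yz])
    also have "\<dots> = (\<Sum>v<n. if v = x (i + Suc t) then (if y = x i \<and> z = x i then
        (\<Prod>l<Suc t. \<beta> (i + l)) * \<pi> a $$ (x (i + Suc t), x (i + Suc t)) * (\<Prod>l<Suc m. \<beta> (i + Suc t + l)) else 0) else 0)"
    proof (rule sum.cong)
      fix v assume "v \<in> {..<n}"
      then have v: "v < n" by simp
      show "\<pi> (path_prod b i (Suc t) * a) $$ (y, v) * \<pi> (path_prod b (i + Suc t) (Suc m)) $$ (v, z) =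
        (if v = x (i + Suc t) then (if y = x i \<and> z = x i then
        (\<Prod>l<Suc t. \<beta> (i + l)) * \<pi> a $$ (x (i + Suc t), x (i + Suc t)) * (\<Prod>l<Suc m. \<beta> (i + Suc t + l)) else 0) else 0)"
        unfolding l[OF v] path_entry[OF v yz(2)] e per by auto
    qed simp
    also have "\<dots> = (if y = x i \<and> z = x i then
        (\<Prod>l<Suc t. \<beta> (i + l)) * \<pi> a $$ (x (i + Suc t), x (i + Suc t)) * (\<Prod>l<Suc m. \<beta> (i + Suc t + l)) else 0)"
      using x_less by simp
    also have "(\<Prod>l<Suc t. \<beta> (i + l)) * \<pi> a $$ (x (i + Suc t), x (i + Suc t)) * (\<Prod>l<Suc m. \<beta> (i + Suc t + l))
        = ?g * \<pi> a $$ (x (i + Suc t), x (i + Suc t))"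
    proof -
      have p: "(\<Prod>l<Suc t + Suc m. \<beta> (i + l)) = (\<Prod>l<Suc t. \<beta> (i + l)) * (\<Prod>l<Suc m. \<beta> (i + Suc t + l))"
        by (simp only: prod_lessThan_split add.assoc)
      have q: "Suc t + Suc m = 2 * n" using m t by simp
      show ?thesis unfolding p[unfolded q prod_two_turns] by (simp only: mult_ac)
    qed
    finally show ?thesis .
  qed
  have tr: "(\<Sum>t<n. \<pi> a $$ (x (i + Suc t), x (i + Suc t))) = mtr (\<pi> a)" for i
  proof -
    have "(\<Sum>t<n. \<pi> a $$ (x (i + Suc t), x (i + Suc t))) = (\<Sum>t<n. \<pi> a $$ (x (Suc i + t), x (Suc i + t)))" by simp
    also have "\<dots> = (\<Sum>t<n. \<pi> a $$ (x t, x t))"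
      by (rule sum_rotation[OF n, of "\<lambda>j. \<pi> a $$ (x j, x j)"]) (simp add: x(2))
    also have "\<dots> = (\<Sum>v<n. \<pi> a $$ (v, v))"
      by (rule sum.reindex_bij_betw[OF x(1)])
    finally show ?thesis by (simp add: mtr_carrier[OF carrier])
  qed
  have "\<pi> (loop_trace n b a) $$ (y, z) =
      (\<Sum>i<n. \<Sum>t<n. if y = x i \<and> z = x i then ?g * \<pi> a $$ (x (i + Suc t), x (i + Suc t)) else 0)"
    unfolding loop_trace_def entry_sum[OF yz] by (intro sum.cong refl tm) simp
  also have "\<dots> = (\<Sum>i<n. if y = x i \<and> z = x i then ?g * mtr (\<pi> a) else 0)"
  proof (intro sum.cong refl)
    fix i
    show "(\<Sum>t<n. if y = x i \<and> z = x i then ?g * \<pi> a $$ (x (i + Suc t), x (i + Suc t)) else 0)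
        = (if y = x i \<and> z = x i then ?g * mtr (\<pi> a) else 0)"
    proof (cases "y = x i \<and> z = x i")
      case True
      then show ?thesis using tr[of i] by (simp flip: sum_distrib_left)
    next
      case False
      then show ?thesis by (simp only: if_False sum.neutral_const)
    qed
  qed
  also have "\<dots> = (\<Sum>v<n. if y = v \<and> z = v then ?g * mtr (\<pi> a) else 0)"
    by (rule sum.reindex_bij_betw[OF x(1)])
  also have "\<dots> = (\<Sum>v<n. if v = y then (if y = z then ?g * mtr (\<pi> a) else 0) else 0)"
    by (rule sum.cong) auto
  finally show "\<pi> (loop_trace n b a) $$ (y, z) = (if y = z then ?g * mtr (\<pi> a) else 0)"
    using yz by simp
qed

end
end

section \<open>Cutoff elements from bump functions of a self-adjoint element\<close>

definition bump :: "nat \<Rightarrow> real \<Rightarrow> real"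
  where "bump j t = max 0 (1 - 2 * \<bar>t - real j\<bar>)"

lemma continuous_bump: "continuous_on UNIV (bump j)"
  unfolding bump_def by (intro continuous_intros)

lemma bump_disjoint: "bump i t \<noteq> 0 \<Longrightarrow> bump j t \<noteq> 0 \<Longrightarrow> i = j"
proof (rule ccontr)
  assume "bump i t \<noteq> 0" "bump j t \<noteq> 0" "i \<noteq> j"
  then have "\<bar>t - real i\<bar> < 1 / 2" "\<bar>t - real j\<bar> < 1 / 2" "\<bar>real i - real j\<bar> \<ge> 1"
    by (auto simp: bump_def max_def split: if_splits)
  then show False by linarith
qed

lemma bump_self: "bump j (real j) = 1"
  by (simp add: bump_def)

text \<open>
  In a representation of dimension at most \<open>n\<close>, a product of \<open>n\<close> consecutive factors \<open>b\<^sub>j\<close> can only be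
  nonzero if \<open>h\<close> has an eigenvalue in each of the \<open>n\<close> disjoint supports of the bump functions. Then the
  dimension is \<open>n\<close>, each \<open>s\<^sub>j(h)\<close> has rank one, and the closed loops sum up to a scalar.
\<close>

definition loop_factor :: "nat \<Rightarrow> 'a::unital_cstar_algebra \<Rightarrow> (nat \<Rightarrow> 'a) \<Rightarrow> nat \<Rightarrow> 'a"
  where "loop_factor n h w j = real_calc (bump (j mod n)) h * w (j mod n) * real_calc (bump (Suc j mod n)) h"

lemma loop_factor_mod: "loop_factor n h w (j mod n) = loop_factor n h w j"
  by (simp add: loop_factor_def mod_Suc_eq)

text \<open>Where the loop sum acts as g and the loop trace as g t, the value is |g|^2 (1 - t/e):
  the adjoint factor removes the unknown phase of g, so that the sign is known. Symmetrizing makes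
  the element self-adjoint also in representations in which it is not scalar.\<close>

definition central_elt :: "nat \<Rightarrow> real \<Rightarrow> (nat \<Rightarrow> 'a::unital_cstar_algebra) \<Rightarrow> 'a \<Rightarrow> 'a"
  where "central_elt n e b a = (let r = star (loop_sum n b) * (loop_sum n b - (1 / e) *\<^sub>R loop_trace n b a)
    in (1 / 2) *\<^sub>R (r + star r))"

lemma (in matrix_rep) central_elt_scalar:
  assumes "acts_scalar (loop_sum m b) g" "acts_scalar (loop_trace m b a) (g * of_real t)"
  shows "acts_scalar (central_elt m e b a) (of_real ((cmod g)\<^sup>2 * (1 - t / e)))"
proof -
  let ?r = "star (loop_sum m b) * (loop_sum m b - (1 / e) *\<^sub>R loop_trace m b a)"
  have "acts_scalar ?r (cnj g * (g - of_real (1 / e) * (g * of_real t)))"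
    by (intro acts_scalar_intros acts_scalar_mult assms)
  also have "cnj g * (g - of_real (1 / e) * (g * of_real t)) = (g * cnj g) * of_real (1 - t / e)"
    by (simp add: algebra_simps)
  also have "g * cnj g = of_real ((cmod g)\<^sup>2)" by (simp add: cmod_square)
  finally have r: "acts_scalar ?r (of_real ((cmod g)\<^sup>2 * (1 - t / e)))" by (simp only: of_real_mult)
  have "acts_scalar ((1 / 2) *\<^sub>R (?r + star ?r))
      (of_real (1/2) * (of_real ((cmod g)\<^sup>2 * (1 - t / e)) + cnj (of_real ((cmod g)\<^sup>2 * (1 - t / e)))))"
    by (intro acts_scalar_intros r)
  moreover have "of_real (1/2) * (of_real ((cmod g)\<^sup>2 * (1 - t / e)) + cnj (of_real ((cmod g)\<^sup>2 * (1 - t / e))))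
      = complex_of_real ((cmod g)\<^sup>2 * (1 - t / e))" by simp
  ultimately show ?thesis by (simp only: central_elt_def Let_def)
qed

context subhom
begin

lemma loop_diagonal:
  fixes h a :: 'a and w :: "nat \<Rightarrow> 'a"
  assumes h: "self_adjoint h" and rep: "matrix_rep k \<rho>" and D: "diagonal_mat (\<rho> h)" and n: "n > 0"
  defines "ev y \<equiv> Re (\<rho> h $$ (y, y))" and "b \<equiv> loop_factor n h w"
  shows "j < n \<Longrightarrow> (\<And>y. y < k \<Longrightarrow> bump j (ev y) = 0) \<Longrightarrow>
      matrix_rep.acts_scalar k \<rho> (loop_sum n b) 0 \<and> matrix_rep.acts_scalar k \<rho> (loop_trace n b a) 0"
    and "k = n \<Longrightarrow> bij_betw x {..<n} {..<n} \<Longrightarrow> (\<And>j y. j < n \<Longrightarrow> y < n \<Longrightarrow> bump j (ev y) \<noteq> 0 \<longleftrightarrow> y = x j) \<Longrightarrow>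
      (\<And>j. \<beta> j = of_real (bump (j mod n) (ev (x (j mod n)))) * \<rho> (w (j mod n)) $$ (x (j mod n), x (Suc j mod n)) *
        of_real (bump (Suc j mod n) (ev (x (Suc j mod n))))) \<Longrightarrow>
      matrix_rep.acts_scalar k \<rho> (loop_sum n b) ((\<Prod>l<n. \<beta> l)\<^sup>2) \<and>
      matrix_rep.acts_scalar k \<rho> (loop_trace n b a) ((\<Prod>l<n. \<beta> l)\<^sup>2 * mtr (\<rho> a))"
proof -
  interpret matrix_rep k \<rho> by fact
  have ds: "diagonal_mat (\<rho> (real_calc (bump j) h))" for j
    by (rule real_calc_diagonal(1)[OF h continuous_bump rep D])
  have es: "\<rho> (real_calc (bump j) h) $$ (y, y) = of_real (bump j (ev y))" if "y < k" for j y
    unfolding ev_def by (rule real_calc_diagonal(2)[OF h continuous_bump rep D that])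
  have eb: "\<rho> (b j) $$ (y, z) = of_real (bump (j mod n) (ev y)) * \<rho> (w (j mod n)) $$ (y, z) * of_real (bump (Suc j mod n) (ev z))"
    if "y < k" "z < k" for j y z
    using that by (simp add: b_def loop_factor_def diagonal_mult[OF ds] es)
  have bm: "b (j mod n) = b j" for j by (simp add: b_def loop_factor_mod)
  show "matrix_rep.acts_scalar k \<rho> (loop_sum n b) 0 \<and> matrix_rep.acts_scalar k \<rho> (loop_trace n b a) 0"
    if j: "j < n" and z: "\<And>y. y < k \<Longrightarrow> bump j (ev y) = 0"
  proof -
    have "\<rho> (b j) = 0\<^sub>m k k" using j z eb by (intro eq_matI) auto
    then show ?thesis using loop_zero[of b j n, OF _ n bm] by blast
  qed
  show "matrix_rep.acts_scalar k \<rho> (loop_sum n b) ((\<Prod>l<n. \<beta> l)\<^sup>2) \<and>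
      matrix_rep.acts_scalar k \<rho> (loop_trace n b a) ((\<Prod>l<n. \<beta> l)\<^sup>2 * mtr (\<rho> a))"
    if k: "k = n" and x: "bij_betw x {..<n} {..<n}"
      and nz: "\<And>j y. j < n \<Longrightarrow> y < n \<Longrightarrow> bump j (ev y) \<noteq> 0 \<longleftrightarrow> y = x j"
      and \<beta>: "\<And>j. \<beta> j = of_real (bump (j mod n) (ev (x (j mod n)))) * \<rho> (w (j mod n)) $$ (x (j mod n), x (Suc j mod n)) *
        of_real (bump (Suc j mod n) (ev (x (Suc j mod n))))"
  proof -
    define X where "X j = x (j mod n)" for j
    have X: "bij_betw X {..<k} {..<k}" "\<And>j. X (j mod k) = X j"
      using x bij_betw_cong[of "{..<n}" X x] by (auto simp: X_def k)
    have bb: "\<beta> (j mod k) = \<beta> j" for j by (simp add: \<beta> k mod_Suc_eq)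
    have e: "\<rho> (b j) $$ (y, z) = (if y = X j \<and> z = X (Suc j) then \<beta> j else 0)" if "y < k" "z < k" for j y z
    proof -
      have "bump (j mod n) (ev y) \<noteq> 0 \<longleftrightarrow> y = X j" "bump (Suc j mod n) (ev z) \<noteq> 0 \<longleftrightarrow> z = X (Suc j)"
        unfolding X_def using that n k by (auto intro!: nz)
      then show ?thesis unfolding eb[OF that] \<beta> X_def by auto
    qed
    have k0: "k > 0" using k n by simp
    show ?thesis
      using loop_sum_scalar[OF k0 X bb e] loop_trace_scalar[OF k0 X bb e] by (simp add: k)
  qed
qed

text \<open>A cutoff function, for a threshold e > 0: among the representations of dimension at most
  n it can be positive only in dimension n and only where the trace of \<open>a\<close> is below
  \<open>e\<close>. At the given \<pi> the unknown nonnegative factor is 1.\<close>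

lemma central_element:
  fixes a :: 'a
  assumes onto: "rep_onto_matrix_algebra n \<pi>" and n: "n > 0" and a: "self_adjoint a"
  obtains r where "self_adjoint r"
    "\<And>k \<rho>. matrix_rep k \<rho> \<Longrightarrow> k < n \<Longrightarrow> matrix_rep.acts_scalar k \<rho> r 0"
    "\<And>\<rho>. matrix_rep n \<rho> \<Longrightarrow> \<exists>c\<ge>0. matrix_rep.acts_scalar n \<rho> r (of_real (c * (1 - Re (mtr (\<rho> a)) / e)))"
    "matrix_rep.acts_scalar n \<pi> r (of_real (1 - Re (mtr (\<pi> a)) / e))"
proof -
  interpret p: matrix_rep n \<pi> by (rule rep_onto_matrix_rep[OF onto])
  \<comment> \<open>The eigenvalues 0, ..., n - 1 sit at the centres of the bump functions, and the
    \<open>w j\<close> below lift cyclic matrix units. So every weight along the loops is 1 in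
    \<pi>.\<close>
  define H where "H = mat n n (\<lambda>(y, z). if y = z then complex_of_nat y else 0)"
  have "H \<in> carrier_mat n n" "mat_adjoint H = H"
    by (auto simp: H_def intro!: eq_matI)
  then obtain h where h: "self_adjoint h" and ph: "\<pi> h = mat n n (\<lambda>(y, z). if y = z then of_nat y else 0)"
    using onto_lift_self_adjoint[OF onto] unfolding H_def by blast
  have "\<exists>w. \<pi> w = mat n n (\<lambda>(y, z). if y = j \<and> z = Suc j mod n then 1 else 0)" for j
    using onto_lift[OF onto, of "mat n n (\<lambda>(y, z). if y = j \<and> z = Suc j mod n then 1 else 0)"] by auto
  then obtain w where w: "\<And>j. \<pi> (w j) = mat n n (\<lambda>(y, z). if y = j \<and> z = Suc j mod n then 1 else 0)" by metis
  define b where "b = loop_factor n h w"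
  define r where "r = central_elt n e b a"
  have sa: "self_adjoint r"
    by (simp add: r_def central_elt_def Let_def self_adjoint_def star_scaleR star_add star_star add.commute)
  have low: "matrix_rep.acts_scalar k \<rho> r 0"
    if rep: "matrix_rep k \<rho>" and z: "matrix_rep.acts_scalar k \<rho> (loop_sum n b) 0" "matrix_rep.acts_scalar k \<rho> (loop_trace n b a) 0" for k \<rho>
    using matrix_rep.central_elt_scalar[OF rep z(1), of a 0 e] z(2) by (simp add: r_def)
  have dich: "(matrix_rep.acts_scalar k \<rho> r 0) \<or> (k = n \<and> (\<exists>c\<ge>0. matrix_rep.acts_scalar n \<rho> r (of_real (c * (1 - Re (mtr (\<rho> a)) / e)))))"
    if rep0: "matrix_rep k \<rho>" and k: "k \<le> n" for k \<rho>
  proof -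
    interpret q: matrix_rep k \<rho> by fact
    obtain U where U: "unitary_mat k U" and DU: "diagonal_mat (mat_adjoint U * \<rho> h * U)"
      using q.diagonalize_single[OF h] by blast
    define \<sigma> where "\<sigma> = (\<lambda>x. mat_adjoint U * \<rho> x * U)"
    have rep: "matrix_rep k \<sigma>" unfolding \<sigma>_def by (rule q.conj_rep[OF U])
    interpret s: matrix_rep k \<sigma> by (rule rep)
    have D: "diagonal_mat (\<sigma> h)" using DU by (simp only: \<sigma>_def)
    have bk: "q.acts_scalar x c" if "s.acts_scalar x c" for x c
      using acts_scalar_conj[OF rep0 U] that unfolding \<sigma>_def by blast
    let ?l = "\<lambda>y. Re (\<sigma> h $$ (y, y))"
    show ?thesis
    proof (cases "\<exists>j<n. \<forall>y<k. bump j (?l y) = 0")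
      case True
      then obtain j where "j < n" "\<And>y. y < k \<Longrightarrow> bump j (?l y) = 0" by blast
      then have "s.acts_scalar (loop_sum n b) 0 \<and> s.acts_scalar (loop_trace n b a) 0"
        unfolding b_def by (rule loop_diagonal(1)[OF h rep D n])
      then show ?thesis using low[OF rep] bk by blast
    next
      case False
      then have "\<forall>j. \<exists>y. j < n \<longrightarrow> y < k \<and> bump j (?l y) \<noteq> 0" by blast
      then obtain x where x: "\<And>j. j < n \<Longrightarrow> x j < k" "\<And>j. j < n \<Longrightarrow> bump j (?l (x j)) \<noteq> 0" by metis
      have inj: "inj_on x {..<n}"
        by (rule inj_onI) (use x bump_disjoint in \<open>metis lessThan_iff\<close>)
      have "card {..<n} \<le> card {..<k}"
        by (rule card_inj_on_le[OF inj]) (use x in auto)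
      then have kn: "k = n" using k by simp
      have "x ` {..<n} = {..<n}" by (rule endo_inj_surj[OF _ _ inj]) (use x kn in auto)
      then have bij: "bij_betw x {..<n} {..<n}" using inj by (simp add: bij_betw_def)
      have nz: "bump j (?l y) \<noteq> 0 \<longleftrightarrow> y = x j" if j: "j < n" and y: "y < n" for j y
      proof
        assume nz: "bump j (?l y) \<noteq> 0"
        obtain i where i: "i < n" "y = x i" using \<open>x ` {..<n} = {..<n}\<close> y by (metis imageE lessThan_iff)
        then show "y = x j" using bump_disjoint[OF nz] x(2)[OF i(1)] by auto
      qed (use x(2)[OF j] in simp)
      define \<beta> where "\<beta> j = of_real (bump (j mod n) (?l (x (j mod n)))) * \<sigma> (w (j mod n)) $$ (x (j mod n), x (Suc j mod n)) *
        of_real (bump (Suc j mod n) (?l (x (Suc j mod n))))" for j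
      define g where "g = (\<Prod>l<n. \<beta> l)\<^sup>2"
      have "s.acts_scalar (loop_sum n b) g \<and> s.acts_scalar (loop_trace n b a) (g * mtr (\<sigma> a))"
        unfolding b_def g_def by (rule loop_diagonal(2)[OF h rep D n kn bij nz \<beta>_def])
      moreover have "mtr (\<sigma> a) = of_real (Re (mtr (\<rho> a)))"
        using q.conj_mtr[OF U, of a] q.mtr_pi_real[OF a] by (simp add: \<sigma>_def)
      ultimately have "s.acts_scalar r (of_real ((cmod g)\<^sup>2 * (1 - Re (mtr (\<rho> a)) / e)))"
        unfolding r_def by (intro s.central_elt_scalar) auto
      then show ?thesis using bk kn by (metis zero_le_power2)
    qed
  qed
  have "matrix_rep.acts_scalar k \<rho> r 0" if "matrix_rep k \<rho>" "k < n" for k \<rho>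
    using dich[OF that(1)] that(2) by auto
  moreover have "\<exists>c\<ge>0. matrix_rep.acts_scalar n \<rho> r (of_real (c * (1 - Re (mtr (\<rho> a)) / e)))" if "matrix_rep n \<rho>" for \<rho>
    using dich[OF that] by (metis mult_zero_left of_real_0 order_refl)
  moreover have "p.acts_scalar r (of_real (1 - Re (mtr (\<pi> a)) / e))"
  proof -
    have D: "diagonal_mat (\<pi> h)" by (simp add: ph diagonal_mat_def)
    have l: "Re (\<pi> h $$ (y, y)) = real y" if "y < n" for y using that by (simp add: ph)
    have nz: "bump j (Re (\<pi> h $$ (y, y))) \<noteq> 0 \<longleftrightarrow> y = id j" if "j < n" "y < n" for j y
      using bump_disjoint[of j "real y" y] bump_self[of y] that l by auto
    have bt: "(1 :: complex) = of_real (bump (j mod n) (Re (\<pi> h $$ (id (j mod n), id (j mod n))))) *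
        \<pi> (w (j mod n)) $$ (id (j mod n), id (Suc j mod n)) *
        of_real (bump (Suc j mod n) (Re (\<pi> h $$ (id (Suc j mod n), id (Suc j mod n)))))" for j
      using n by (simp add: l bump_self w mod_Suc_eq)
    have "p.acts_scalar (loop_sum n b) ((\<Prod>l<n. 1)\<^sup>2) \<and> p.acts_scalar (loop_trace n b a) ((\<Prod>l<n. 1)\<^sup>2 * mtr (\<pi> a))"
      unfolding b_def by (rule loop_diagonal(2)[OF h p.matrix_rep_axioms D n refl bij_betw_id nz bt])
    then have "p.acts_scalar (loop_sum n b) 1" "p.acts_scalar (loop_trace n b a) (1 * of_real (Re (mtr (\<pi> a))))"
      using p.mtr_pi_real[OF a] by auto
    from p.central_elt_scalar[OF this] show ?thesis by (simp add: r_def)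
  qed
  ultimately show ?thesis using that sa by blast
qed

end

subsection \<open>Gluing along a central element\<close>

definition ramp :: "nat \<Rightarrow> nat \<Rightarrow> real \<Rightarrow> real"
  where "ramp k l t = min 1 (max 0 (real k * t - real l))"

lemma continuous_ramp: "continuous_on UNIV (ramp k l)"
  unfolding ramp_def by (intro continuous_intros)

lemma ramp_bounds: "0 \<le> ramp k l t" "ramp k l t \<le> 1"
  by (auto simp: ramp_def)

lemma sum_ramp:
  assumes "0 \<le> t" "t \<le> 1"
  shows "(\<Sum>l<k. ramp k l t) = real k * t"
proof -
  have "(\<Sum>l<m. min 1 (max 0 (y - real l))) = min y (real m)" if "y \<ge> 0" for y m
    using that by (induction m) auto
  from this[of "real k * t" k] show ?thesis
    using assms mult_left_le[of t "real k"] by (simp add: ramp_def)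
qed

lemma ramp_intermediate: "ramp k l t \<noteq> 0 \<Longrightarrow> ramp k l t \<noteq> 1 \<Longrightarrow> l = nat \<lfloor>real k * t\<rfloor>"
proof -
  assume "ramp k l t \<noteq> 0" "ramp k l t \<noteq> 1"
  then have "real l < real k * t" "real k * t < real l + 1" by (auto simp: ramp_def min_def max_def split: if_splits)
  then have "\<lfloor>real k * t\<rfloor> = int l" by (intro floor_unique) auto
  then show ?thesis by simp
qed

lemma expi_rep_cong: "matrix_rep n \<pi> \<Longrightarrow> \<pi> x = \<pi> y \<Longrightarrow> \<pi> (expi x) = \<pi> (expi y)"
  unfolding expi_def by (rule exp_rep_cong) (simp_all add: matrix_rep.scaleC)

text \<open>This evaluates the interpolating unitaries of the gluing argument at points where the
  image of each modified exponent is either zero or that of the original one.\<close>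

lemma expi_prod_rep_cong:
  assumes "matrix_rep n \<pi>" "\<And>h. h \<in> set hs \<Longrightarrow> \<pi> (f h) = \<pi> (g h)"
  shows "\<pi> (expi_prod (map f hs)) = \<pi> (expi_prod (map g hs))"
  using assms(2)
proof (induction hs)
  case (Cons h hs)
  then show ?case
    using expi_rep_cong[OF assms(1), of "f h" "g h"] by (simp add: expi_prod_def matrix_rep.mult[OF assms(1)])
qed simp

lemma expi_zero: "expi 0 = 1"
  by (simp add: expi_def)

lemma expi_prod_zero: "expi_prod (map (\<lambda>_. 0) hs) = 1"
  by (induction hs) (simp_all add: expi_prod_def expi_zero)

lemma (in matrix_rep) hs_norm_triangle_minus: "hs_norm n \<pi> (X - Y) \<le> hs_norm n \<pi> X + hs_norm n \<pi> Y"
  using hs_norm_triangle[of X "(-1) *\<^sub>R Y"] hs_norm_scaleR[of "-1" Y] by simp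

context subhom
begin

text \<open>The combination of \<open>X\<close> and \<open>Y\<close> with weight \<open>q\<close> is
  never formed in the algebra, where \<open>q\<close> need not be central. It is tested only in
  representations in which \<open>q\<close> is a scalar in [0, 1], with one \<open>W\<close> for all
  of them.\<close>

definition glued :: "'a ^ 'm \<Rightarrow> 'a \<Rightarrow> 'a ^ 'm \<Rightarrow> 'a ^ 'm \<Rightarrow> bool"
  where "glued B q X Y \<longleftrightarrow> (\<forall>e>0. \<exists>W\<in>orbit_hull B. \<forall>n \<pi> s. matrix_rep n \<pi> \<longrightarrow> n \<le> N \<longrightarrow> 0 \<le> s \<longrightarrow> s \<le> 1 \<longrightarrow>
    matrix_rep.acts_scalar n \<pi> q (of_real s) \<longrightarrow> hs_norm n \<pi> (W - ((1 - s) *\<^sub>R X + s *\<^sub>R Y)) \<le> e)"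

text \<open>
  The unitaries \<open>u t\<^sub>l\<close> interpolate between \<open>u\<close> and \<open>v\<close>, with a transition that takes place where
  \<open>q\<close> is between \<open>l/k\<close> and \<open>(l+1)/k\<close>. At each point at most one of the \<open>k\<close> transitions is active,
  so their average approximates \<open>(1 - q) X + q Y\<close> up to \<open>O(1/k)\<close>.
\<close>

lemma glued_base:
  fixes B :: "'a ^ 'm"
  assumes B: "sa_tuple B" and q: "self_adjoint q" and u: "u \<in> expi_group" and v: "v \<in> expi_group"
  shows "glued B q (conj_by u B) (conj_by v B)"
  unfolding glued_def
proof (intro allI impI)
  fix e :: real assume e: "e > 0"
  obtain hs where hs: "star u * v = expi_prod hs" "\<forall>h\<in>set hs. self_adjoint h"
    using expi_group_mult[OF expi_group_star[OF u] v] by (auto simp: expi_group_def)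
  \<comment> \<open>A bound for the error of a single transition. Averaging over k transitions, of
    which at most one is active, divides it by k.\<close>
  define K where "K = 2 * (sqrt N * norm B)"
  have K0: "K \<ge> 0" by (simp add: K_def)
  obtain k0 where "K / e < real k0" using reals_Archimedean2 by blast
  then have k0: "K < e * real k0" using e by (simp add: divide_less_eq mult.commute)
  define k where "k = Suc k0"
  have k: "k > 0" "K \<le> e * real k" using k0 e by (auto simp: k_def distrib_left)
  define G where "G l = real_calc (ramp k l) q" for l
  have saG: "self_adjoint (G l)" for l unfolding G_def by (rule real_calc_self_adjoint[OF q continuous_ramp])
  \<comment> \<open>The symmetrized product keeps the exponent self-adjoint, although
    \<open>G l\<close> and \<open>h\<close> need not commute; where \<open>G l\<close> acts as a
    scalar, it is the plain multiple of \<open>h\<close>.\<close>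
  define H where "H l h = (1/2) *\<^sub>R (G l * h + h * G l)" for l h
  have saH: "self_adjoint h \<Longrightarrow> self_adjoint (H l h)" for l h
    using saG[of l] by (simp add: H_def self_adjoint_def star_scaleR star_add star_mult add.commute)
  define T where "T l = expi_prod (map (H l) hs)" for l
  have TG: "T l \<in> expi_group" for l
    unfolding T_def expi_group_def using hs(2) saH by (auto intro!: exI[of _ "map (H l) hs"])
  define Z where "Z l = conj_by (u * T l) B" for l
  have Zh: "Z l \<in> orbit_hull B" for l
    unfolding Z_def by (intro orbit_hull_base expi_group_mult u TG)
  define W where "W = (\<Sum>l<k. (1 / real k) *\<^sub>R Z l)"
  have Wh: "W \<in> orbit_hull B"
    unfolding W_def by (rule convex_sum[OF _ convex_orbit_hull]) (use k Zh in auto)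
  let ?X = "conj_by u B" and ?Y = "conj_by v B"
  have "hs_norm n \<pi> (W - ((1 - s) *\<^sub>R ?X + s *\<^sub>R ?Y)) \<le> e"
    if rep: "matrix_rep n \<pi>" and nN: "n \<le> N" and s: "0 \<le> s" "s \<le> 1" and qs: "matrix_rep.acts_scalar n \<pi> q (of_real s)" for n \<pi> s
  proof -
    interpret matrix_rep n \<pi> by (rule rep)
    define g where "g l = ramp k l s" for l
    have Gs: "acts_scalar (G l) (of_real (g l))" for l
      unfolding G_def g_def by (rule real_calc_scalar[OF q continuous_ramp rep qs])
    have dG: "diagonal_mat (\<pi> (G l))" for l by (rule acts_scalar_diagonal[OF Gs])
    have H_entry: "\<pi> (H l h) = of_real (g l) \<cdot>\<^sub>m \<pi> h" for l h
      by (rule eq_matI)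
        (use Gs[of l] in \<open>auto simp: H_def entry_scaleR entry_add diagonal_mult[OF dG] acts_scalar_def\<close>)
    have uT0: "\<pi> (u * T l) = \<pi> u" if "g l = 0" for l
    proof -
      have "\<pi> (T l) = \<pi> (expi_prod (map (\<lambda>_. 0) hs))"
        unfolding T_def by (rule expi_prod_rep_cong[OF rep]) (auto simp: H_entry that zero intro!: eq_matI)
      then show ?thesis by (simp add: expi_prod_zero mult one right_mult_one_mat[OF carrier])
    qed
    have uT1: "\<pi> (u * T l) = \<pi> v" if "g l = 1" for l
    proof -
      have "\<pi> (T l) = \<pi> (expi_prod (map (\<lambda>h. h) hs))"
        unfolding T_def by (rule expi_prod_rep_cong[OF rep]) (auto simp: H_entry that intro!: eq_matI)
      then have "\<pi> (u * T l) = \<pi> (u * (star u * v))" by (simp add: mult hs(1))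
      also have "u * (star u * v) = v"
        using expi_group_unitary[OF u] by (simp add: unitary_def flip: mult.assoc)
      finally show ?thesis .
    qed
    define D where "D l = Z l - ((1 - g l) *\<^sub>R ?X + g l *\<^sub>R ?Y)" for l
    have conj_cong: "\<pi> (conj_by a B $ i) = \<pi> (conj_by c B $ i)" if "\<pi> a = \<pi> c" for a c i
      using that by (simp add: conj_by_def mult star)
    have D0: "hs_norm n \<pi> (D l) = 0" if "g l = 0 \<or> g l = 1" for l
    proof (rule hs_norm_zero)
      fix i
      have "\<pi> (Z l $ i) = \<pi> (if g l = 0 then ?X $ i else ?Y $ i)"
        unfolding Z_def using conj_cong[OF uT0] conj_cong[OF uT1] that by auto
      then show "\<pi> (D l $ i) = 0\<^sub>m n n"
        using that by (intro eq_matI) (auto simp: D_def entry_diff entry_add entry_scaleR)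
    qed
    have hB: "hs_norm n \<pi> B \<le> sqrt N * norm B"
      using hs_norm_bound[of B] nN by (meson norm_ge_zero mult_right_mono of_nat_mono order_trans real_sqrt_le_mono)
    have D1: "hs_norm n \<pi> (D l) \<le> K" for l
    proof -
      have g01: "0 \<le> g l" "g l \<le> 1" by (auto simp: g_def ramp_bounds)
      have hX: "hs_norm n \<pi> ?X \<le> hs_norm n \<pi> B" "hs_norm n \<pi> ?Y \<le> hs_norm n \<pi> B" "hs_norm n \<pi> (Z l) \<le> hs_norm n \<pi> B"
        using hs_norm_orbit_hull[OF B] orbit_hull_base u v Zh by blast+
      have "hs_norm n \<pi> (D l) \<le> hs_norm n \<pi> (Z l) + hs_norm n \<pi> ((1 - g l) *\<^sub>R ?X + g l *\<^sub>R ?Y)"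
        unfolding D_def by (rule hs_norm_triangle_minus)
      also have "hs_norm n \<pi> ((1 - g l) *\<^sub>R ?X + g l *\<^sub>R ?Y) \<le> (1 - g l) * hs_norm n \<pi> ?X + g l * hs_norm n \<pi> ?Y"
        using hs_norm_triangle[of "(1 - g l) *\<^sub>R ?X" "g l *\<^sub>R ?Y"] g01 by (simp add: hs_norm_scaleR)
      also have "\<dots> \<le> (1 - g l) * hs_norm n \<pi> B + g l * hs_norm n \<pi> B"
        using g01 hX by (intro add_mono mult_left_mono) auto
      also have "\<dots> = hs_norm n \<pi> B" by (simp add: algebra_simps)
      finally show ?thesis using hX(3) hB by (simp add: K_def)
    qed
    have "W - ((1 - s) *\<^sub>R ?X + s *\<^sub>R ?Y) = (1 / real k) *\<^sub>R (\<Sum>l<k. D l)"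
    proof -
      have sg: "(\<Sum>l<k. g l) = real k * s" unfolding g_def by (rule sum_ramp[OF s])
      have "(\<Sum>l<k. D l) = (\<Sum>l<k. Z l) - ((\<Sum>l<k. 1 - g l) *\<^sub>R ?X + (\<Sum>l<k. g l) *\<^sub>R ?Y)"
        by (simp only: D_def sum_subtractf[of Z] sum.distrib scaleR_left.sum)
      also have "(\<Sum>l<k. 1 - g l) = real k * (1 - s)" by (simp add: sum_subtractf sg algebra_simps)
      finally show ?thesis
        using k(1) by (simp add: sg W_def scaleR_right_diff_distrib scaleR_add_right scaleR_sum_right)
    qed
    then have "hs_norm n \<pi> (W - ((1 - s) *\<^sub>R ?X + s *\<^sub>R ?Y)) = (1 / real k) * hs_norm n \<pi> (\<Sum>l<k. D l)"
      by (simp only: hs_norm_scaleR) simp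
    also have "\<dots> \<le> (1 / real k) * K"
    proof (rule mult_left_mono)
      have "hs_norm n \<pi> (\<Sum>l<k. D l) \<le> (\<Sum>l<k. hs_norm n \<pi> (D l))" by (rule hs_norm_sum)
      also have "\<dots> \<le> (\<Sum>l<k. if l = nat \<lfloor>real k * s\<rfloor> then K else 0)"
      proof (rule sum_mono)
        fix l
        show "hs_norm n \<pi> (D l) \<le> (if l = nat \<lfloor>real k * s\<rfloor> then K else 0)"
        proof (cases "g l = 0 \<or> g l = 1")
          case True
          then show ?thesis using D0[OF True] K0 by simp
        next
          case False
          then have "l = nat \<lfloor>real k * s\<rfloor>" unfolding g_def by (intro ramp_intermediate) auto
          then show ?thesis using D1[of l] by simp
        qed
      qed
      also have "\<dots> \<le> K" using K0 by simp
      finally show "hs_norm n \<pi> (\<Sum>l<k. D l) \<le> K" .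
    qed simp
    also have "\<dots> \<le> e" using k by (simp add: divide_le_eq)
    finally show ?thesis .
  qed
  then show "\<exists>W\<in>orbit_hull B. \<forall>n \<pi> s. matrix_rep n \<pi> \<longrightarrow> n \<le> N \<longrightarrow> 0 \<le> s \<longrightarrow> s \<le> 1 \<longrightarrow>
    matrix_rep.acts_scalar n \<pi> q (of_real s) \<longrightarrow> hs_norm n \<pi> (W - ((1 - s) *\<^sub>R ?X + s *\<^sub>R ?Y)) \<le> e"
    using Wh by blast
qed

lemma glued_convex:
  fixes B :: "'a ^ 'm"
  assumes 1: "glued B q X1 Y1" and 2: "glued B q X2 Y2" and ab: "a \<ge> 0" "b \<ge> 0" "a + b = 1"
  shows "glued B q (a *\<^sub>R X1 + b *\<^sub>R X2) (a *\<^sub>R Y1 + b *\<^sub>R Y2)"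
  unfolding glued_def
proof (intro allI impI)
  fix e :: real assume e: "e > 0"
  obtain W1 where W1: "W1 \<in> orbit_hull B" "\<And>n \<pi> s. matrix_rep n \<pi> \<Longrightarrow> n \<le> N \<Longrightarrow> 0 \<le> s \<Longrightarrow> s \<le> 1 \<Longrightarrow>
      matrix_rep.acts_scalar n \<pi> q (of_real s) \<Longrightarrow> hs_norm n \<pi> (W1 - ((1 - s) *\<^sub>R X1 + s *\<^sub>R Y1)) \<le> e"
    using 1 e unfolding glued_def by blast
  obtain W2 where W2: "W2 \<in> orbit_hull B" "\<And>n \<pi> s. matrix_rep n \<pi> \<Longrightarrow> n \<le> N \<Longrightarrow> 0 \<le> s \<Longrightarrow> s \<le> 1 \<Longrightarrow>
      matrix_rep.acts_scalar n \<pi> q (of_real s) \<Longrightarrow> hs_norm n \<pi> (W2 - ((1 - s) *\<^sub>R X2 + s *\<^sub>R Y2)) \<le> e"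
    using 2 e unfolding glued_def by blast
  have "hs_norm n \<pi> (a *\<^sub>R W1 + b *\<^sub>R W2 - ((1 - s) *\<^sub>R (a *\<^sub>R X1 + b *\<^sub>R X2) + s *\<^sub>R (a *\<^sub>R Y1 + b *\<^sub>R Y2))) \<le> e"
    if h: "matrix_rep n \<pi>" "n \<le> N" "0 \<le> s" "s \<le> 1" "matrix_rep.acts_scalar n \<pi> q (of_real s)" for n \<pi> s
  proof -
    interpret matrix_rep n \<pi> by (rule h(1))
    have "a *\<^sub>R W1 + b *\<^sub>R W2 - ((1 - s) *\<^sub>R (a *\<^sub>R X1 + b *\<^sub>R X2) + s *\<^sub>R (a *\<^sub>R Y1 + b *\<^sub>R Y2)) =
        a *\<^sub>R (W1 - ((1 - s) *\<^sub>R X1 + s *\<^sub>R Y1)) + b *\<^sub>R (W2 - ((1 - s) *\<^sub>R X2 + s *\<^sub>R Y2))"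
      by (simp add: algebra_simps)
    then have "hs_norm n \<pi> (a *\<^sub>R W1 + b *\<^sub>R W2 - ((1 - s) *\<^sub>R (a *\<^sub>R X1 + b *\<^sub>R X2) + s *\<^sub>R (a *\<^sub>R Y1 + b *\<^sub>R Y2)))
        \<le> hs_norm n \<pi> (a *\<^sub>R (W1 - ((1 - s) *\<^sub>R X1 + s *\<^sub>R Y1))) + hs_norm n \<pi> (b *\<^sub>R (W2 - ((1 - s) *\<^sub>R X2 + s *\<^sub>R Y2)))"
      using hs_norm_triangle by metis
    also have "\<dots> \<le> a * e + b * e"
      unfolding hs_norm_scaleR using ab W1(2)[OF h] W2(2)[OF h] by (intro add_mono mult_mono) (auto simp: hs_norm_nonneg)
    also have "\<dots> = e" using ab by (simp flip: distrib_right)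
    finally show ?thesis .
  qed
  moreover have "a *\<^sub>R W1 + b *\<^sub>R W2 \<in> orbit_hull B"
    using convex_orbit_hull W1(1) W2(1) ab by (rule convexD)
  ultimately show "\<exists>W\<in>orbit_hull B. \<forall>n \<pi> s. matrix_rep n \<pi> \<longrightarrow> n \<le> N \<longrightarrow> 0 \<le> s \<longrightarrow> s \<le> 1 \<longrightarrow>
      matrix_rep.acts_scalar n \<pi> q (of_real s) \<longrightarrow>
      hs_norm n \<pi> (W - ((1 - s) *\<^sub>R (a *\<^sub>R X1 + b *\<^sub>R X2) + s *\<^sub>R (a *\<^sub>R Y1 + b *\<^sub>R Y2))) \<le> e"
    by blast
qed

text \<open>The relation is jointly convex in its two arguments. Writing the fixed argument as a
  convex combination of itself, one argument at a time is extended from the orbit to its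
  hull.\<close>

lemma glued_orbit_hull:
  fixes B :: "'a ^ 'm"
  assumes B: "sa_tuple B" and q: "self_adjoint q" and X: "X \<in> orbit_hull B" and Y: "Y \<in> orbit_hull B"
  shows "glued B q X Y"
proof -
  have e: "(Z :: 'a ^ 'm) = a *\<^sub>R Z + b *\<^sub>R Z" if "a + b = 1" for a b Z
    using that by (simp flip: scaleR_add_left)
  have 1: "glued B q (conj_by u B) Y" if u: "u \<in> expi_group" for u
  proof -
    have "orbit_hull B \<subseteq> {Y. glued B q (conj_by u B) Y}"
      unfolding orbit_hull_def
    proof (rule hull_minimal)
      show "convex {Y. glued B q (conj_by u B) Y}"
      proof (rule convexI)
        fix Y1 Y2 and a b :: real
        assume "Y1 \<in> {Y. glued B q (conj_by u B) Y}" "Y2 \<in> {Y. glued B q (conj_by u B) Y}" and ab: "0 \<le> a" "0 \<le> b" "a + b = 1"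
        then have "glued B q (a *\<^sub>R conj_by u B + b *\<^sub>R conj_by u B) (a *\<^sub>R Y1 + b *\<^sub>R Y2)"
          by (intro glued_convex) auto
        then show "a *\<^sub>R Y1 + b *\<^sub>R Y2 \<in> {Y. glued B q (conj_by u B) Y}"
          using e[OF ab(3), of "conj_by u B"] by simp
      qed
    qed (use glued_base[OF B q u] in auto)
    then show ?thesis using Y by blast
  qed
  have "orbit_hull B \<subseteq> {X. glued B q X Y}"
    unfolding orbit_hull_def
  proof (rule hull_minimal)
    show "convex {X. glued B q X Y}"
    proof (rule convexI)
      fix X1 X2 and a b :: real
      assume "X1 \<in> {X. glued B q X Y}" "X2 \<in> {X. glued B q X Y}" and ab: "0 \<le> a" "0 \<le> b" "a + b = 1"
      then have "glued B q (a *\<^sub>R X1 + b *\<^sub>R X2) (a *\<^sub>R Y + b *\<^sub>R Y)"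
        by (intro glued_convex) auto
      then show "a *\<^sub>R X1 + b *\<^sub>R X2 \<in> {X. glued B q X Y}"
        using e[OF ab(3), of Y] by simp
    qed
  qed (use 1 in auto)
  then show ?thesis using X by blast
qed

end

subsection \<open>Burnside's theorem for matrix representations\<close>

lemma mat_eqI_cols:
  fixes A B :: "complex mat"
  assumes A: "A \<in> carrier_mat n k" and B: "B \<in> carrier_mat n k"
    and eq: "\<And>c. c \<in> carrier_mat k 1 \<Longrightarrow> A * c = B * c"
  shows "A = B"
proof (rule eq_matI)
  fix i j assume "i < dim_row B" "j < dim_col B"
  then have ij: "i < n" "j < k" using B by auto
  define c where "c = mat k 1 (\<lambda>(l, _). if l = j then 1 else 0 :: complex)"
  have cc: "c \<in> carrier_mat k 1" by (simp add: c_def)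
  have "(M * c) $$ (i, 0) = M $$ (i, j)" if M: "M \<in> carrier_mat n k" for M
  proof -
    have "(M * c) $$ (i, 0) = (\<Sum>l<k. M $$ (i, l) * c $$ (l, 0))"
      by (rule mult_mat_index[OF M cc ij(1)]) simp
    also have "\<dots> = (\<Sum>l<k. if l = j then M $$ (i, j) else 0)"
      by (rule sum.cong) (auto simp: c_def)
    finally show ?thesis using ij by simp
  qed
  then show "A $$ (i, j) = B $$ (i, j)" using A B eq[OF cc] by metis
qed (use A B in auto)

text \<open>An invariant subspace of dimension k, given by an orthonormal basis: the product of
  \<open>V\<close> with its adjoint is the projection onto the subspace, and it fixes the range of
  each \<open>\<sigma> x * V\<close>.\<close>

definition invariant_isometry :: "nat \<Rightarrow> ('a::unital_cstar_algebra \<Rightarrow> complex mat) \<Rightarrow> nat \<Rightarrow> complex mat \<Rightarrow> bool"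
  where "invariant_isometry n \<sigma> k V \<longleftrightarrow> isometry_mat n k V \<and>
    (\<forall>x. V * (mat_adjoint V * (\<sigma> x * V)) = \<sigma> x * V)"

text \<open>Invariance allows the projection onto the range of \<open>V\<close> to be inserted
  between two factors, which makes the compression multiplicative.\<close>

lemma compression_rep:
  assumes rep: "matrix_rep n \<sigma>" and V: "invariant_isometry n \<sigma> k V"
  shows "matrix_rep k (\<lambda>x. mat_adjoint V * (\<sigma> x * V))"
proof -
  interpret matrix_rep n \<sigma> by (rule rep)
  have Vc: "V \<in> carrier_mat n k" and VV: "mat_adjoint V * V = 1\<^sub>m k"
    and inv: "\<And>x. V * (mat_adjoint V * (\<sigma> x * V)) = \<sigma> x * V"
    using V by (auto simp: invariant_isometry_def isometry_mat_def)
  have ac: "mat_adjoint V \<in> carrier_mat k n" using Vc by simp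
  have sV: "\<sigma> x * V \<in> carrier_mat n k" for x by (rule mult_carrier_mat[OF carrier Vc])
  have aV: "mat_adjoint V * (\<sigma> x * V) \<in> carrier_mat k k" for x by (rule mult_carrier_mat[OF ac sV])
  show ?thesis
  proof
    fix x y c
    show "mat_adjoint V * (\<sigma> x * V) \<in> carrier_mat k k" by (rule aV)
    show "mat_adjoint V * (\<sigma> (x + y) * V) = mat_adjoint V * (\<sigma> x * V) + mat_adjoint V * (\<sigma> y * V)"
      unfolding add add_mult_distrib_mat[OF carrier carrier Vc] by (rule mult_add_distrib_mat[OF ac sV sV])
    show "mat_adjoint V * (\<sigma> (c *\<^sub>C x) * V) = c \<cdot>\<^sub>m (mat_adjoint V * (\<sigma> x * V))"
      unfolding scaleC mult_smult_assoc_mat[OF carrier Vc] by (rule mult_smult_distrib[OF ac sV])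
    have "mat_adjoint V * (\<sigma> (x * y) * V) = mat_adjoint V * (\<sigma> x * (\<sigma> y * V))"
      unfolding mult by (simp only: assoc_mult_mat[OF carrier carrier Vc])
    also have "\<sigma> x * (\<sigma> y * V) = \<sigma> x * (V * (mat_adjoint V * (\<sigma> y * V)))" by (simp only: inv)
    also have "\<dots> = (\<sigma> x * V) * (mat_adjoint V * (\<sigma> y * V))" by (rule assoc_mult_mat[OF carrier Vc aV, symmetric])
    also have "mat_adjoint V * \<dots> = mat_adjoint V * (\<sigma> x * V) * (mat_adjoint V * (\<sigma> y * V))"
      by (rule assoc_mult_mat[OF ac sV aV, symmetric])
    finally show "mat_adjoint V * (\<sigma> (x * y) * V) = mat_adjoint V * (\<sigma> x * V) * (mat_adjoint V * (\<sigma> y * V))" .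
    show "mat_adjoint V * (\<sigma> (star x) * V) = mat_adjoint (mat_adjoint V * (\<sigma> x * V))"
      unfolding mat_adjoint_mult[OF ac sV] mat_adjoint_mult[OF carrier Vc] star mat_adjoint_adjoint
      by (rule assoc_mult_mat[OF ac mat_adjoint_carrier[OF carrier] Vc, symmetric])
    show "mat_adjoint V * (\<sigma> 1 * V) = 1\<^sub>m k"
      using left_mult_one_mat[OF Vc] VV by (simp add: one)
  qed
qed

definition two_sided_ideal :: "'a::unital_cstar_algebra set \<Rightarrow> bool"
  where "two_sided_ideal J \<longleftrightarrow> (\<forall>x\<in>J. \<forall>y\<in>J. x - y \<in> J) \<and> (\<forall>c. \<forall>x\<in>J. c *\<^sub>C x \<in> J) \<and>
    (\<forall>x\<in>J. \<forall>y. x * y \<in> J \<and> y * x \<in> J)"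

text \<open>
  If no proper invariant subspace supports the ideal, then the image of the ideal contains a
  projection \<open>E\<close> of minimal rank; it satisfies \<open>E \<rho>(t) E \<in> \<complex> E\<close>, and together with irreducibility
  this forces \<open>E\<close> to have rank one.
\<close>

locale supporting_ideal = matrix_rep k \<rho> for k and \<rho> :: "'a::unital_cstar_algebra \<Rightarrow> complex mat" +
  fixes J :: "'a set"
  assumes J: "two_sided_ideal J" and nz: "\<exists>b\<in>J. \<rho> b \<noteq> 0\<^sub>m k k"
    and minimal: "\<And>l V b. invariant_isometry k \<rho> l V \<Longrightarrow> b \<in> J \<Longrightarrow> \<rho> b * V \<noteq> 0\<^sub>m k l \<Longrightarrow> k \<le> l"
begin

lemma ideal_closed:
  "x \<in> J \<Longrightarrow> y \<in> J \<Longrightarrow> x - y \<in> J" "x \<in> J \<Longrightarrow> c *\<^sub>C x \<in> J" "x \<in> J \<Longrightarrow> x * y \<in> J" "x \<in> J \<Longrightarrow> y * x \<in> J"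
  using J by (auto simp: two_sided_ideal_def)

text \<open>The orbit of \<open>v\<close> under the algebra is an invariant subspace on which the
  ideal does not vanish, as \<open>p\<close> fixes \<open>v\<close>; by minimality it is the whole
  space.\<close>

lemma cyclic:
  assumes p: "p \<in> J" and v: "v \<in> carrier_mat k 1" "v \<noteq> 0\<^sub>m k 1" and pv: "\<rho> p * v = v" and w: "w \<in> carrier_mat k 1"
  obtains x where "\<rho> x * v = w"
proof -
  define T where "T = range (\<lambda>x. \<rho> x * v)"
  have Tc: "T \<subseteq> carrier_mat k 1" unfolding T_def using mult_carrier_mat[OF carrier v(1)] by auto
  have T: "col_subspace k T"
    unfolding col_subspace_def
  proof (intro conjI ballI allI Tc)
    show "0\<^sub>m k 1 \<in> T" unfolding T_def using left_mult_zero_mat[OF v(1), of k] zero by (metis rangeI)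
    fix s t assume "s \<in> T" "t \<in> T"
    then obtain x y where "s = \<rho> x * v" "t = \<rho> y * v" by (auto simp: T_def)
    then have "s + t = \<rho> (x + y) * v" by (simp add: add add_mult_distrib_mat[OF carrier carrier v(1)])
    then show "s + t \<in> T" by (simp add: T_def)
  next
    fix c t assume "t \<in> T"
    then obtain x where "t = \<rho> x * v" by (auto simp: T_def)
    then have "c \<cdot>\<^sub>m t = \<rho> (c *\<^sub>C x) * v" by (simp only: scaleC mult_smult_assoc_mat[OF carrier v(1)])
    then show "c \<cdot>\<^sub>m t \<in> T" by (simp add: T_def)
  qed
  obtain l V where V: "isometry_mat k l V" and VT: "\<And>c. c \<in> carrier_mat l 1 \<Longrightarrow> V * c \<in> T"
    and Vt: "\<And>t. t \<in> T \<Longrightarrow> V * (mat_adjoint V * t) = t"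
    using orthonormal_basis[OF T] by metis
  have Vc: "V \<in> carrier_mat k l" using V by (simp add: isometry_mat_def)
  have ac: "mat_adjoint V \<in> carrier_mat l k" using Vc by simp
  have inv: "invariant_isometry k \<rho> l V"
    unfolding invariant_isometry_def
  proof (intro conjI V allI)
    fix x
    have rV: "\<rho> x * V \<in> carrier_mat k l" by (rule mult_carrier_mat[OF carrier Vc])
    show "V * (mat_adjoint V * (\<rho> x * V)) = \<rho> x * V"
    proof (rule mat_eqI_cols[OF mult_carrier_mat[OF Vc mult_carrier_mat[OF ac rV]] rV])
      fix c :: "complex mat" assume c: "c \<in> carrier_mat l 1"
      obtain y where y: "V * c = \<rho> y * v" using VT[OF c] by (auto simp: T_def)
      have "\<rho> x * V * c = \<rho> x * (\<rho> y * v)" using assoc_mult_mat[OF carrier Vc c] y by simp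
      also have "\<dots> = \<rho> (x * y) * v" by (simp only: mult assoc_mult_mat[OF carrier carrier v(1)])
      finally have "\<rho> x * V * c \<in> T" by (simp add: T_def)
      from Vt[OF this] show "V * (mat_adjoint V * (\<rho> x * V)) * c = \<rho> x * V * c"
        using assoc_mult_mat[OF Vc mult_carrier_mat[OF ac rV] c] assoc_mult_mat[OF ac rV c] by simp
    qed
  qed
  have vT: "v \<in> T" unfolding T_def using left_mult_one_mat[OF v(1)] one by (metis rangeI)
  have "\<rho> p * V \<noteq> 0\<^sub>m k l"
  proof
    assume z: "\<rho> p * V = 0\<^sub>m k l"
    have avc: "mat_adjoint V * v \<in> carrier_mat l 1" by (rule mult_carrier_mat[OF ac v(1)])
    have "\<rho> p * v = \<rho> p * (V * (mat_adjoint V * v))" using Vt[OF vT] by simp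
    also have "\<dots> = \<rho> p * V * (mat_adjoint V * v)" by (rule assoc_mult_mat[OF carrier Vc avc, symmetric])
    also have "\<dots> = 0\<^sub>m k 1" unfolding z by (rule left_mult_zero_mat[OF avc])
    finally show False using pv v(2) by simp
  qed
  then have "k \<le> l" using minimal[OF inv p] by blast
  then have "l = k" using isometry_defect(1)[OF V] by simp
  then have "V * mat_adjoint V = 1\<^sub>m k" using isometry_mat_square V by (auto simp: unitary_mat_def)
  then have "w = V * (mat_adjoint V * w)"
    using assoc_mult_mat[OF Vc ac w] left_mult_one_mat[OF w] by simp
  also have "\<dots> \<in> T" by (rule VT[OF mult_carrier_mat[OF ac w]])
  finally show ?thesis using that by (auto simp: T_def)
qed

text \<open>The rank as seen in a chosen basis that diagonalizes \<open>x\<close>. The minimum is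
  later taken over all pairs of an element of the ideal and such a basis.\<close>

definition diag_rank :: "'a \<Rightarrow> complex mat \<Rightarrow> nat"
  where "diag_rank x U = card {j. j < k \<and> (mat_adjoint U * \<rho> x * U) $$ (j, j) \<noteq> 0}"

definition diag_pair :: "'a \<Rightarrow> complex mat \<Rightarrow> bool"
  where "diag_pair x U \<longleftrightarrow> x \<in> J \<and> unitary_mat k U \<and> diagonal_mat (mat_adjoint U * \<rho> x * U)"

lemma diag_pair_zero:
  assumes "diag_pair x U" "diag_rank x U = 0"
  shows "\<rho> x = 0\<^sub>m k k"
proof -
  have U: "unitary_mat k U" and D: "diagonal_mat (mat_adjoint U * \<rho> x * U)"
    using assms(1) by (auto simp: diag_pair_def)
  define \<rho>1 where "\<rho>1 x = mat_adjoint U * \<rho> x * U" for x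
  have r1: "\<rho>1 = (\<lambda>x. mat_adjoint U * \<rho> x * U)" by (simp add: \<rho>1_def fun_eq_iff)
  interpret r1: matrix_rep k \<rho>1 unfolding r1 by (rule conj_rep[OF U])
  have "\<forall>j<k. \<rho>1 x $$ (j, j) = 0"
    using assms(2) unfolding diag_rank_def \<rho>1_def[symmetric] by simp
  moreover have "diagonal_mat (\<rho>1 x)" using D by (simp only: \<rho>1_def)
  ultimately have "r1.acts_scalar x 0" by (auto simp: r1.acts_scalar_def diagonal_mat_def)
  then have "acts_scalar x 0" unfolding r1 by (rule acts_scalar_conj[OF matrix_rep_axioms U])
  then show ?thesis by (auto simp: acts_scalar_iff intro!: eq_matI)
qed

lemma minimal_projection:
  obtains e where "e \<in> J" "\<rho> e \<noteq> 0\<^sub>m k k" "\<rho> (star e) = \<rho> e" "\<rho> (e * e) = \<rho> e"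
    "\<And>t. \<exists>c. \<rho> (e * t * e) = c \<cdot>\<^sub>m \<rho> e"
proof -
  have "\<exists>x U. diag_pair x U \<and> diag_rank x U \<noteq> 0"
  proof -
    obtain b where b: "b \<in> J" "\<rho> b \<noteq> 0\<^sub>m k k" using nz by blast
    obtain U where U: "unitary_mat k U" "diagonal_mat (mat_adjoint U * \<rho> (star b * b) * U)"
      using diagonalize_single[OF self_adjoint_intros(7)] by blast
    have p: "diag_pair (star b * b) U" using U b ideal_closed(4) by (simp add: diag_pair_def)
    have "\<rho> (star b * b) \<noteq> 0\<^sub>m k k"
      using adjoint_mult_eq_0[OF carrier] b(2) by (auto simp: mult star)
    then show ?thesis using diag_pair_zero[OF p] p by blast
  qed
  then obtain r0 where "\<exists>x U. diag_pair x U \<and> diag_rank x U = r0 \<and> r0 \<noteq> 0" by blast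
  then have ex: "\<exists>r. r \<noteq> 0 \<and> (\<exists>x U. diag_pair x U \<and> diag_rank x U = r)" by blast
  define r where "r = (LEAST r. r \<noteq> 0 \<and> (\<exists>x U. diag_pair x U \<and> diag_rank x U = r))"
  have r: "r \<noteq> 0" "\<exists>x U. diag_pair x U \<and> diag_rank x U = r"
    using LeastI_ex[OF ex] by (auto simp: r_def)
  have least: "\<rho> x = 0\<^sub>m k k" if "diag_pair x U" "diag_rank x U < r" for x U
  proof -
    have "\<not> (diag_rank x U \<noteq> 0 \<and> (\<exists>y W. diag_pair y W \<and> diag_rank y W = diag_rank x U))"
      using not_less_Least that(2) unfolding r_def by blast
    then show ?thesis using that(1) diag_pair_zero[OF that(1)] by blast
  qed
  obtain p U where pU: "diag_pair p U" "diag_rank p U = r" using r by blast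
  have pJ: "p \<in> J" and U: "unitary_mat k U" and D: "diagonal_mat (mat_adjoint U * \<rho> p * U)"
    using pU by (auto simp: diag_pair_def)
  define \<rho>1 where "\<rho>1 x = mat_adjoint U * \<rho> x * U" for x
  have "\<rho>1 = (\<lambda>x. mat_adjoint U * \<rho> x * U)" by (simp add: \<rho>1_def fun_eq_iff)
  then interpret r1: matrix_rep k \<rho>1 using conj_rep[OF U] by simp
  have tr1: "mtr (\<rho>1 x) = mtr (\<rho> x)" for x unfolding \<rho>1_def by (rule conj_mtr[OF U])
  have D1: "diagonal_mat (\<rho>1 p)" using D by (simp only: \<rho>1_def)
  have eq1: "\<rho> x = \<rho> y" if "\<rho>1 x = \<rho>1 y" for x y
    using conj_inverse[OF U] that unfolding \<rho>1_def by metis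
  have eq0: "\<rho>1 x = 0\<^sub>m k k" if "\<rho> x = 0\<^sub>m k k" for x
  proof -
    have "\<rho> x = \<rho> 0" using that by (simp add: zero)
    then have "\<rho>1 x = \<rho>1 0" by (simp only: \<rho>1_def)
    then show ?thesis by (simp only: r1.zero)
  qed
  have "{j. j < k \<and> \<rho>1 p $$ (j, j) \<noteq> 0} \<noteq> {}"
  proof
    assume "{j. j < k \<and> \<rho>1 p $$ (j, j) \<noteq> 0} = {}"
    then have "diag_rank p U = 0" unfolding diag_rank_def \<rho>1_def[symmetric] by simp
    then show False using pU r by simp
  qed
  then obtain j0 where j0: "j0 < k" "\<rho>1 p $$ (j0, j0) \<noteq> 0" by blast
  define l where "l = \<rho>1 p $$ (j0, j0)"
  have m01: "\<rho>1 p $$ (j, j) = 0 \<or> \<rho>1 p $$ (j, j) = l" if j: "j < k" for j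
  proof -
    \<comment> \<open>This polynomial in \<open>p\<close> vanishes at the eigenvalue
      \<open>l\<close> and at 0, so it has smaller rank than \<open>p\<close> and is zero. Hence
      \<open>p\<close> is \<open>l\<close> times a projection.\<close>
    define q where "q = p * p - l *\<^sub>C p"
    have qe: "\<rho>1 q $$ (i, j) = (if i = j then \<rho>1 p $$ (i, i) * (\<rho>1 p $$ (i, i) - l) else 0)" if "i < k" "j < k" for i j
      using D1 that by (auto simp: q_def r1.entry_diff r1.entry_scaleC r1.diagonal_mult[OF D1] diagonal_mat_def algebra_simps)
    have "diag_pair q U"
      unfolding diag_pair_def \<rho>1_def[symmetric]
    proof (intro conjI U)
      show "q \<in> J" unfolding q_def using pJ by (intro ideal_closed)
      show "diagonal_mat (\<rho>1 q)"
        unfolding diagonal_mat_def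
      proof (intro allI impI)
        fix i j assume "i < dim_row (\<rho>1 q)" "j < dim_col (\<rho>1 q)" "i \<noteq> j"
        then have "i < k" "j < k" "i \<noteq> j" by simp_all
        then show "\<rho>1 q $$ (i, j) = 0" by (simp only: qe if_False)
      qed
    qed
    moreover have "diag_rank q U < r"
    proof -
      have "{j. j < k \<and> \<rho>1 q $$ (j, j) \<noteq> 0} \<subset> {j. j < k \<and> \<rho>1 p $$ (j, j) \<noteq> 0}"
      proof
        show "{j. j < k \<and> \<rho>1 q $$ (j, j) \<noteq> 0} \<subseteq> {j. j < k \<and> \<rho>1 p $$ (j, j) \<noteq> 0}"
        proof
          fix j assume "j \<in> {j. j < k \<and> \<rho>1 q $$ (j, j) \<noteq> 0}"
          then have j: "j < k" "\<rho>1 q $$ (j, j) \<noteq> 0" by auto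
          then show "j \<in> {j. j < k \<and> \<rho>1 p $$ (j, j) \<noteq> 0}" using qe[OF j(1) j(1)] by auto
        qed
        have "\<rho>1 q $$ (j0, j0) = 0" using qe[OF j0(1) j0(1)] by (simp add: l_def)
        then show "{j. j < k \<and> \<rho>1 q $$ (j, j) \<noteq> 0} \<noteq> {j. j < k \<and> \<rho>1 p $$ (j, j) \<noteq> 0}"
          using j0 by blast
      qed
      then show ?thesis
        unfolding pU(2)[symmetric] diag_rank_def \<rho>1_def[symmetric] by (intro psubset_card_mono) auto
    qed
    ultimately have "\<rho>1 q = 0\<^sub>m k k" using least eq0 by blast
    then show ?thesis using qe[OF j j] j by auto
  qed
  have l0: "l \<noteq> 0" using j0 by (simp add: l_def)
  define e where "e = inverse l *\<^sub>C p"
  have eJ: "e \<in> J" unfolding e_def by (rule ideal_closed(2)[OF pJ])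
  have e1: "\<rho>1 e $$ (i, j) = (if i = j \<and> \<rho>1 p $$ (i, i) \<noteq> 0 then 1 else 0)" if "i < k" "j < k" for i j
    using D1 m01[OF that(1)] l0 that by (auto simp: e_def r1.entry_scaleC diagonal_mat_def)
  have De: "diagonal_mat (\<rho>1 e)" by (auto simp: diagonal_mat_def e1)
  have star_e: "\<rho> (star e) = \<rho> e"
    by (rule eq1, rule eq_matI) (auto simp: r1.entry_star e1)
  have ee: "\<rho> (e * e) = \<rho> e"
    by (rule eq1, rule eq_matI) (auto simp: r1.diagonal_mult[OF De] e1)
  have tre: "mtr (\<rho> e) = of_nat r"
  proof -
    have "mtr (\<rho> e) = (\<Sum>j<k. if \<rho>1 p $$ (j, j) \<noteq> 0 then 1 else 0)"
      unfolding tr1[symmetric] mtr_carrier[OF r1.carrier] by (rule sum.cong) (auto simp: e1)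
    also have "\<dots> = of_nat (card {j. j < k \<and> \<rho>1 p $$ (j, j) \<noteq> 0})"
      by (simp add: sum.If_cases Int_def)
    also have "\<dots> = of_nat r"
      using pU(2) unfolding diag_rank_def \<rho>1_def[symmetric] by simp
    finally show ?thesis .
  qed
  have e0: "\<rho> e \<noteq> 0\<^sub>m k k"
  proof
    assume "\<rho> e = 0\<^sub>m k k"
    then have "mtr (\<rho> e) = 0" by (simp add: mtr_def)
    then show False using tre r(1) by simp
  qed
  have sa_case: "\<exists>c. \<rho> (e * t * e) = c \<cdot>\<^sub>m \<rho> e" if t: "self_adjoint t" for t
  proof -
    define y where "y = e * t * e"
    have ry: "\<rho> (star y) = \<rho> y"
      using t star_e by (simp add: y_def star_mult mult self_adjoint_def assoc_mult_mat[OF carrier carrier carrier])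
    have ey: "\<rho> (e * y) = \<rho> y" "\<rho> (y * e) = \<rho> y"
    proof -
      have "\<rho> (e * y) = \<rho> (e * e) * \<rho> (t * e)" by (simp add: y_def mult[symmetric] mult.assoc)
      then show "\<rho> (e * y) = \<rho> y" by (simp add: ee) (simp add: y_def mult[symmetric] mult.assoc)
      have "\<rho> (y * e) = \<rho> (e * t) * \<rho> (e * e)" by (simp add: y_def mult[symmetric] mult.assoc)
      then show "\<rho> (y * e) = \<rho> y" by (simp add: ee) (simp add: y_def mult[symmetric] mult.assoc)
    qed
    obtain W where W: "unitary_mat k W"
      and DW: "\<And>b. b \<in> UNIV \<Longrightarrow> diagonal_mat (mat_adjoint W * \<rho> (if b then e else y) * W)"
    proof (rule joint_diagonalization[of "UNIV :: bool set" "\<lambda>b. \<rho> (if b then e else y)" k])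
      fix b c :: bool
      show "mat_adjoint (\<rho> (if b then e else y)) = \<rho> (if b then e else y)"
        using star_e ry by (simp add: star[symmetric])
      show "\<rho> (if b then e else y) * \<rho> (if c then e else y) = \<rho> (if c then e else y) * \<rho> (if b then e else y)"
        using ey by (simp add: mult[symmetric])
    qed auto
    define \<rho>2 where "\<rho>2 x = mat_adjoint W * \<rho> x * W" for x
    have "\<rho>2 = (\<lambda>x. mat_adjoint W * \<rho> x * W)" by (simp add: \<rho>2_def fun_eq_iff)
    then interpret r2: matrix_rep k \<rho>2 using conj_rep[OF W] by simp
    have DE: "diagonal_mat (\<rho>2 e)" and DY: "diagonal_mat (\<rho>2 y)"
      using DW[of True] DW[of False] by (simp_all add: \<rho>2_def)
    have c2: "\<rho>2 x = \<rho>2 z" if "\<rho> x = \<rho> z" for x z using that by (simp only: \<rho>2_def)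
    have E01: "\<rho>2 e $$ (j, j) = 0 \<or> \<rho>2 e $$ (j, j) = 1" if j: "j < k" for j
    proof -
      have "\<rho>2 e $$ (j, j) * \<rho>2 e $$ (j, j) = \<rho>2 e $$ (j, j)"
        using c2[OF ee] r2.diagonal_mult(1)[OF DE j j, of e] by simp
      then show ?thesis by simp
    qed
    \<comment> \<open>The new basis need not be the one that realized the minimal rank; the trace of
      the projection shows that the rank is still \<open>r\<close>.\<close>
    have card_E: "card {j. j < k \<and> \<rho>2 e $$ (j, j) \<noteq> 0} = r"
    proof -
      have "mtr (\<rho>2 e) = (\<Sum>j<k. if \<rho>2 e $$ (j, j) \<noteq> 0 then 1 else 0)"
        unfolding mtr_carrier[OF r2.carrier] by (rule sum.cong) (use E01 in force)+
      also have "\<dots> = of_nat (card {j. j < k \<and> \<rho>2 e $$ (j, j) \<noteq> 0})"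
        by (simp add: sum.If_cases Int_def)
      finally have "of_nat (card {j. j < k \<and> \<rho>2 e $$ (j, j) \<noteq> 0}) = (of_nat r :: complex)"
        using tre conj_mtr[OF W, of e] by (simp add: \<rho>2_def)
      then show ?thesis using of_nat_eq_iff by blast
    qed
    then have "{j. j < k \<and> \<rho>2 e $$ (j, j) \<noteq> 0} \<noteq> {}" using r(1) by (metis card.empty)
    then obtain j1 where j1: "j1 < k" "\<rho>2 e $$ (j1, j1) \<noteq> 0" by blast
    then have j1': "\<rho>2 e $$ (j1, j1) = 1" using E01 by blast
    define \<nu> where "\<nu> = \<rho>2 y $$ (j1, j1)"
    \<comment> \<open>Subtracting an eigenvalue of \<open>y\<close> on the range of \<open>e\<close>
      lowers the rank again, so minimality forces \<open>y\<close> to be a multiple of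
      \<open>e\<close>.\<close>
    define z where "z = y - \<nu> *\<^sub>C e"
    have ze: "\<rho>2 z $$ (i, j) = \<rho>2 y $$ (i, j) - \<nu> * \<rho>2 e $$ (i, j)" if "i < k" "j < k" for i j
      using that by (simp add: z_def r2.entry_diff r2.entry_scaleC)
    have yE: "\<rho>2 y $$ (j, j) = \<rho>2 e $$ (j, j) * \<rho>2 y $$ (j, j)" if "j < k" for j
      using c2[OF ey(1)] r2.diagonal_mult(1)[OF DE that that, of y] by simp
    have "diag_pair z W"
      unfolding diag_pair_def \<rho>2_def[symmetric]
    proof (intro conjI W)
      have "y \<in> J" unfolding y_def using eJ ideal_closed by blast
      then show "z \<in> J" unfolding z_def using eJ ideal_closed by blast
      show "diagonal_mat (\<rho>2 z)" using DE DY by (auto simp: diagonal_mat_def ze)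
    qed
    moreover have "diag_rank z W < r"
    proof -
      have "{j. j < k \<and> \<rho>2 z $$ (j, j) \<noteq> 0} \<subset> {j. j < k \<and> \<rho>2 e $$ (j, j) \<noteq> 0}"
      proof
        show "{j. j < k \<and> \<rho>2 z $$ (j, j) \<noteq> 0} \<subseteq> {j. j < k \<and> \<rho>2 e $$ (j, j) \<noteq> 0}"
        proof
          fix j assume "j \<in> {j. j < k \<and> \<rho>2 z $$ (j, j) \<noteq> 0}"
          then have j: "j < k" "\<rho>2 z $$ (j, j) \<noteq> 0" by auto
          have "\<rho>2 e $$ (j, j) \<noteq> 0"
          proof
            assume e0: "\<rho>2 e $$ (j, j) = 0"
            then have "\<rho>2 y $$ (j, j) = 0" using yE[OF j(1)] by (metis mult_zero_left)
            then show False using j e0 by (simp add: ze)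
          qed
          then show "j \<in> {j. j < k \<and> \<rho>2 e $$ (j, j) \<noteq> 0}" using j by simp
        qed
        have "\<rho>2 z $$ (j1, j1) = 0" using j1 j1' by (simp add: ze \<nu>_def)
        then show "{j. j < k \<and> \<rho>2 z $$ (j, j) \<noteq> 0} \<noteq> {j. j < k \<and> \<rho>2 e $$ (j, j) \<noteq> 0}"
          using j1 by blast
      qed
      then show ?thesis
        unfolding card_E[symmetric] diag_rank_def \<rho>2_def[symmetric] by (intro psubset_card_mono) auto
    qed
    ultimately have z0: "\<rho> z = 0\<^sub>m k k" using least by blast
    have "\<rho> y = \<nu> \<cdot>\<^sub>m \<rho> e"
    proof (rule eq_matI)
      fix i j assume "i < dim_row (\<nu> \<cdot>\<^sub>m \<rho> e)" "j < dim_col (\<nu> \<cdot>\<^sub>m \<rho> e)"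
      then have ij: "i < k" "j < k" by auto
      then have "\<rho> z $$ (i, j) = 0" by (simp add: z0)
      then show "\<rho> y $$ (i, j) = (\<nu> \<cdot>\<^sub>m \<rho> e) $$ (i, j)"
        using ij by (simp add: z_def entry_diff entry_scaleC)
    qed auto
    then show ?thesis by (auto simp: y_def)
  qed
  have "\<exists>c. \<rho> (e * t * e) = c \<cdot>\<^sub>m \<rho> e" for t
  proof -
    \<comment> \<open>Reduction to the self-adjoint case, which was needed for joint diagonalization
      with \<open>e\<close>.\<close>
    define a b where "a = t + star t" and "b = \<i> *\<^sub>C (t - star t)"
    have "self_adjoint a" "self_adjoint b"
      by (simp_all add: a_def b_def self_adjoint_def star_scaleC star_add star_diff star_star add.commute
          scaleC_diff_right scaleC_minus_left)
    then obtain c d where cd: "\<rho> (e * a * e) = c \<cdot>\<^sub>m \<rho> e" "\<rho> (e * b * e) = d \<cdot>\<^sub>m \<rho> e" using sa_case by metis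
    have "t = (1/2) *\<^sub>R (a + (- \<i>) *\<^sub>C b)"
    proof -
      have "(- \<i>) *\<^sub>C b = t - star t" by (simp add: b_def scaleC_scaleC)
      then have "a + (- \<i>) *\<^sub>C b = 2 *\<^sub>R t" by (simp add: a_def scaleR_2)
      then show ?thesis by simp
    qed
    then have "e * t * e = (1/2) *\<^sub>R (e * a * e + (- \<i>) *\<^sub>C (e * b * e))"
      by (metis (no_types, lifting) distrib_left distrib_right mult_scaleC_left mult_scaleC_right mult_scaleR_left mult_scaleR_right)
    then have eq: "\<rho> (e * t * e) = \<rho> ((1/2) *\<^sub>R (e * a * e + (- \<i>) *\<^sub>C (e * b * e)))" by (simp only:)
    have "\<rho> (e * t * e) = (of_real (1/2) * (c + (- \<i>) * d)) \<cdot>\<^sub>m \<rho> e"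
    proof (rule eq_matI)
      fix i j assume "i < dim_row ((of_real (1/2) * (c + (- \<i>) * d)) \<cdot>\<^sub>m \<rho> e)"
        "j < dim_col ((of_real (1/2) * (c + (- \<i>) * d)) \<cdot>\<^sub>m \<rho> e)"
      then have ij: "i < k" "j < k" by auto
      have "\<rho> (e * a * e) $$ (i, j) = c * \<rho> e $$ (i, j)" "\<rho> (e * b * e) $$ (i, j) = d * \<rho> e $$ (i, j)"
        using ij by (simp_all add: cd)
      then have "\<rho> (e * t * e) $$ (i, j) = of_real (1/2) * (c * \<rho> e $$ (i, j) + (- \<i>) * (d * \<rho> e $$ (i, j)))"
        by (simp only: eq entry_scaleR[OF ij] entry_add[OF ij] entry_scaleC[OF ij])
      then show "\<rho> (e * t * e) $$ (i, j) = ((of_real (1/2) * (c + (- \<i>) * d)) \<cdot>\<^sub>m \<rho> e) $$ (i, j)"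
        using ij by (simp add: ring_distribs)
    qed auto
    then show ?thesis by blast
  qed
  then show ?thesis using that eJ e0 star_e ee by blast
qed

text \<open>A minimal projection that has a cyclic vector \<open>v\<close> in its range is the
  rank-one projection onto \<open>v\<close>. Multiplying it on both sides by elements that send
  \<open>v\<close> to basis vectors produces all matrix units.\<close>

lemma onto: "rep_onto_matrix_algebra k \<rho>"
proof -
  obtain e where e: "e \<in> J" "\<rho> e \<noteq> 0\<^sub>m k k" "\<rho> (star e) = \<rho> e" "\<rho> (e * e) = \<rho> e"
    and ete: "\<And>t. \<exists>c. \<rho> (e * t * e) = c \<cdot>\<^sub>m \<rho> e" using minimal_projection by metis
  obtain w where w: "w \<in> carrier_mat k 1" "\<rho> e * w \<noteq> 0\<^sub>m k 1"
  proof -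
    have "\<exists>w\<in>carrier_mat k 1. \<rho> e * w \<noteq> 0\<^sub>m k k * w"
      using mat_eqI_cols[OF carrier zero_carrier_mat] e(2) by blast
    then obtain w where "w \<in> carrier_mat k 1" "\<rho> e * w \<noteq> 0\<^sub>m k k * w" by blast
    then show ?thesis using that left_mult_zero_mat[of w k 1 k] by metis
  qed
  have ewc: "\<rho> e * w \<in> carrier_mat k 1" by (rule mult_carrier_mat[OF carrier w(1)])
  obtain d where d: "d \<noteq> 0" "mat_adjoint (d \<cdot>\<^sub>m (\<rho> e * w)) * (d \<cdot>\<^sub>m (\<rho> e * w)) = 1\<^sub>m 1"
    using normalize_col[OF ewc w(2)] .
  define v where "v = d \<cdot>\<^sub>m (\<rho> e * w)"
  have vc: "v \<in> carrier_mat k 1" and vv: "mat_adjoint v * v = 1\<^sub>m 1" using ewc d by (auto simp: v_def)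
  have va: "mat_adjoint v \<in> carrier_mat 1 k" using vc by simp
  have v0: "v \<noteq> 0\<^sub>m k 1"
  proof
    assume "v = 0\<^sub>m k 1"
    then have "mat_adjoint v * v = 0\<^sub>m 1 1" using right_mult_zero_mat[OF va] by simp
    then have "(1\<^sub>m 1 :: complex mat) $$ (0, 0) = 0\<^sub>m 1 1 $$ (0, 0)" using vv by simp
    then show False by simp
  qed
  have ev: "\<rho> e * v = v"
  proof -
    have "\<rho> e * v = d \<cdot>\<^sub>m (\<rho> e * (\<rho> e * w))" unfolding v_def by (rule mult_smult_distrib[OF carrier ewc])
    also have "\<rho> e * (\<rho> e * w) = \<rho> (e * e) * w" by (simp only: mult assoc_mult_mat[OF carrier carrier w(1)])
    finally show ?thesis by (simp add: e(4) v_def)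
  qed
  have cyc: "\<exists>x. \<rho> x * v = u" if "u \<in> carrier_mat k 1" for u
    using cyclic[OF e(1) vc v0 ev that] by metis
  have vvc: "v * mat_adjoint v \<in> carrier_mat k k" using vc by simp
  \<comment> \<open>Each vector u is \<open>\<rho> x * v\<close> for some \<open>x\<close>. With c
    the scalar to which \<open>e\<close> compresses \<open>x\<close>, both sides send u to c
    v.\<close>
  have E: "\<rho> e = v * mat_adjoint v"
  proof (rule mat_eqI_cols[OF carrier vvc])
    fix u :: "complex mat" assume u: "u \<in> carrier_mat k 1"
    have euc: "\<rho> e * u \<in> carrier_mat k 1" by (rule mult_carrier_mat[OF carrier u])
    obtain x where x: "\<rho> x * v = u" using cyc[OF u] by blast
    obtain c where c: "\<rho> (e * x * e) = c \<cdot>\<^sub>m \<rho> e" using ete by blast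
    have "\<rho> e * u = \<rho> e * (\<rho> x * (\<rho> e * v))" by (simp only: x ev)
    also have "\<dots> = \<rho> (e * x) * (\<rho> e * v)"
      unfolding mult[of e x] by (rule assoc_mult_mat[OF carrier carrier mult_carrier_mat[OF carrier vc], symmetric])
    also have "\<dots> = \<rho> (e * x * e) * v"
      unfolding mult[of "e * x" e] by (rule assoc_mult_mat[OF carrier carrier vc, symmetric])
    also have "\<dots> = c \<cdot>\<^sub>m v" unfolding c mult_smult_assoc_mat[OF carrier vc] ev ..
    finally have eu: "\<rho> e * u = c \<cdot>\<^sub>m v" .
    have "mat_adjoint v * u = mat_adjoint (\<rho> e * v) * u" by (simp only: ev)
    also have "\<dots> = mat_adjoint v * (\<rho> e * u)"
      unfolding mat_adjoint_mult[OF carrier vc] star[symmetric] e(3) by (rule assoc_mult_mat[OF va carrier u])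
    also have "\<dots> = c \<cdot>\<^sub>m 1\<^sub>m 1" unfolding eu mult_smult_distrib[OF va vc] vv ..
    finally have vu: "mat_adjoint v * u = c \<cdot>\<^sub>m 1\<^sub>m 1" .
    have "v * mat_adjoint v * u = v * (c \<cdot>\<^sub>m 1\<^sub>m 1)" using assoc_mult_mat[OF vc va u] vu by simp
    also have "\<dots> = c \<cdot>\<^sub>m v" using mult_smult_distrib[OF vc one_carrier_mat] right_mult_one_mat[OF vc] by simp
    finally show "\<rho> e * u = v * mat_adjoint v * u" using eu by simp
  qed
  define f where "f j = mat k 1 (\<lambda>(l, _). if l = j then 1 else 0 :: complex)" for j :: nat
  have fc: "f j \<in> carrier_mat k 1" for j by (simp add: f_def)
  have unit: "\<exists>x. \<forall>a<k. \<forall>b<k. \<rho> x $$ (a, b) = (if a = i \<and> b = j then 1 else 0)" for i j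
  proof -
    obtain x y where xy: "\<rho> x * v = f i" "\<rho> y * v = f j" using cyc[OF fc] by metis
    have fac: "mat_adjoint (f j) \<in> carrier_mat 1 k" using fc[of j] by simp
    have "\<rho> (x * e * star y) = \<rho> x * (v * mat_adjoint v) * mat_adjoint (\<rho> y)" by (simp add: mult star E)
    also have "\<rho> x * (v * mat_adjoint v) = f i * mat_adjoint v"
      using assoc_mult_mat[OF carrier vc va] xy by metis
    also have "f i * mat_adjoint v * mat_adjoint (\<rho> y) = f i * (mat_adjoint v * mat_adjoint (\<rho> y))"
      by (rule assoc_mult_mat[OF fc va mat_adjoint_carrier[OF carrier]])
    also have "mat_adjoint v * mat_adjoint (\<rho> y) = mat_adjoint (f j)"
      using mat_adjoint_mult[OF carrier vc, of y] xy(2) by metis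
    finally have eq: "\<rho> (x * e * star y) = f i * mat_adjoint (f j)" .
    have "\<rho> (x * e * star y) $$ (a, b) = (if a = i \<and> b = j then 1 else 0)" if ab: "a < k" "b < k" for a b
      unfolding eq mult_mat_index[OF fc fac ab] using ab by (simp add: f_def)
    then show ?thesis by blast
  qed
  then obtain x where x: "\<And>i j a b. a < k \<Longrightarrow> b < k \<Longrightarrow> \<rho> (x i j) $$ (a, b) = (if a = i \<and> b = j then 1 else 0)" by metis
  have "M \<in> range \<rho>" if M: "M \<in> carrier_mat k k" for M
  proof -
    have "\<rho> (\<Sum>i<k. \<Sum>j<k. M $$ (i, j) *\<^sub>C x i j) = M"
    proof (rule eq_matI)
      fix a b assume "a < dim_row M" "b < dim_col M"
      then have ab: "a < k" "b < k" using M by auto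
      have "\<rho> (\<Sum>i<k. \<Sum>j<k. M $$ (i, j) *\<^sub>C x i j) $$ (a, b) = (\<Sum>i<k. \<Sum>j<k. M $$ (i, j) * (if a = i \<and> b = j then 1 else 0))"
        using ab by (simp add: entry_sum entry_scaleC x)
      also have "\<dots> = (\<Sum>i<k. if i = a then M $$ (a, b) else 0)"
      proof (rule sum.cong)
        fix i
        have "(\<Sum>j<k. M $$ (i, j) * (if a = i \<and> b = j then 1 else 0)) = (\<Sum>j<k. if j = b then (if i = a then M $$ (a, b) else 0) else 0)"
          by (rule sum.cong) auto
        then show "(\<Sum>j<k. M $$ (i, j) * (if a = i \<and> b = j then 1 else 0)) = (if i = a then M $$ (a, b) else 0)"
          using ab by simp
      qed simp
      finally show "\<rho> (\<Sum>i<k. \<Sum>j<k. M $$ (i, j) *\<^sub>C x i j) $$ (a, b) = M $$ (a, b)" using ab by simp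
    qed (use M in auto)
    then show ?thesis by (metis rangeI)
  qed
  then have "range \<rho> = carrier_mat k k" using carrier by blast
  then show ?thesis unfolding rep_onto_matrix_algebra_def by (simp add: add scaleC mult star)
qed

end

text \<open>Let J be the ideal of elements that vanish in all irreducible representations of smaller
  dimension. On an invariant subspace of least dimension on which J does not vanish, the compression
  is surjective by the Burnside argument. If the subspace were proper, J would vanish on it by
  definition; so it is the whole space.\<close>

lemma onto_if_new_ideal:
  fixes \<sigma> :: "'a::unital_cstar_algebra \<Rightarrow> complex mat"
  assumes rep: "matrix_rep n \<sigma>" and b: "\<sigma> b \<noteq> 0\<^sub>m n n"
    and low: "\<And>k \<rho>. 1 \<le> k \<Longrightarrow> k < n \<Longrightarrow> rep_onto_matrix_algebra k \<rho> \<Longrightarrow> \<rho> b = 0\<^sub>m k k"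
  shows "rep_onto_matrix_algebra n \<sigma>"
proof -
  interpret matrix_rep n \<sigma> by (rule rep)
  define J :: "'a set" where "J = {b. \<forall>k \<rho>. 1 \<le> k \<longrightarrow> k < n \<longrightarrow> rep_onto_matrix_algebra k \<rho> \<longrightarrow> \<rho> b = 0\<^sub>m k k}"
  have J: "two_sided_ideal J"
    unfolding two_sided_ideal_def
  proof (intro conjI ballI allI)
    fix x y c assume x: "x \<in> J"
    have z: "\<rho> x = 0\<^sub>m k k" "matrix_rep k \<rho>" if "1 \<le> k" "k < n" "rep_onto_matrix_algebra k \<rho>" for k \<rho>
      using that x rep_onto_matrix_rep by (auto simp: J_def)
    have "\<rho> (c *\<^sub>C x) = 0\<^sub>m k k \<and> \<rho> (x * y) = 0\<^sub>m k k \<and> \<rho> (y * x) = 0\<^sub>m k k"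
      if h: "1 \<le> k" "k < n" "rep_onto_matrix_algebra k \<rho>" for k \<rho>
    proof -
      interpret r: matrix_rep k \<rho> by (rule z(2)[OF h])
      show ?thesis
        unfolding r.mult r.scaleC z(1)[OF h] left_mult_zero_mat[OF r.carrier] right_mult_zero_mat[OF r.carrier]
        by (auto intro!: eq_matI)
    qed
    then show "c *\<^sub>C x \<in> J" "x * y \<in> J" "y * x \<in> J"
      unfolding J_def by blast+
    assume y: "y \<in> J"
    have zy: "\<rho> y = 0\<^sub>m k k" if "1 \<le> k" "k < n" "rep_onto_matrix_algebra k \<rho>" for k \<rho>
      using that y by (auto simp: J_def)
    show "x - y \<in> J"
      unfolding J_def
    proof (intro CollectI allI impI)
      fix k and \<rho> :: "'a \<Rightarrow> complex mat" assume h: "1 \<le> k" "k < n" "rep_onto_matrix_algebra k \<rho>"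
      interpret r: matrix_rep k \<rho> by (rule z(2)[OF h])
      show "\<rho> (x - y) = 0\<^sub>m k k" by (rule eq_matI) (simp_all add: r.entry_diff z(1)[OF h] zy[OF h])
    qed
  qed
  have bJ: "b \<in> J" using low by (auto simp: J_def)
  let ?P = "\<lambda>k. \<exists>V b. invariant_isometry n \<sigma> k V \<and> b \<in> J \<and> \<sigma> b * V \<noteq> 0\<^sub>m n k"
  have "invariant_isometry n \<sigma> n (1\<^sub>m n)"
    unfolding invariant_isometry_def isometry_mat_def
    using right_mult_one_mat[OF carrier] left_mult_one_mat[OF carrier] by simp
  then have Pn: "?P n" using bJ b right_mult_one_mat[OF carrier] by metis
  define k where "k = (LEAST k. ?P k)"
  have Pk: "?P k" unfolding k_def by (rule LeastI[of ?P, OF Pn])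
  have least: "k \<le> l" if "?P l" for l unfolding k_def by (rule Least_le[of ?P, OF that])
  have kn: "k \<le> n" by (rule least[OF Pn])
  obtain V p where V: "invariant_isometry n \<sigma> k V" and p: "p \<in> J" "\<sigma> p * V \<noteq> 0\<^sub>m n k" using Pk by blast
  have Vi: "isometry_mat n k V" and Vc: "V \<in> carrier_mat n k" and VV: "mat_adjoint V * V = 1\<^sub>m k"
    and inv: "\<And>x. V * (mat_adjoint V * (\<sigma> x * V)) = \<sigma> x * V"
    using V by (auto simp: invariant_isometry_def isometry_mat_def)
  have ac: "mat_adjoint V \<in> carrier_mat k n" using Vc by simp
  define \<rho> where "\<rho> = (\<lambda>x. mat_adjoint V * (\<sigma> x * V))"
  interpret r: matrix_rep k \<rho> unfolding \<rho>_def by (rule compression_rep[OF rep V])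
  have inv': "\<sigma> x * V = V * \<rho> x" for x by (simp only: \<rho>_def inv)
  interpret s: supporting_ideal k \<rho> J
  proof
    show "two_sided_ideal J" by (rule J)
    have "\<rho> p \<noteq> 0\<^sub>m k k"
      using p(2) inv'[of p] right_mult_zero_mat[OF Vc, of k] by metis
    then show "\<exists>b\<in>J. \<rho> b \<noteq> 0\<^sub>m k k" using p(1) by blast
    fix l W c
    assume W: "invariant_isometry k \<rho> l W" and c: "c \<in> J" "\<rho> c * W \<noteq> 0\<^sub>m k l"
    have Wc: "W \<in> carrier_mat k l" and WW: "mat_adjoint W * W = 1\<^sub>m l"
      and Winv: "\<And>x. W * (mat_adjoint W * (\<rho> x * W)) = \<rho> x * W"
      using W by (auto simp: invariant_isometry_def isometry_mat_def)
    have aW: "mat_adjoint W \<in> carrier_mat l k" using Wc by simp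
    have VW: "V * W \<in> carrier_mat n l" by (rule mult_carrier_mat[OF Vc Wc])
    have rW: "\<rho> x * W \<in> carrier_mat k l" for x by (rule mult_carrier_mat[OF r.carrier Wc])
    have sVW: "\<sigma> x * (V * W) = V * (\<rho> x * W)" for x
      using assoc_mult_mat[OF carrier Vc Wc] inv'[of x] assoc_mult_mat[OF Vc r.carrier Wc] by metis
    have cancel: "mat_adjoint V * (V * X) = X" if "X \<in> carrier_mat k m" for X m
      using assoc_mult_mat[OF ac Vc that] VV left_mult_one_mat[OF that] by simp
    have adj: "mat_adjoint (V * W) * (V * X) = mat_adjoint W * X" if X: "X \<in> carrier_mat k m" for X m
      unfolding mat_adjoint_mult[OF Vc Wc]
      using assoc_mult_mat[OF aW ac mult_carrier_mat[OF Vc X]] cancel[OF X] by simp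
    have "invariant_isometry n \<sigma> l (V * W)"
      unfolding invariant_isometry_def isometry_mat_def
    proof (intro conjI allI VW)
      show "mat_adjoint (V * W) * (V * W) = 1\<^sub>m l" using adj[OF Wc] WW by simp
      fix x
      have "mat_adjoint (V * W) * (\<sigma> x * (V * W)) = mat_adjoint W * (\<rho> x * W)"
        unfolding sVW by (rule adj[OF rW])
      then have "V * W * (mat_adjoint (V * W) * (\<sigma> x * (V * W))) = V * (W * (mat_adjoint W * (\<rho> x * W)))"
        using assoc_mult_mat[OF Vc Wc mult_carrier_mat[OF aW rW]] by simp
      then show "V * W * (mat_adjoint (V * W) * (\<sigma> x * (V * W))) = \<sigma> x * (V * W)"
        unfolding Winv sVW .
    qed
    moreover have "\<sigma> c * (V * W) \<noteq> 0\<^sub>m n l"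
    proof
      assume "\<sigma> c * (V * W) = 0\<^sub>m n l"
      then have "mat_adjoint V * (V * (\<rho> c * W)) = 0\<^sub>m k l"
        unfolding sVW using right_mult_zero_mat[OF ac] by simp
      then show False using cancel[OF rW] c(2) by simp
    qed
    ultimately show "k \<le> l" using least c(1) by blast
  qed
  have onto: "rep_onto_matrix_algebra k \<rho>" by (rule s.onto)
  have k1: "1 \<le> k"
  proof (rule ccontr)
    assume "\<not> 1 \<le> k"
    then have "\<sigma> p * V = 0\<^sub>m n k" using Vc by (intro eq_matI) auto
    then show False using p(2) by simp
  qed
  have "k = n"
  proof (rule ccontr)
    assume "k \<noteq> n"
    then have "\<rho> p = 0\<^sub>m k k" using kn k1 onto p(1) by (auto simp: J_def)
    then show False using p(2) inv'[of p] right_mult_zero_mat[OF Vc] by metis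
  qed
  then have U: "unitary_mat n V" using Vi isometry_mat_square by blast
  have VVa: "V * mat_adjoint V = 1\<^sub>m n" using U by (simp add: unitary_mat_def)
  have "M \<in> range \<sigma>" if M: "M \<in> carrier_mat n n" for M
  proof -
    have "mat_adjoint V * (M * V) \<in> carrier_mat k k" using ac M Vc \<open>k = n\<close> by auto
    then obtain x where x: "\<rho> x = mat_adjoint V * (M * V)" using onto_lift[OF onto] by metis
    have e: "V * (mat_adjoint V * (X * V)) * mat_adjoint V = X" if X: "X \<in> carrier_mat n n" for X
    proof -
      have XV: "X * V \<in> carrier_mat n k" by (rule mult_carrier_mat[OF X Vc])
      have "V * (mat_adjoint V * (X * V)) = X * V"
        by (simp only: assoc_mult_mat[OF Vc ac XV, symmetric] VVa left_mult_one_mat[OF XV])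
      then show ?thesis by (simp only: assoc_mult_mat[OF X Vc ac] VVa right_mult_one_mat[OF X])
    qed
    have "mat_adjoint V * (\<sigma> x * V) = mat_adjoint V * (M * V)" using x by (simp only: \<rho>_def)
    then have "\<sigma> x = M" using e[OF carrier[of x]] e[OF M] by metis
    then show ?thesis by blast
  qed
  then have "range \<sigma> = carrier_mat n n" using carrier by blast
  then show ?thesis unfolding rep_onto_matrix_algebra_def by (simp add: add scaleC mult star)
qed

subsection \<open>Compactness of the space of matrix representations\<close>

text \<open>Representations as points of a product of complex planes, one for each matrix entry of
  each algebra element. The axioms are closed conditions, and entries are bounded by the norm of the
  element, so Tychonoff's theorem applies.\<close>

definition rep_coords :: "nat \<Rightarrow> ('a::unital_cstar_algebra \<times> nat \<times> nat \<Rightarrow> complex) set"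
  where "rep_coords n = {\<Phi>. \<forall>i<n. \<forall>j<n. \<forall>x y c.
    \<Phi> (x + y, i, j) = \<Phi> (x, i, j) + \<Phi> (y, i, j) \<and> \<Phi> (c *\<^sub>C x, i, j) = c * \<Phi> (x, i, j) \<and>
    \<Phi> (x * y, i, j) = (\<Sum>l<n. \<Phi> (x, i, l) * \<Phi> (y, l, j)) \<and> \<Phi> (star x, i, j) = cnj (\<Phi> (x, j, i)) \<and>
    \<Phi> (1, i, j) = (if i = j then 1 else 0)}"

definition rep_of_coords :: "nat \<Rightarrow> ('a \<times> nat \<times> nat \<Rightarrow> complex) \<Rightarrow> 'a \<Rightarrow> complex mat"
  where "rep_of_coords n \<Phi> x = mat n n (\<lambda>(i, j). \<Phi> (x, i, j))"

lemma rep_of_coords: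
  assumes "\<Phi> \<in> rep_coords n"
  shows "matrix_rep n (rep_of_coords n \<Phi>)"
proof
  fix x y
  have c: "rep_of_coords n \<Phi> x \<in> carrier_mat n n" for x by (simp add: rep_of_coords_def)
  show "rep_of_coords n \<Phi> (x * y) = rep_of_coords n \<Phi> x * rep_of_coords n \<Phi> y"
  proof (rule eq_matI)
    fix i j assume "i < dim_row (rep_of_coords n \<Phi> x * rep_of_coords n \<Phi> y)"
      "j < dim_col (rep_of_coords n \<Phi> x * rep_of_coords n \<Phi> y)"
    then have ij: "i < n" "j < n" using c by (auto simp: rep_of_coords_def)
    show "rep_of_coords n \<Phi> (x * y) $$ (i, j) = (rep_of_coords n \<Phi> x * rep_of_coords n \<Phi> y) $$ (i, j)"
      unfolding mult_mat_index[OF c c ij] using assms ij by (simp add: rep_of_coords_def rep_coords_def)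
  qed (auto simp: rep_of_coords_def)
qed (use assms in \<open>auto simp: rep_of_coords_def rep_coords_def intro!: eq_matI\<close>)

lemma coords_of_rep:
  assumes "matrix_rep n \<pi>"
  defines "\<Phi> \<equiv> (\<lambda>(x, i, j). if i < n \<and> j < n then \<pi> x $$ (i, j) else 0)"
  shows "\<Phi> \<in> rep_coords n" "\<Phi> (x, i, j) \<in> cball 0 (norm x)"
proof -
  interpret matrix_rep n \<pi> by fact
  show "\<Phi> \<in> rep_coords n"
    by (auto simp: \<Phi>_def rep_coords_def entry_add entry_scaleC entry_mult entry_star one)
  show "\<Phi> (x, i, j) \<in> cball 0 (norm x)"
    by (auto simp: \<Phi>_def entry_bound)
qed

lemma continuous_coord: "continuous_on UNIV (\<lambda>\<Phi> :: 'b \<Rightarrow> complex. \<Phi> p)"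
  by simp

lemma closed_rep_coords: "closed (rep_coords n :: ('a::unital_cstar_algebra \<times> nat \<times> nat \<Rightarrow> complex) set)"
  unfolding rep_coords_def
  by (intro closed_Collect_all closed_Collect_imp closed_Collect_conj closed_Collect_eq continuous_intros
      continuous_coord open_Collect_const)

lemma compact_bounded_coords: "compact {\<Phi> :: 'a::real_normed_vector \<times> nat \<times> nat \<Rightarrow> complex. \<forall>x i j. \<Phi> (x, i, j) \<in> cball 0 (norm x)}"
proof -
  have "compactin (product_topology (\<lambda>_. euclidean) UNIV) (PiE UNIV (\<lambda>p :: 'a \<times> nat \<times> nat. cball (0 :: complex) (norm (fst p))))"
    unfolding compactin_PiE by simp
  moreover have "PiE UNIV (\<lambda>p :: 'a \<times> nat \<times> nat. cball (0 :: complex) (norm (fst p))) =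
      {\<Phi>. \<forall>x i j. \<Phi> (x, i, j) \<in> cball 0 (norm x)}"
    by (auto simp: PiE_def Pi_def)
  ultimately show ?thesis by (simp add: euclidean_product_topology)
qed

lemma finite_subcover_reps:
  fixes a :: "'a::unital_cstar_algebra" and r :: "'b \<Rightarrow> 'a"
  assumes n: "n > 0"
    and cover: "\<And>\<sigma>. matrix_rep n \<sigma> \<Longrightarrow> e \<le> Re (mtr (\<sigma> a)) \<Longrightarrow> \<exists>s\<in>I. 1 / 2 < Re (\<sigma> (r s) $$ (0, 0))"
  obtains I' where "finite I'" "I' \<subseteq> I"
    "\<And>\<sigma>. matrix_rep n \<sigma> \<Longrightarrow> e \<le> Re (mtr (\<sigma> a)) \<Longrightarrow> \<exists>s\<in>I'. 1 / 2 < Re (\<sigma> (r s) $$ (0, 0))"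
proof (rule ccontr)
  assume neg: "\<not> thesis"
  note found = that
  define S where "S = {\<Phi> :: 'a \<times> nat \<times> nat \<Rightarrow> complex. \<forall>x i j. \<Phi> (x, i, j) \<in> cball 0 (norm x)} \<inter>
      (rep_coords n \<inter> {\<Phi>. e \<le> Re (\<Sum>i<n. \<Phi> (a, i, i))})"
  define f where "f s = {\<Phi> :: 'a \<times> nat \<times> nat \<Rightarrow> complex. Re (\<Phi> (r s, 0, 0)) \<le> 1 / 2}" for s
  have "closed {\<Phi> :: 'a \<times> nat \<times> nat \<Rightarrow> complex. e \<le> Re (\<Sum>i<n. \<Phi> (a, i, i))}"
    by (intro closed_Collect_le continuous_intros continuous_coord)
  then have S: "compact S"
    unfolding S_def by (intro compact_Int_closed compact_bounded_coords closed_Int closed_rep_coords)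
  have "S \<inter> (\<Inter>s\<in>I. f s) \<noteq> {}"
  proof (rule compact_imp_fip_image[OF S])
    fix s show "closed (f s)"
      unfolding f_def by (intro closed_Collect_le continuous_intros continuous_coord)
  next
    fix I' assume I': "finite I'" "I' \<subseteq> I"
    then obtain \<sigma> where s: "matrix_rep n \<sigma>" "e \<le> Re (mtr (\<sigma> a))" "\<And>s. s \<in> I' \<Longrightarrow> Re (\<sigma> (r s) $$ (0, 0)) \<le> 1 / 2"
      using neg found by (meson linorder_not_less)
    define \<Phi> where "\<Phi> = (\<lambda>(x, i, j). if i < n \<and> j < n then \<sigma> x $$ (i, j) else 0)"
    note c = coords_of_rep[OF s(1), folded \<Phi>_def]
    have "(\<Sum>i<n. \<Phi> (a, i, i)) = mtr (\<sigma> a)"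
      unfolding mtr_carrier[OF matrix_rep.carrier[OF s(1)]] by (simp add: \<Phi>_def)
    then have "\<Phi> \<in> S" using c s(2) by (simp add: S_def del: Re_sum)
    moreover have "\<Phi> \<in> (\<Inter>s\<in>I'. f s)" using s(3) n by (simp add: f_def \<Phi>_def)
    ultimately show "S \<inter> (\<Inter>s\<in>I'. f s) \<noteq> {}" by blast
  qed
  then obtain \<Phi> where P: "\<Phi> \<in> S" "\<And>s. s \<in> I \<Longrightarrow> \<Phi> \<in> f s" by blast
  then have rep: "matrix_rep n (rep_of_coords n \<Phi>)" by (intro rep_of_coords) (simp add: S_def)
  have "e \<le> Re (mtr (rep_of_coords n \<Phi> a))"
    using P(1) unfolding mtr_carrier[OF matrix_rep.carrier[OF rep]] by (simp add: S_def rep_of_coords_def)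
  then obtain s where s: "s \<in> I" "1 / 2 < Re (rep_of_coords n \<Phi> (r s) $$ (0, 0))" using cover[OF rep] by blast
  then show False using P(2)[OF s(1)] n by (simp add: f_def rep_of_coords_def)
qed

subsection \<open>Approximation by induction on the dimension\<close>

lemma (in matrix_rep) sum_sq_diag_nonneg:
  assumes "sa_tuple X" "j < n"
  shows "0 \<le> Re (\<pi> (sum_sq X) $$ (j, j))"
proof -
  have "\<pi> (X $ i * X $ i) $$ (j, j) = of_real (\<Sum>l<n. (cmod (\<pi> (X $ i) $$ (j, l)))\<^sup>2)" for i
  proof -
    have "\<pi> (X $ i) $$ (l, j) = cnj (\<pi> (X $ i) $$ (j, l))" if "l < n" for l
      using entry_star[of l j "X $ i"] assms that by (simp add: sa_tuple_def self_adjoint_def)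
    then show ?thesis using assms by (simp add: entry_mult cmod_square)
  qed
  then have "Re (\<pi> (X $ i * X $ i) $$ (j, j)) = (\<Sum>l<n. (cmod (\<pi> (X $ i) $$ (j, l)))\<^sup>2)" for i
    by (simp only: Re_complex_of_real)
  then show ?thesis
    using assms(2) by (simp add: sum_sq_def entry_sum sum_nonneg)
qed

context subhom
begin

text \<open>The positive part of \<open>sum_sq X\<close> above level d^2 vanishes in surjective
  representations of smaller dimension, where every eigenvalue of \<open>sum_sq X\<close> is at most
  its trace. In \<sigma> it does not vanish, since the average eigenvalue already exceeds d^2. So
  \<open>onto_if_new_ideal\<close> applies.\<close>

lemma onto_if_large:
  fixes X :: "'a ^ 'm"
  assumes X: "sa_tuple X" and rep: "matrix_rep n \<sigma>" and d: "d \<ge> 0" and e: "real n * d\<^sup>2 < Re (mtr (\<sigma> (sum_sq X)))"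
    and low: "\<And>k \<rho>. 1 \<le> k \<Longrightarrow> k < n \<Longrightarrow> rep_onto_matrix_algebra k \<rho> \<Longrightarrow> hs_norm k \<rho> X \<le> d"
  shows "rep_onto_matrix_algebra n \<sigma>"
proof -
  define f where "f t = max 0 (t - d\<^sup>2)" for t :: real
  have fc: "continuous_on UNIV f" unfolding f_def by (intro continuous_intros)
  have sa: "self_adjoint (sum_sq X)" by (rule sa_sum_sq[OF X])
  have zero_iff: "\<rho> (real_calc f (sum_sq X)) = 0\<^sub>m k k \<longleftrightarrow>
      (\<forall>j<k. Re ((mat_adjoint U * \<rho> (sum_sq X) * U) $$ (j, j)) \<le> d\<^sup>2)"
    if r: "matrix_rep k \<rho>" and U: "unitary_mat k U" "diagonal_mat (mat_adjoint U * \<rho> (sum_sq X) * U)" for k \<rho> U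
  proof -
    interpret p: matrix_rep k \<rho> by (rule r)
    define \<rho>1 where "\<rho>1 x = mat_adjoint U * \<rho> x * U" for x
    have r1: "\<rho>1 = (\<lambda>x. mat_adjoint U * \<rho> x * U)" by (simp add: \<rho>1_def fun_eq_iff)
    interpret r1: matrix_rep k \<rho>1 unfolding r1 by (rule p.conj_rep[OF U(1)])
    have D: "diagonal_mat (\<rho>1 (sum_sq X))" using U(2) by (simp only: \<rho>1_def)
    note rc = real_calc_diagonal[OF sa fc r1.matrix_rep_axioms D]
    have "\<rho> (real_calc f (sum_sq X)) = 0\<^sub>m k k \<longleftrightarrow> \<rho>1 (real_calc f (sum_sq X)) = 0\<^sub>m k k"
    proof
      assume "\<rho> (real_calc f (sum_sq X)) = 0\<^sub>m k k"
      then have "\<rho> (real_calc f (sum_sq X)) = \<rho> 0" by (simp add: p.zero)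
      then have "\<rho>1 (real_calc f (sum_sq X)) = \<rho>1 0" by (simp only: \<rho>1_def)
      then show "\<rho>1 (real_calc f (sum_sq X)) = 0\<^sub>m k k" by (simp only: r1.zero)
    next
      assume "\<rho>1 (real_calc f (sum_sq X)) = 0\<^sub>m k k"
      then have "\<rho>1 (real_calc f (sum_sq X)) = \<rho>1 0" by (simp add: r1.zero)
      then have "\<rho> (real_calc f (sum_sq X)) = \<rho> 0" using p.conj_inverse[OF U(1)] unfolding \<rho>1_def by metis
      then show "\<rho> (real_calc f (sum_sq X)) = 0\<^sub>m k k" by (simp only: p.zero)
    qed
    also have "\<dots> \<longleftrightarrow> (\<forall>j<k. \<rho>1 (real_calc f (sum_sq X)) $$ (j, j) = 0)"
    proof
      assume z: "\<forall>j<k. \<rho>1 (real_calc f (sum_sq X)) $$ (j, j) = 0"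
      show "\<rho>1 (real_calc f (sum_sq X)) = 0\<^sub>m k k"
      proof (rule eq_matI)
        fix i j assume "i < dim_row (0\<^sub>m k k :: complex mat)" "j < dim_col (0\<^sub>m k k :: complex mat)"
        then have "i < k" "j < k" by auto
        then show "\<rho>1 (real_calc f (sum_sq X)) $$ (i, j) = 0\<^sub>m k k $$ (i, j)"
          using z rc(1) by (cases "i = j") (simp_all add: diagonal_mat_def)
      qed simp_all
    qed simp
    also have "\<dots> \<longleftrightarrow> (\<forall>j<k. Re (\<rho>1 (sum_sq X) $$ (j, j)) \<le> d\<^sup>2)"
      using rc(2) by (auto simp: f_def)
    finally show ?thesis by (simp only: \<rho>1_def)
  qed
  show ?thesis
  proof (rule onto_if_new_ideal[OF rep])
    interpret s: matrix_rep n \<sigma> by (rule rep)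
    obtain U where U: "unitary_mat n U" "diagonal_mat (mat_adjoint U * \<sigma> (sum_sq X) * U)"
      using s.diagonalize_single[OF sa] by blast
    show "\<sigma> (real_calc f (sum_sq X)) \<noteq> 0\<^sub>m n n"
    proof
      assume "\<sigma> (real_calc f (sum_sq X)) = 0\<^sub>m n n"
      then have le: "\<forall>j<n. Re ((mat_adjoint U * \<sigma> (sum_sq X) * U) $$ (j, j)) \<le> d\<^sup>2"
        using zero_iff[OF rep U] by blast
      interpret r: matrix_rep n "\<lambda>x. mat_adjoint U * \<sigma> x * U" by (rule s.conj_rep[OF U(1)])
      have "Re (mtr (\<sigma> (sum_sq X))) = (\<Sum>j<n. Re ((mat_adjoint U * \<sigma> (sum_sq X) * U) $$ (j, j)))"
        unfolding s.conj_mtr[OF U(1), symmetric] mtr_carrier[OF r.carrier] by simp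
      also have "\<dots> \<le> (\<Sum>j<n. d\<^sup>2)" by (rule sum_mono) (use le in auto)
      finally show False using e by simp
    qed
  next
    fix k and \<rho> :: "'a \<Rightarrow> complex mat" assume k: "1 \<le> k" "k < n" and onto: "rep_onto_matrix_algebra k \<rho>"
    have r: "matrix_rep k \<rho>" by (rule rep_onto_matrix_rep[OF onto])
    interpret p: matrix_rep k \<rho> by (rule r)
    obtain U where U: "unitary_mat k U" "diagonal_mat (mat_adjoint U * \<rho> (sum_sq X) * U)"
      using p.diagonalize_single[OF sa] by blast
    interpret r: matrix_rep k "\<lambda>x. mat_adjoint U * \<rho> x * U" by (rule p.conj_rep[OF U(1)])
    have "Re ((mat_adjoint U * \<rho> (sum_sq X) * U) $$ (j, j)) \<le> d\<^sup>2" if j: "j < k" for j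
    proof -
      have "Re ((mat_adjoint U * \<rho> (sum_sq X) * U) $$ (j, j)) \<le> (\<Sum>j<k. Re ((mat_adjoint U * \<rho> (sum_sq X) * U) $$ (j, j)))"
        by (rule member_le_sum) (use j r.sum_sq_diag_nonneg[OF X] in \<open>auto simp del: index_mult_mat(1)\<close>)
      also have "\<dots> = Re (mtr (\<rho> (sum_sq X)))"
        unfolding p.conj_mtr[OF U(1), symmetric] mtr_carrier[OF r.carrier] by simp
      also have "\<dots> = (hs_norm k \<rho> X)\<^sup>2" by (rule p.hs_norm_square[OF X, symmetric])
      also have "\<dots> \<le> d\<^sup>2" by (rule power_mono[OF low[OF k onto] p.hs_norm_nonneg])
      finally show ?thesis .
    qed
    then show "\<rho> (real_calc f (sum_sq X)) = 0\<^sub>m k k" using zero_iff[OF r U] by blast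
  qed
qed

lemma approximation_step:
  fixes A B :: "'a ^ 'm"
  assumes A: "abelian_family A" and B: "abelian_family B" and maj: "A \<prec>\<^sub>t\<^sub>r B"
    and n: "0 < n" "n \<le> N" and e: "e > 0"
    and IH: "\<And>d. d > 0 \<Longrightarrow> \<exists>Z\<in>orbit_hull B. \<forall>k \<rho>. 1 \<le> k \<longrightarrow> k < n \<longrightarrow> rep_onto_matrix_algebra k \<rho> \<longrightarrow> hs_norm k \<rho> (A - Z) \<le> d"
  shows "\<exists>Z\<in>orbit_hull B. \<forall>k \<rho>. 1 \<le> k \<longrightarrow> k \<le> n \<longrightarrow> rep_onto_matrix_algebra k \<rho> \<longrightarrow> hs_norm k \<rho> (A - Z) \<le> e"
proof -
  have saA: "sa_tuple A" and saB: "sa_tuple B" using A B by (auto intro: sa_tuple_intros)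
  define e2 where "e2 = e / 2"
  \<comment> \<open>Small enough that n times the square of \<open>e1\<close> stays below the square
    of \<open>e2\<close>. By \<open>onto_if_large\<close> every n-dimensional representation with
    error at least \<open>e2\<close> is then surjective.\<close>
  define e1 where "e1 = e2 / (real n + 1)"
  have e2: "e2 > 0" using e by (simp add: e2_def)
  have e1: "e1 > 0" "e1 \<le> e2" "real n * e1\<^sup>2 < e2\<^sup>2"
  proof -
    show "e1 > 0" "e1 \<le> e2" using e2 by (auto simp: e1_def divide_le_eq)
    have "0 < 1 + (real n + real n * real n)" by (intro add_pos_nonneg) auto
    then have "real n < (real n + 1)\<^sup>2" by (simp add: power2_eq_square algebra_simps)
    then have "real n * e2\<^sup>2 < (real n + 1)\<^sup>2 * e2\<^sup>2" using e2 by (intro mult_strict_right_mono) auto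
    then show "real n * e1\<^sup>2 < e2\<^sup>2" by (simp add: e1_def power_divide divide_less_eq mult.commute)
  qed
  obtain Z where Z: "Z \<in> orbit_hull B"
    and Zlow: "\<And>k \<rho>. 1 \<le> k \<Longrightarrow> k < n \<Longrightarrow> rep_onto_matrix_algebra k \<rho> \<Longrightarrow> hs_norm k \<rho> (A - Z) \<le> e1"
    using IH[OF e1(1)] by blast
  have saZ: "sa_tuple (A - Z)" using saA orbit_hull_sa[OF saB Z] by (rule sa_tuple_intros)
  \<comment> \<open>\<open>Y\<close> is a local approximation at \<sigma> and \<open>r\<close> its
    cutoff. The level 1/2 is met because the squared local error is taken below half of the
    threshold, the square of \<open>e2\<close>.\<close>
  define Q where "Q \<sigma> Y r \<longleftrightarrow> Y \<in> orbit_hull B \<and> self_adjoint r \<and>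
      (\<forall>k \<rho>. matrix_rep k \<rho> \<longrightarrow> k < n \<longrightarrow> matrix_rep.acts_scalar k \<rho> r 0) \<and>
      (\<forall>\<rho>. matrix_rep n \<rho> \<longrightarrow> (\<exists>c\<ge>0. matrix_rep.acts_scalar n \<rho> r (of_real (c * (1 - Re (mtr (\<rho> (sum_sq (A - Y)))) / e2\<^sup>2))))) \<and>
      1 / 2 < Re (\<sigma> r $$ (0, 0))" for \<sigma> Y r
  have "\<exists>Y r. Q \<sigma> Y r" if onto: "rep_onto_matrix_algebra n \<sigma>" for \<sigma>
  proof -
    interpret s: matrix_rep n \<sigma> by (rule rep_onto_matrix_rep[OF onto])
    obtain Y where Y: "Y \<in> orbit_hull B" "(hs_norm n \<sigma> (A - Y))\<^sup>2 < e2\<^sup>2 / 2"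
      using local_approximation[OF A B maj onto, of "e2\<^sup>2 / 2"] n e2 by auto
    have saY: "sa_tuple (A - Y)" using saA orbit_hull_sa[OF saB Y(1)] by (rule sa_tuple_intros)
    obtain r where r: "self_adjoint r"
      "\<And>k \<rho>. matrix_rep k \<rho> \<Longrightarrow> k < n \<Longrightarrow> matrix_rep.acts_scalar k \<rho> r 0"
      "\<And>\<rho>. matrix_rep n \<rho> \<Longrightarrow> \<exists>c\<ge>0. matrix_rep.acts_scalar n \<rho> r (of_real (c * (1 - Re (mtr (\<rho> (sum_sq (A - Y)))) / e2\<^sup>2)))"
      "s.acts_scalar r (of_real (1 - Re (mtr (\<sigma> (sum_sq (A - Y)))) / e2\<^sup>2))"
      using central_element[OF onto n(1) sa_sum_sq[OF saY], of "e2\<^sup>2"] by blast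
    have "Re (\<sigma> r $$ (0, 0)) = 1 - (hs_norm n \<sigma> (A - Y))\<^sup>2 / e2\<^sup>2"
      using r(4) n(1) unfolding s.acts_scalar_def s.hs_norm_square[OF saY] by simp
    also have "\<dots> > 1 / 2" using Y(2) e2 by (simp add: divide_less_eq)
    finally show ?thesis unfolding Q_def using Y(1) r by blast
  qed
  then obtain Y r where Q: "\<And>\<sigma>. rep_onto_matrix_algebra n \<sigma> \<Longrightarrow> Q \<sigma> (Y \<sigma>) (r \<sigma>)" by metis
  define I where "I = {\<sigma> :: 'a \<Rightarrow> complex mat. rep_onto_matrix_algebra n \<sigma>}"
  obtain I' where I': "finite I'" "I' \<subseteq> I"
    and cover: "\<And>\<sigma>. matrix_rep n \<sigma> \<Longrightarrow> e2\<^sup>2 \<le> Re (mtr (\<sigma> (sum_sq (A - Z)))) \<Longrightarrow> \<exists>s\<in>I'. 1 / 2 < Re (\<sigma> (r s) $$ (0, 0))"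
  proof (rule finite_subcover_reps[OF n(1), of "e2\<^sup>2" "sum_sq (A - Z)" I r])
    fix \<sigma> :: "'a \<Rightarrow> complex mat" assume s: "matrix_rep n \<sigma>" "e2\<^sup>2 \<le> Re (mtr (\<sigma> (sum_sq (A - Z))))"
    have "rep_onto_matrix_algebra n \<sigma>"
      by (rule onto_if_large[OF saZ s(1), of e1]) (use e1 s(2) Zlow in auto)
    then show "\<exists>s\<in>I. 1 / 2 < Re (\<sigma> (r s) $$ (0, 0))" using Q by (auto simp: I_def Q_def)
  qed blast
  \<comment> \<open>The local approximations are glued in one after the other, each at an
    arbitrarily small cost. Representations that are already good stay good, because a cutoff is
    positive only where the approximation glued in is itself within \<open>e2\<close>.\<close>
  have glue: "\<forall>d>0. \<exists>W\<in>orbit_hull B.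
      (\<forall>k \<rho>. 1 \<le> k \<longrightarrow> k < n \<longrightarrow> rep_onto_matrix_algebra k \<rho> \<longrightarrow> hs_norm k \<rho> (A - W) \<le> e1 + d) \<and>
      (\<forall>\<rho>. rep_onto_matrix_algebra n \<rho> \<longrightarrow>
        hs_norm n \<rho> (A - Z) \<le> e2 \<or> (\<exists>s\<in>F. 1 / 2 < Re (\<rho> (r s) $$ (0, 0))) \<longrightarrow> hs_norm n \<rho> (A - W) \<le> e2 + d)"
    if "finite F" "F \<subseteq> I" for F
    using that
  proof (induction F rule: finite_induct)
    case empty
    show ?case
    proof (intro allI impI bexI[OF _ Z] conjI)
      fix d :: real and k and \<rho> :: "'a \<Rightarrow> complex mat" assume "d > 0" "1 \<le> k" "k < n" "rep_onto_matrix_algebra k \<rho>"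
      then show "hs_norm k \<rho> (A - Z) \<le> e1 + d" using Zlow[of k \<rho>] by simp
    qed auto
  next
    case (insert s F)
    show ?case
    proof (intro allI impI)
      fix d :: real assume d: "d > 0"
      obtain W where W: "W \<in> orbit_hull B"
        and W1: "\<And>k \<rho>. 1 \<le> k \<Longrightarrow> k < n \<Longrightarrow> rep_onto_matrix_algebra k \<rho> \<Longrightarrow> hs_norm k \<rho> (A - W) \<le> e1 + d / 2"
        and W2: "\<And>\<rho>. rep_onto_matrix_algebra n \<rho> \<Longrightarrow>
          hs_norm n \<rho> (A - Z) \<le> e2 \<or> (\<exists>s\<in>F. 1 / 2 < Re (\<rho> (r s) $$ (0, 0))) \<Longrightarrow> hs_norm n \<rho> (A - W) \<le> e2 + d / 2"
        using insert.IH insert.prems d by (metis half_gt_zero insert_subset)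
      have Qs: "Q s (Y s) (r s)" using Q insert.prems by (auto simp: I_def)
      have Ys: "Y s \<in> orbit_hull B" and rs: "self_adjoint (r s)"
        and r0: "\<And>k \<rho>. matrix_rep k \<rho> \<Longrightarrow> k < n \<Longrightarrow> matrix_rep.acts_scalar k \<rho> (r s) 0"
        and r1: "\<And>\<rho>. matrix_rep n \<rho> \<Longrightarrow> \<exists>c\<ge>0. matrix_rep.acts_scalar n \<rho> (r s) (of_real (c * (1 - Re (mtr (\<rho> (sum_sq (A - Y s)))) / e2\<^sup>2)))"
        using Qs by (auto simp: Q_def)
      have saY: "sa_tuple (A - Y s)" using saA orbit_hull_sa[OF saB Ys] by (rule sa_tuple_intros)
      \<comment> \<open>Saturates at 1/2, so that wherever the cutoff exceeds 1/2 the old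
        approximation, which may be bad there, is replaced completely. It vanishes for nonpositive
        values, hence in all smaller dimensions.\<close>
      define f where "f t = min 1 (max 0 (2 * t))" for t :: real
      have fc: "continuous_on UNIV f" unfolding f_def by (intro continuous_intros)
      define q where "q = real_calc f (r s)"
      have q: "self_adjoint q" unfolding q_def by (rule real_calc_self_adjoint[OF rs fc])
      have "d / 2 > 0" using d by simp
      then obtain W' where W': "W' \<in> orbit_hull B"
        and g: "\<And>k \<rho> t. matrix_rep k \<rho> \<Longrightarrow> k \<le> N \<Longrightarrow> 0 \<le> t \<Longrightarrow> t \<le> 1 \<Longrightarrow> matrix_rep.acts_scalar k \<rho> q (of_real t) \<Longrightarrow>
          hs_norm k \<rho> (W' - ((1 - t) *\<^sub>R W + t *\<^sub>R Y s)) \<le> d / 2"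
        using glued_orbit_hull[OF saB q W Ys] unfolding glued_def by blast
      have "hs_norm k \<rho> (A - W') \<le> e1 + d" if k: "1 \<le> k" "k < n" "rep_onto_matrix_algebra k \<rho>" for k \<rho>
      proof -
        interpret p: matrix_rep k \<rho> by (rule rep_onto_matrix_rep[OF k(3)])
        have "p.acts_scalar q (of_real (f 0))"
          unfolding q_def by (rule real_calc_scalar[OF rs fc p.matrix_rep_axioms]) (use r0[OF p.matrix_rep_axioms k(2)] in simp)
        then have "hs_norm k \<rho> (W' - ((1 - 0) *\<^sub>R W + 0 *\<^sub>R Y s)) \<le> d / 2"
          using k n by (intro g p.matrix_rep_axioms) (auto simp: f_def)
        then have "hs_norm k \<rho> (W - W') \<le> d / 2" by (simp add: p.hs_norm_minus)
        then show ?thesis using p.hs_norm_triangle3[of A W' W] W1[OF k] by simp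
      qed
      moreover have "hs_norm n \<rho> (A - W') \<le> e2 + d"
        if onto: "rep_onto_matrix_algebra n \<rho>"
          and cond: "hs_norm n \<rho> (A - Z) \<le> e2 \<or> (\<exists>s\<in>insert s F. 1 / 2 < Re (\<rho> (r s) $$ (0, 0)))" for \<rho>
      proof -
        interpret p: matrix_rep n \<rho> by (rule rep_onto_matrix_rep[OF onto])
        obtain c where c: "c \<ge> 0" "p.acts_scalar (r s) (of_real (c * (1 - Re (mtr (\<rho> (sum_sq (A - Y s)))) / e2\<^sup>2)))"
          using r1[OF p.matrix_rep_axioms] by blast
        define t0 where "t0 = c * (1 - (hs_norm n \<rho> (A - Y s))\<^sup>2 / e2\<^sup>2)"
        have ct: "p.acts_scalar (r s) (of_real t0)" using c(2) by (simp add: t0_def p.hs_norm_square[OF saY])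
        define t where "t = f t0"
        have t: "0 \<le> t" "t \<le> 1" by (auto simp: t_def f_def)
        have qt: "p.acts_scalar q (of_real t)"
          unfolding q_def t_def by (rule real_calc_scalar[OF rs fc p.matrix_rep_axioms ct])
        have near: "hs_norm n \<rho> (W' - ((1 - t) *\<^sub>R W + t *\<^sub>R Y s)) \<le> d / 2"
          by (rule g[OF p.matrix_rep_axioms n(2) t qt])
        \<comment> \<open>A positive weight forces the cutoff to be positive, hence the error of
          \<open>Y s\<close> to be below \<open>e2\<close>; no bound is available at weight
          zero.\<close>
        have tY: "t * hs_norm n \<rho> (A - Y s) \<le> t * e2"
        proof (cases "t = 0")
          case False
          then have "t0 > 0" by (auto simp: t_def f_def)
          then have "1 - (hs_norm n \<rho> (A - Y s))\<^sup>2 / e2\<^sup>2 > 0"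
            using c(1) by (simp add: t0_def zero_less_mult_iff)
          then have "(hs_norm n \<rho> (A - Y s))\<^sup>2 \<le> e2\<^sup>2" using e2 by (simp add: divide_less_eq)
          then have "hs_norm n \<rho> (A - Y s) \<le> e2" by (rule power2_le_imp_le) (use e2 in simp)
          then show ?thesis using t by (intro mult_left_mono)
        qed simp
        \<comment> \<open>If nothing is known about \<open>W\<close>, the representation is covered
          by \<open>r s\<close> alone; then t = 1 and \<open>W\<close> does not contribute.\<close>
        have tW: "(1 - t) * hs_norm n \<rho> (A - W) \<le> (1 - t) * (e2 + d / 2)"
        proof (cases "hs_norm n \<rho> (A - Z) \<le> e2 \<or> (\<exists>s\<in>F. 1 / 2 < Re (\<rho> (r s) $$ (0, 0)))")
          case True
          then show ?thesis using W2[OF onto True] t by (intro mult_left_mono) auto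
        next
          case False
          then have "1 / 2 < Re (\<rho> (r s) $$ (0, 0))" using cond by auto
          then have "1 / 2 < t0" using ct n(1) by (simp add: p.acts_scalar_def)
          then have "t = 1" by (simp add: t_def f_def)
          then show ?thesis by simp
        qed
        have "A - ((1 - t) *\<^sub>R W + t *\<^sub>R Y s) = (1 - t) *\<^sub>R (A - W) + t *\<^sub>R (A - Y s)"
          by (simp add: algebra_simps)
        then have "hs_norm n \<rho> (A - ((1 - t) *\<^sub>R W + t *\<^sub>R Y s)) \<le>
            (1 - t) * hs_norm n \<rho> (A - W) + t * hs_norm n \<rho> (A - Y s)"
          using p.hs_norm_triangle[of "(1 - t) *\<^sub>R (A - W)" "t *\<^sub>R (A - Y s)"] t by (simp add: p.hs_norm_scaleR)
        also have "\<dots> \<le> (1 - t) * (e2 + d / 2) + t * e2" using tW tY by simp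
        also have "\<dots> \<le> e2 + d / 2" using t d by (simp add: algebra_simps)
        finally have "hs_norm n \<rho> (A - ((1 - t) *\<^sub>R W + t *\<^sub>R Y s)) \<le> e2 + d / 2" .
        then show ?thesis
          using p.hs_norm_triangle3[of A W' "(1 - t) *\<^sub>R W + t *\<^sub>R Y s"] near p.hs_norm_minus[of W' "(1 - t) *\<^sub>R W + t *\<^sub>R Y s"] by simp
      qed
      ultimately show "\<exists>W\<in>orbit_hull B.
          (\<forall>k \<rho>. 1 \<le> k \<longrightarrow> k < n \<longrightarrow> rep_onto_matrix_algebra k \<rho> \<longrightarrow> hs_norm k \<rho> (A - W) \<le> e1 + d) \<and>
          (\<forall>\<rho>. rep_onto_matrix_algebra n \<rho> \<longrightarrow>
            hs_norm n \<rho> (A - Z) \<le> e2 \<or> (\<exists>s\<in>insert s F. 1 / 2 < Re (\<rho> (r s) $$ (0, 0))) \<longrightarrow> hs_norm n \<rho> (A - W) \<le> e2 + d)"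
        using W' by blast
    qed
  qed
  obtain W where W: "W \<in> orbit_hull B"
    and W1: "\<And>k \<rho>. 1 \<le> k \<Longrightarrow> k < n \<Longrightarrow> rep_onto_matrix_algebra k \<rho> \<Longrightarrow> hs_norm k \<rho> (A - W) \<le> e1 + e2"
    and W2: "\<And>\<rho>. rep_onto_matrix_algebra n \<rho> \<Longrightarrow>
      hs_norm n \<rho> (A - Z) \<le> e2 \<or> (\<exists>s\<in>I'. 1 / 2 < Re (\<rho> (r s) $$ (0, 0))) \<Longrightarrow> hs_norm n \<rho> (A - W) \<le> e2 + e2"
    using glue[OF I'] e2 by metis
  have "hs_norm k \<rho> (A - W) \<le> e" if k: "1 \<le> k" "k \<le> n" "rep_onto_matrix_algebra k \<rho>" for k \<rho>
  proof (cases "k = n")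
    case False
    then show ?thesis using W1[of k \<rho>] k e1 by (simp add: e2_def)
  next
    case True
    interpret p: matrix_rep k \<rho> by (rule rep_onto_matrix_rep[OF k(3)])
    have "hs_norm n \<rho> (A - Z) \<le> e2 \<or> (\<exists>s\<in>I'. 1 / 2 < Re (\<rho> (r s) $$ (0, 0)))"
    proof (cases "hs_norm n \<rho> (A - Z) \<le> e2")
      case False
      then have "e2\<^sup>2 \<le> (hs_norm n \<rho> (A - Z))\<^sup>2" using e2 by (intro power_mono) auto
      then have "\<exists>s\<in>I'. 1 / 2 < Re (\<rho> (r s) $$ (0, 0))"
        using p.matrix_rep_axioms p.hs_norm_square[OF saZ] True by (intro cover) auto
      then show ?thesis ..
    qed simp
    then show ?thesis using W2[of \<rho>] k True by (simp add: e2_def)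
  qed
  then show ?thesis using W by blast
qed

lemma approximation:
  fixes A B :: "'a ^ 'm"
  assumes A: "abelian_family A" and B: "abelian_family B" and maj: "A \<prec>\<^sub>t\<^sub>r B"
  shows "n \<le> N \<Longrightarrow> e > 0 \<Longrightarrow> \<exists>Z\<in>orbit_hull B. \<forall>k \<rho>. 1 \<le> k \<longrightarrow> k \<le> n \<longrightarrow> rep_onto_matrix_algebra k \<rho> \<longrightarrow> hs_norm k \<rho> (A - Z) \<le> e"
proof (induction n arbitrary: e)
  case 0
  then show ?case using orbit_hull_base[OF expi_group_one, of B] by auto
next
  case (Suc n)
  show ?case
    by (rule approximation_step[OF A B maj _ Suc.prems]) (use Suc in \<open>auto simp: less_Suc_eq_le\<close>)
qed

section \<open>From uniform estimates in representations to the norm closure\<close>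

lemma closure_if_majorized:
  fixes A B :: "'a ^ 'm"
  assumes A: "abelian_family A" and B: "abelian_family B" and maj: "A \<prec>\<^sub>t\<^sub>r B"
  shows "A \<in> closure (convex hull unitary_orbit B)"
  unfolding closure_approachable
proof (intro allI impI)
  fix e :: real assume e: "e > 0"
  \<comment> \<open>The norm of a tuple is at most the sum of the norms of its components; the
    factor 2 makes the final inequality strict.\<close>
  define d where "d = e / (2 * real CARD('m))"
  have d: "d > 0" using e by (simp add: d_def)
  obtain Z where Z: "Z \<in> orbit_hull B"
    and le: "\<And>k \<rho>. 1 \<le> k \<Longrightarrow> k \<le> N \<Longrightarrow> rep_onto_matrix_algebra k \<rho> \<Longrightarrow> hs_norm k \<rho> (A - Z) \<le> d"
    using approximation[OF A B maj le_refl d] by blast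
  have saB: "sa_tuple B" using B by (rule sa_tuple_intros)
  have sa: "sa_tuple (A - Z)" using sa_tuple_intros(5)[OF A] orbit_hull_sa[OF saB Z] by (rule sa_tuple_intros)
  \<comment> \<open>Each eigenvalue of a component is a diagonal entry in a suitable basis and is
    dominated by the Hilbert-Schmidt norm, which does not change with the basis. Faithfulness of
    \<open>R\<close> turns the eigenvalue bounds into a norm bound.\<close>
  have comp: "norm ((A - Z) $ i) \<le> d" for i
  proof (rule norm_self_adjoint_le)
    show "self_adjoint ((A - Z) $ i)" using sa by (simp add: sa_tuple_def)
    fix \<pi> n assume pi: "\<pi> \<in> R" "n \<le> N" "rep_onto_matrix_algebra n \<pi>"
    interpret p: matrix_rep n \<pi> by (rule rep_onto_matrix_rep[OF pi(3)])
    obtain U where U: "unitary_mat n U" "diagonal_mat (mat_adjoint U * \<pi> ((A - Z) $ i) * U)"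
      using p.diagonalize_single[of "(A - Z) $ i"] sa by (auto simp: sa_tuple_def)
    define \<rho> where "\<rho> x = mat_adjoint U * \<pi> x * U" for x
    have r: "\<rho> = (\<lambda>x. mat_adjoint U * \<pi> x * U)" by (simp add: \<rho>_def fun_eq_iff)
    interpret r: matrix_rep n \<rho> unfolding r by (rule p.conj_rep[OF U(1)])
    have "cmod (\<rho> ((A - Z) $ i) $$ (j, j)) \<le> d" if j: "j < n" for j
    proof -
      have "cmod (\<rho> ((A - Z) $ i) $$ (j, j)) \<le> hs_norm n \<rho> (A - Z)"
        using member_le_L2_set[of "UNIV \<times> {..<n} \<times> {..<n}" "(i, j, j)"
            "\<lambda>(i, j, k). cmod (\<rho> ((A - Z) $ i) $$ (j, k))"] j
        by (simp add: hs_norm_def)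
      also have "hs_norm n \<rho> (A - Z) = hs_norm n \<pi> (A - Z)"
      proof (rule power2_eq_imp_eq[OF _ r.hs_norm_nonneg p.hs_norm_nonneg])
        show "(hs_norm n \<rho> (A - Z))\<^sup>2 = (hs_norm n \<pi> (A - Z))\<^sup>2"
          unfolding r.hs_norm_square[OF sa] p.hs_norm_square[OF sa] unfolding \<rho>_def p.conj_mtr[OF U(1)] ..
      qed
      also have "\<dots> \<le> d" using le[OF _ pi(2,3)] j by simp
      finally show ?thesis .
    qed
    then show "\<exists>U. unitary_mat n U \<and> diagonal_mat (mat_adjoint U * \<pi> ((A - Z) $ i) * U) \<and>
        (\<forall>j<n. cmod ((mat_adjoint U * \<pi> ((A - Z) $ i) * U) $$ (j, j)) \<le> d)"
      using U unfolding \<rho>_def by blast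
  qed
  have "norm (A - Z) \<le> (\<Sum>i\<in>UNIV. norm ((A - Z) $ i))"
    unfolding norm_vec_def by (rule L2_set_le_sum) simp
  also have "\<dots> \<le> (\<Sum>i\<in>(UNIV :: 'm set). d)" by (rule sum_mono) (rule comp)
  also have "\<dots> = e / 2" by (simp add: d_def)
  also have "\<dots> < e" using e by simp
  finally show "\<exists>y\<in>convex hull unitary_orbit B. dist y A < e"
    using Z orbit_hull_subset by (metis dist_commute dist_norm subsetD)
qed

end

theorem theorem6p4:
  fixes A B :: "('a::unital_cstar_algebra) ^ 'm"
  assumes "separable_space (euclidean :: 'a topology)"
    and "subhomogeneous TYPE('a)"
    and "abelian_family A"
    and "abelian_family B"
  shows "A \<prec>\<^sub>t\<^sub>r B \<longleftrightarrow> A \<in> closure (convex hull unitary_orbit B)"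
proof -
  obtain N and R :: "('a \<Rightarrow> complex mat) set"
    where "\<forall>\<pi>\<in>R. \<exists>n. 1 \<le> n \<and> n \<le> N \<and> rep_onto_matrix_algebra n \<pi>" "inj (direct_sum_rep R)"
    using assms(2) unfolding subhomogeneous_def by blast
  then interpret subhom N R by unfold_locales auto
  show ?thesis
    using closure_if_majorized majorized_if_closure assms(3,4) by blast
qed

end
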